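(* Let $M$ be a closed connected manifold and let $L:TM\times\mathbb{R}\to\mathbb{R}$ be a $C^\infty$ Lagrangian that is convex, superlinear, $1$-periodic in time and complete, with Hamiltonian $H$ and critical value $c(L)$. Let $k\in\mathbb{R}$. If $u:M\times\mathbb{S}^1\to\mathbb{R}$ is a $C^{1+\mathrm{Lip}}$ function (i.e. $C^1$ with Lipschitz derivative) which is a global solution of the Hamilton-Jacobi equation $u_t+H(x,u_x,t)=k$ on $M\times\mathbb{S}^1$, then $k=c(L)$ and $u$ is a weak KAM solution in $\mathcal{S}^-\cap\mathcal{S}^+$.
   Context: $\mathbb{S}^1=\mathbb{R}/\mathbb{Z}$, and $[t]\in\mathbb{S}^1$ is the class of $t\in\mathbb{R}$. Assumptions on $L$: (convex) $L$ restricted to each $T_xM$, in linear coordinates, has positive definite Hessian; (superlinear) for some Riemannian metric $\lim_{|v|\to\infty}L(x,v,t)/|v|=\infty$ uniformly in $x,t$; (periodic) $L(x,v,t+1)=L(x,v,t)$; (complete) the Euler-Lagrange flow of $L$ is complete. Hamiltonian: $H(x,p,t)=\max_{v\in T_xM}(p\,v-L(x,v,t))$ on $T^*M\times\mathbb{R}$. $u_x$ and $u_t$ are the partial differentials of $u$ in $x\in M$ and $t$. For $k\in\mathbb{R}$ and an absolutely continuous curve $\gamma:[a,b]\to M$, $A_{L+k}(\gamma)=\int_a^b(L(\gamma(\tau),\dot\gamma(\tau),\tau)+k)\,d\tau$. A curve $\gamma:[a,b]\to M$ is closed if $\gamma(a)=\gamma(b)$ and $b-a$ is an integer. Critical value: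 $c=c(L)=\min\{k: A_{L+k}(\gamma)\ge0\text{ for all absolutely continuous closed curves }\gamma\}$. For $(x,[s]),(y,[t])\in M\times\mathbb{S}^1$ and an integer $n\ge0$, let $\mathcal{C}((x,[s]),(y,[t]);n)$ be the set of absolutely continuous curves $\gamma:[a,b]\to M$ with $\gamma(a)=x$, $\gamma(b)=y$, $[a]=[s]$, $[b]=[t]$ and integer part of $b-a$ equal to $n$. Put $\Phi^n_k((x,[s]),(y,[t]))=\min\{A_{L+k}(\gamma):\gamma\in\mathcal{C}((x,[s]),(y,[t]);n)\}$ ($+\infty$ if the set is empty) and $\Phi_k=\inf_{n\ge0}\Phi^n_k$. A function $u:M\times\mathbb{S}^1\to\mathbb{R}$ is dominated ($u\prec L+c$) if $u(y,[t])-u(x,[s])\le\Phi_c((x,[s]),(y,[t]))$ for all $(x,[s]),(y,[t])$. $\mathcal{S}^+$ is the set of forward weak KAM solutions: dominated $u$ such that for every $(x,[s])$ there is a curve $\gamma:[s,\infty)\to M$ with $\gamma(s)=x$ and $u(\gamma(t),[t])-u(x,[s])=A_{L+c}(\gamma|_{[s,t]})$ for all $t>s$. $\mathcal{S}^-$ is the set of backward weak KAM solutions: dominated $u$ such that for every $(x,[s])$ there is a curve $\gamma:(-\infty,s]\to M$ with $\gamma(s)=x$ and $u(x,[s])-u(\gamma(t),[t])=A_{L+c}(\gamma|_{[t,s]})$ for all $t<s$. *)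

theory Defs
  imports "HOL-Analysis.Analysis"
begin

section \<open>The circle\<close>

quotient_type circle = real / "\<lambda>s t :: real. s - t \<in> \<int>"
  morphisms circle_rep circle_of
proof (rule equivpI)
  show "reflp (\<lambda>s t :: real. s - t \<in> \<int>)"
    by (simp add: reflp_def)
  show "symp (\<lambda>s t :: real. s - t \<in> \<int>)"
    unfolding symp_def by (metis Ints_minus minus_diff_eq)
  show "transp (\<lambda>s t :: real. s - t \<in> \<int>)"
    unfolding transp_def by (metis Ints_add diff_add_cancel add_diff_eq)
qed


section \<open>Regularity on open subsets of Euclidean spaces\<close>

text \<open>In the next definitions the set \<open>S\<close> is meant to be open. All partial derivatives up to
  order \<open>n\<close> are obtained by iterating directional derivatives.\<close>

primrec Ck_on :: "nat \<Rightarrow> 'b::euclidean_space set \<Rightarrow> ('b \<Rightarrow> 'c::real_normed_vector) \<Rightarrow> bool" where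
  "Ck_on 0 S f \<longleftrightarrow> continuous_on S f"
| "Ck_on (Suc n) S f \<longleftrightarrow>
     (\<forall>z\<in>S. f differentiable (at z)) \<and> (\<forall>v. Ck_on n S (\<lambda>z. frechet_derivative f (at z) v))"

definition smooth_on :: "'b::euclidean_space set \<Rightarrow> ('b \<Rightarrow> 'c::real_normed_vector) \<Rightarrow> bool" where
  "smooth_on S f \<longleftrightarrow> (\<forall>n. Ck_on n S f)"

text \<open>The Lipschitz condition is local, because it is imposed in charts, whose domains are not
  compact. On a compact manifold this is the same as a derivative that is globally Lipschitz
  with respect to some (equivalently, every) Riemannian metric.\<close>

definition C1_Lip_on :: "'b::euclidean_space set \<Rightarrow> ('b \<Rightarrow> real) \<Rightarrow> bool" where
  "C1_Lip_on S f \<longleftrightarrow>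
     (\<exists>D :: 'b \<Rightarrow> 'b \<Rightarrow>\<^sub>L real.
        (\<forall>z\<in>S. (f has_derivative blinfun_apply (D z)) (at z)) \<and>
        (\<forall>z\<in>S. \<exists>r>0. \<exists>C. C-lipschitz_on (ball z r \<inter> S) D))"

definition hessian :: "('b::euclidean_space \<Rightarrow> real) \<Rightarrow> 'b \<Rightarrow> 'b \<Rightarrow> 'b \<Rightarrow> real" where
  "hessian f z v w = frechet_derivative (\<lambda>y. frechet_derivative f (at y) w) (at z) v"

definition abs_continuous_on :: "real \<Rightarrow> real \<Rightarrow> (real \<Rightarrow> 'b::real_normed_vector) \<Rightarrow> bool" where
  "abs_continuous_on a b f \<longleftrightarrow>
     (\<forall>\<epsilon>>0. \<exists>\<delta>>0. \<forall>(n::nat) s t.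
        (\<forall>i<n. a \<le> s i \<and> s i \<le> t i \<and> t i \<le> b) \<and>
        disjoint_family_on (\<lambda>i. {s i<..<t i}) {..<n} \<and>
        (\<Sum>i<n. t i - s i) < \<delta>
        \<longrightarrow> (\<Sum>i<n. norm (f (t i) - f (s i))) < \<epsilon>)"


section \<open>Smooth manifolds and tangent vectors\<close>

text \<open>The manifold is the whole type \<open>'a\<close>; its dimension is \<open>DIM('e)\<close>, hence positive. A chart is a pair of its domain and its coordinate map;
  the values of the coordinate map outside the domain are irrelevant.\<close>

type_synonym ('a, 'e) chart = "'a set \<times> ('a \<Rightarrow> 'e)"

abbreviation chart_inv :: "('a, 'e) chart \<Rightarrow> 'e \<Rightarrow> 'a" where
  "chart_inv c \<equiv> inv_into (fst c) (snd c)"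

abbreviation chart_image :: "('a, 'e) chart \<Rightarrow> 'e set" where
  "chart_image c \<equiv> snd c ` fst c"

definition smooth_atlas :: "('a::t2_space, 'e::euclidean_space) chart set \<Rightarrow> bool" where
  "smooth_atlas A \<longleftrightarrow>
     (\<Union>c\<in>A. fst c) = UNIV \<and>
     (\<forall>c\<in>A. open (fst c) \<and> open (chart_image c) \<and>
        homeomorphism (fst c) (chart_image c) (snd c) (chart_inv c)) \<and>
     (\<forall>c\<in>A. \<forall>d\<in>A. smooth_on (snd c ` (fst c \<inter> fst d)) (snd d \<circ> chart_inv c))"

text \<open>A tangent vector at \<open>x\<close> is the family of its coordinates in all charts around \<open>x\<close>, which are
  related by the derivatives of the transition maps (and, as a normalisation, 0 for the other
  arguments). The coordinates with respect to one chart determine the tangent vector;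
  \<open>tangent_of A c x w\<close> is the tangent vector at \<open>x\<close> with coordinates \<open>w\<close> in the chart \<open>c\<close>.\<close>

type_synonym ('a, 'e) tangent = "('a, 'e) chart \<Rightarrow> 'e"

definition tangent_space ::
    "('a::t2_space, 'e::euclidean_space) chart set \<Rightarrow> 'a \<Rightarrow> ('a, 'e) tangent set" where
  "tangent_space A x =
     {v. (\<forall>c. \<not> (c \<in> A \<and> x \<in> fst c) \<longrightarrow> v c = 0) \<and>
         (\<forall>c\<in>A. \<forall>d\<in>A. x \<in> fst c \<and> x \<in> fst d \<longrightarrow>
            v d = frechet_derivative (snd d \<circ> chart_inv c) (at (snd c x)) (v c))}"

definition tangent_of ::
    "('a::t2_space, 'e::euclidean_space) chart set \<Rightarrow> ('a, 'e) chart \<Rightarrow> 'a \<Rightarrow> 'e \<Rightarrow> ('a, 'e) tangent"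
    where
  "tangent_of A c x w =
     (\<lambda>d. if d \<in> A \<and> x \<in> fst d
          then frechet_derivative (snd d \<circ> chart_inv c) (at (snd c x)) w else 0)"

definition riemannian_metric ::
    "('a::t2_space, 'e::euclidean_space) chart set
       \<Rightarrow> ('a \<Rightarrow> ('a, 'e) tangent \<Rightarrow> ('a, 'e) tangent \<Rightarrow> real) \<Rightarrow> bool" where
  "riemannian_metric A g \<longleftrightarrow>
     (\<forall>c\<in>A.
        (\<forall>x\<in>fst c. bilinear (\<lambda>v w. g x (tangent_of A c x v) (tangent_of A c x w)) \<and>
           (\<forall>v w. g x (tangent_of A c x v) (tangent_of A c x w)
                = g x (tangent_of A c x w) (tangent_of A c x v)) \<and>
           (\<forall>v. v \<noteq> 0 \<longrightarrow> g x (tangent_of A c x v) (tangent_of A c x v) > 0)) \<and>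
        (\<forall>v w. smooth_on (chart_image c)
           (\<lambda>q. g (chart_inv c q) (tangent_of A c (chart_inv c q) v)
                  (tangent_of A c (chart_inv c q) w))))"

text \<open>A curve is a function on all of \<open>real\<close>, of which only the values on the relevant interval
  matter. Its velocity is meaningful wherever it is differentiable, which for an absolutely
  continuous curve on \<open>[a, b]\<close> is almost everywhere.\<close>

definition velocity ::
    "('a::t2_space, 'e::euclidean_space) chart set \<Rightarrow> (real \<Rightarrow> 'a) \<Rightarrow> real \<Rightarrow> ('a, 'e) tangent" where
  "velocity A \<gamma> \<tau> =
     (\<lambda>c. if c \<in> A \<and> \<gamma> \<tau> \<in> fst c then vector_derivative (snd c \<circ> \<gamma>) (at \<tau>) else 0)"

definition ac_curve ::
    "('a::t2_space, 'e::euclidean_space) chart set \<Rightarrow> (real \<Rightarrow> 'a) \<Rightarrow> real \<Rightarrow> real \<Rightarrow> bool" where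
  "ac_curve A \<gamma> a b \<longleftrightarrow>
     a \<le> b \<and> continuous_on {a..b} \<gamma> \<and>
     (\<forall>c\<in>A. \<forall>a' b'. a \<le> a' \<and> a' \<le> b' \<and> b' \<le> b \<and> \<gamma> ` {a'..b'} \<subseteq> fst c
        \<longrightarrow> abs_continuous_on a' b' (snd c \<circ> \<gamma>))"


section \<open>Lagrangians\<close>

type_synonym ('a, 'e) lagrangian = "'a \<Rightarrow> ('a, 'e) tangent \<Rightarrow> real \<Rightarrow> real"

definition local_lagrangian ::
    "('a::t2_space, 'e::euclidean_space) chart set \<Rightarrow> ('a, 'e) lagrangian \<Rightarrow> ('a, 'e) chart
       \<Rightarrow> 'e \<times> 'e \<times> real \<Rightarrow> real" where
  "local_lagrangian A L c =
     (\<lambda>(q, w, t). L (chart_inv c q) (tangent_of A c (chart_inv c q) w) t)"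

definition smooth_lagrangian ::
    "('a::t2_space, 'e::euclidean_space) chart set \<Rightarrow> ('a, 'e) lagrangian \<Rightarrow> bool" where
  "smooth_lagrangian A L \<longleftrightarrow>
     (\<forall>c\<in>A. smooth_on (chart_image c \<times> UNIV \<times> UNIV) (local_lagrangian A L c))"

definition convex_lagrangian ::
    "('a::t2_space, 'e::euclidean_space) chart set \<Rightarrow> ('a, 'e) lagrangian \<Rightarrow> bool" where
  "convex_lagrangian A L \<longleftrightarrow>
     (\<forall>c\<in>A. \<forall>q\<in>chart_image c. \<forall>w t. \<forall>h. h \<noteq> 0 \<longrightarrow>
        hessian (\<lambda>w. local_lagrangian A L c (q, w, t)) w h h > 0)"

definition superlinear_lagrangian ::
    "('a::t2_space, 'e::euclidean_space) chart set \<Rightarrow> ('a, 'e) lagrangian \<Rightarrow> bool" where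
  "superlinear_lagrangian A L \<longleftrightarrow>
     (\<exists>g. riemannian_metric A g \<and>
        (\<forall>K. \<exists>R>0. \<forall>x. \<forall>v\<in>tangent_space A x. \<forall>t.
           sqrt (g x v v) > R \<longrightarrow> L x v t / sqrt (g x v v) > K))"

definition periodic_lagrangian ::
    "('a::t2_space, 'e::euclidean_space) chart set \<Rightarrow> ('a, 'e) lagrangian \<Rightarrow> bool" where
  "periodic_lagrangian A L \<longleftrightarrow> (\<forall>x. \<forall>v\<in>tangent_space A x. \<forall>t. L x v (t + 1) = L x v t)"

text \<open>The Euler-Lagrange equation \<open>d/dt (\<partial>L/\<partial>v) = \<partial>L/\<partial>x\<close> in every chart, tested against an arbitrary
  vector \<open>h\<close>, for a curve defined on the whole real line.\<close>

definition euler_lagrange ::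
    "('a::t2_space, 'e::euclidean_space) chart set \<Rightarrow> ('a, 'e) lagrangian \<Rightarrow> (real \<Rightarrow> 'a) \<Rightarrow> bool"
    where
  "euler_lagrange A L \<gamma> \<longleftrightarrow>
     continuous_on UNIV \<gamma> \<and>
     (\<forall>\<tau>. \<forall>c\<in>A. \<gamma> \<tau> \<in> fst c \<longrightarrow>
        (let q = snd c \<circ> \<gamma>; w = (\<lambda>\<sigma>. vector_derivative q (at \<sigma>)) in
           q differentiable (at \<tau>) \<and>
           (\<forall>h. ((\<lambda>\<sigma>. frechet_derivative (\<lambda>v. local_lagrangian A L c (q \<sigma>, v, \<sigma>)) (at (w \<sigma>)) h)
                  has_real_derivative
                  frechet_derivative (\<lambda>y. local_lagrangian A L c (y, w \<tau>, \<tau>)) (at (q \<tau>)) h)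
                (at \<tau>))))"

definition complete_lagrangian ::
    "('a::t2_space, 'e::euclidean_space) chart set \<Rightarrow> ('a, 'e) lagrangian \<Rightarrow> bool" where
  "complete_lagrangian A L \<longleftrightarrow>
     (\<forall>x. \<forall>v\<in>tangent_space A x. \<forall>s.
        \<exists>\<gamma>. euler_lagrange A L \<gamma> \<and> \<gamma> s = x \<and> velocity A \<gamma> s = v)"

text \<open>Here \<open>p\<close> is a covector at \<open>x\<close>, that is, a linear function on the tangent space at \<open>x\<close>.\<close>

definition hamiltonian ::
    "('a::t2_space, 'e::euclidean_space) chart set \<Rightarrow> ('a, 'e) lagrangian
       \<Rightarrow> 'a \<Rightarrow> (('a, 'e) tangent \<Rightarrow> real) \<Rightarrow> real \<Rightarrow> real" where
  "hamiltonian A L x p t = (GREATEST h. \<exists>v\<in>tangent_space A x. h = p v - L x v t)"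


section \<open>Action, critical value and action potential\<close>

text \<open>For the Lagrangians considered here the integrand is measurable and bounded below along every
  absolutely continuous curve, so the only alternative to integrability is the value \<open>\<infinity>\<close>.\<close>

definition action ::
    "('a::t2_space, 'e::euclidean_space) chart set \<Rightarrow> ('a, 'e) lagrangian \<Rightarrow> real
       \<Rightarrow> (real \<Rightarrow> 'a) \<Rightarrow> real \<Rightarrow> real \<Rightarrow> ereal" where
  "action A L k \<gamma> a b =
     (let f = (\<lambda>\<tau>. L (\<gamma> \<tau>) (velocity A \<gamma> \<tau>) \<tau> + k) in
        if f absolutely_integrable_on {a..b} then ereal (integral {a..b} f) else \<infinity>)"

definition critical_value ::
    "('a::t2_space, 'e::euclidean_space) chart set \<Rightarrow> ('a, 'e) lagrangian \<Rightarrow> real" where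
  "critical_value A L =
     (LEAST k. \<forall>\<gamma> a b. ac_curve A \<gamma> a b \<and> \<gamma> a = \<gamma> b \<and> b - a \<in> \<int> \<longrightarrow> action A L k \<gamma> a b \<ge> 0)"

definition connecting_curves ::
    "('a::t2_space, 'e::euclidean_space) chart set \<Rightarrow> 'a \<times> circle \<Rightarrow> 'a \<times> circle \<Rightarrow> nat
       \<Rightarrow> ((real \<Rightarrow> 'a) \<times> real \<times> real) set" where
  "connecting_curves A X Y n =
     {(\<gamma>, a, b). ac_curve A \<gamma> a b \<and> \<gamma> a = fst X \<and> \<gamma> b = fst Y \<and>
        circle_of a = snd X \<and> circle_of b = snd Y \<and> \<lfloor>b - a\<rfloor> = int n}"

text \<open>The minimum is written as an infimum in the extended reals, which is \<open>\<infinity>\<close> for the empty set.\<close>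

definition action_potential_n ::
    "('a::t2_space, 'e::euclidean_space) chart set \<Rightarrow> ('a, 'e) lagrangian \<Rightarrow> real \<Rightarrow> nat
       \<Rightarrow> 'a \<times> circle \<Rightarrow> 'a \<times> circle \<Rightarrow> ereal" where
  "action_potential_n A L k n X Y =
     (INF (\<gamma>, a, b) \<in> connecting_curves A X Y n. action A L k \<gamma> a b)"

definition action_potential ::
    "('a::t2_space, 'e::euclidean_space) chart set \<Rightarrow> ('a, 'e) lagrangian \<Rightarrow> real
       \<Rightarrow> 'a \<times> circle \<Rightarrow> 'a \<times> circle \<Rightarrow> ereal" where
  "action_potential A L k X Y = (INF n. action_potential_n A L k n X Y)"


section \<open>Weak KAM solutions\<close>

definition dominated ::
    "('a::t2_space, 'e::euclidean_space) chart set \<Rightarrow> ('a, 'e) lagrangian \<Rightarrow> real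
       \<Rightarrow> ('a \<times> circle \<Rightarrow> real) \<Rightarrow> bool" where
  "dominated A L c u \<longleftrightarrow> (\<forall>X Y. ereal (u Y - u X) \<le> action_potential A L c X Y)"

definition forward_weak_KAM ::
    "('a::t2_space, 'e::euclidean_space) chart set \<Rightarrow> ('a, 'e) lagrangian
       \<Rightarrow> ('a \<times> circle \<Rightarrow> real) set" where
  "forward_weak_KAM A L =
     {u. dominated A L (critical_value A L) u \<and>
         (\<forall>x s. \<exists>\<gamma>. \<gamma> s = x \<and>
            (\<forall>t>s. ac_curve A \<gamma> s t \<and>
               ereal (u (\<gamma> t, circle_of t) - u (x, circle_of s))
                 = action A L (critical_value A L) \<gamma> s t))}"

definition backward_weak_KAM ::
    "('a::t2_space, 'e::euclidean_space) chart set \<Rightarrow> ('a, 'e) lagrangian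
       \<Rightarrow> ('a \<times> circle \<Rightarrow> real) set" where
  "backward_weak_KAM A L =
     {u. dominated A L (critical_value A L) u \<and>
         (\<forall>x s. \<exists>\<gamma>. \<gamma> s = x \<and>
            (\<forall>t<s. ac_curve A \<gamma> t s \<and>
               ereal (u (x, circle_of s) - u (\<gamma> t, circle_of t))
                 = action A L (critical_value A L) \<gamma> t s))}"


section \<open>The Hamilton-Jacobi equation\<close>

definition C1_Lip ::
    "('a::t2_space, 'e::euclidean_space) chart set \<Rightarrow> ('a \<times> circle \<Rightarrow> real) \<Rightarrow> bool" where
  "C1_Lip A u \<longleftrightarrow>
     (\<forall>c\<in>A. C1_Lip_on (chart_image c \<times> UNIV) (\<lambda>(q, t). u (chart_inv c q, circle_of t)))"

text \<open>The partial differential in the manifold variable does not depend on the choice of the chart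
  in which it is computed, provided the function is differentiable.\<close>

definition diff_x ::
    "('a::t2_space, 'e::euclidean_space) chart set \<Rightarrow> ('a \<times> circle \<Rightarrow> real)
       \<Rightarrow> 'a \<Rightarrow> circle \<Rightarrow> ('a, 'e) tangent \<Rightarrow> real" where
  "diff_x A u x \<theta> v =
     (let c = (SOME c. c \<in> A \<and> x \<in> fst c) in
        frechet_derivative (\<lambda>q. u (chart_inv c q, \<theta>)) (at (snd c x)) (v c))"

definition hamilton_jacobi ::
    "('a::t2_space, 'e::euclidean_space) chart set \<Rightarrow> ('a, 'e) lagrangian \<Rightarrow> real
       \<Rightarrow> ('a \<times> circle \<Rightarrow> real) \<Rightarrow> bool" where
  "hamilton_jacobi A L k u \<longleftrightarrow>
     (\<forall>x t. deriv (\<lambda>s. u (x, circle_of s)) t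
              + hamiltonian A L x (diff_x A u x (circle_of t)) t = k)"

end

theory Submission
  imports Defs "HOL-Complex_Analysis.Great_Picard"
begin

text \<open>The Hamilton-Jacobi equation and the definition of \<open>H\<close> as a Legendre transform say that, at every
  \<open>(x, t)\<close>, the function \<open>gap x t v = L(x, v, t) + k - u_t - u_x v\<close> of the velocity \<open>v\<close> is nonnegative and
  attains the value 0 (\<open>gap_minimum\<close>); by strict convexity it does so at exactly one velocity \<open>X(x, t)\<close>
  (\<open>gap_zero_unique\<close>). Everything follows by integrating this along curves, because
  \<open>u_t + u_x v\<close> is the derivative of \<open>u\<close> along a curve with velocity \<open>v\<close>.

  Along an absolutely continuous curve the derivative of \<open>u\<close> is at most \<open>L + k\<close> at almost every time, so
  the increment of \<open>u\<close> is at most the action: \<open>u\<close> is dominated, with the constant \<open>k\<close>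
  (\<open>increment_le_action\<close>). This rests on two facts about absolutely continuous functions: they are
  differentiable almost everywhere (\<open>abs_continuous_on_differentiable_ae\<close>), and their increments are at
  most the integral of any integrable upper bound of the derivative (\<open>abs_continuous_on_le_integral\<close>).

  Along an integral curve of \<open>X\<close> the derivative of \<open>u\<close> equals \<open>L + k\<close>, so the curve is
  calibrated (\<open>calibrated_curve_action\<close>). The field \<open>X\<close> is continuous, since it is the unique zero of a
  continuous function and coercivity of \<open>L\<close> keeps it locally bounded (\<open>calibrated_velocity_field\<close>). Peano's theorem
  together with the compactness of \<open>M\<close> and the periodicity in time therefore gives integral curves on whole
  half-lines in both time directions. This produces the curves required of a weak KAM solution.

  Domination applied to closed curves gives \<open>c(L) \<le> k\<close>. Conversely, a calibrated curve on \<open>[0, \<infinity>)\<close>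
  returns, at infinitely many integer times, to one coordinate ball, where a coordinate segment of bounded action
  closes it up. The \<open>(L + k')\<close>-action of the resulting closed curve is a bounded quantity plus \<open>k' - k\<close> times its
  length, and this is negative for long curves if \<open>k' < k\<close>; hence \<open>c(L) = k\<close> (\<open>critical_value_eq\<close>).\<close>


section \<open>Absolutely continuous functions and their integrated derivative\<close>

text \<open>Arbitrary finite index sets allow the members of a division or of a Vitali cover to serve as their own
  indices.\<close>

lemma abs_continuous_on_finite_family:
  assumes "abs_continuous_on a b f" "\<epsilon> > 0"
  obtains \<delta> where "\<delta> > 0"
    "\<And>(I::'i set) s t. finite I \<Longrightarrow> (\<And>i. i \<in> I \<Longrightarrow> a \<le> s i \<and> s i \<le> t i \<and> t i \<le> b)
       \<Longrightarrow> (\<And>i j. i \<in> I \<Longrightarrow> j \<in> I \<Longrightarrow> i \<noteq> j \<Longrightarrow> {s i<..<t i} \<inter> {s j<..<t j} = {})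
       \<Longrightarrow> (\<Sum>i\<in>I. t i - s i) < \<delta> \<Longrightarrow> (\<Sum>i\<in>I. norm (f (t i) - f (s i))) < \<epsilon>"
proof -
  obtain \<delta> where "\<delta> > 0" and \<delta>: "\<And>(n::nat) s t. (\<forall>i<n. a \<le> s i \<and> s i \<le> t i \<and> t i \<le> b) \<Longrightarrow>
        disjoint_family_on (\<lambda>i. {s i<..<t i}) {..<n} \<Longrightarrow>
        (\<Sum>i<n. t i - s i) < \<delta> \<Longrightarrow> (\<Sum>i<n. norm (f (t i) - f (s i))) < \<epsilon>"
    using assms unfolding abs_continuous_on_def by meson
  show thesis
  proof (rule that[OF \<open>\<delta> > 0\<close>])
    fix I :: "'i set" and s t
    assume I: "finite I" "\<And>i. i \<in> I \<Longrightarrow> a \<le> s i \<and> s i \<le> t i \<and> t i \<le> b"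
      "\<And>i j. i \<in> I \<Longrightarrow> j \<in> I \<Longrightarrow> i \<noteq> j \<Longrightarrow> {s i<..<t i} \<inter> {s j<..<t j} = {}"
      "(\<Sum>i\<in>I. t i - s i) < \<delta>"
    obtain h where h: "bij_betw h {..<card I} I"
      using ex_bij_betw_nat_finite[OF I(1)] atLeast0LessThan by metis
    have hI: "h i \<in> I" if "i < card I" for i using h that by (auto simp: bij_betw_def)
    have inj: "h i \<noteq> h j" if "i < card I" "j < card I" "i \<noteq> j" for i j
      using h that by (auto simp: bij_betw_def inj_on_def)
    have "(\<Sum>i<card I. norm (f (t (h i)) - f (s (h i)))) < \<epsilon>"
    proof (rule \<delta>)
      show "\<forall>i<card I. a \<le> s (h i) \<and> s (h i) \<le> t (h i) \<and> t (h i) \<le> b" using I hI by blast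
      show "disjoint_family_on (\<lambda>i. {s (h i)<..<t (h i)}) {..<card I}"
        unfolding disjoint_family_on_def using I(3) hI inj by (metis lessThan_iff)
      show "(\<Sum>i<card I. t (h i) - s (h i)) < \<delta>"
        using I(4) sum.reindex_bij_betw[OF h, of "\<lambda>i. t i - s i"] by simp
    qed
    then show "(\<Sum>i\<in>I. norm (f (t i) - f (s i))) < \<epsilon>"
      using sum.reindex_bij_betw[OF h, of "\<lambda>i. norm (f (t i) - f (s i))"] by simp
  qed
qed

lemma abs_continuous_on_imp_continuous_on:
  assumes "abs_continuous_on a b f"
  shows "continuous_on {a..b} f"
proof (rule continuous_onI)
  fix x e :: real assume "x \<in> {a..b}" "e > 0"
  obtain \<delta> where "\<delta> > 0" and
    \<delta>: "\<And>(I::nat set) s t. finite I \<Longrightarrow> (\<And>i. i \<in> I \<Longrightarrow> a \<le> s i \<and> s i \<le> t i \<and> t i \<le> b)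
       \<Longrightarrow> (\<And>i j. i \<in> I \<Longrightarrow> j \<in> I \<Longrightarrow> i \<noteq> j \<Longrightarrow> {s i<..<t i} \<inter> {s j<..<t j} = {})
       \<Longrightarrow> (\<Sum>i\<in>I. t i - s i) < \<delta> \<Longrightarrow> (\<Sum>i\<in>I. norm (f (t i) - f (s i))) < e"
    by (rule abs_continuous_on_finite_family[OF assms \<open>e > 0\<close>]) blast
  have "dist (f y) (f x) \<le> e" if "y \<in> {a..b}" "dist y x < \<delta>" for y
  proof (cases "x \<le> y")
    case True
    then show ?thesis
      using \<delta>[of "{0}" "\<lambda>_. x" "\<lambda>_. y"] that \<open>x \<in> _\<close> by (auto simp: dist_norm)
  next
    case False
    then show ?thesis
      using \<delta>[of "{0}" "\<lambda>_. y" "\<lambda>_. x"] that \<open>x \<in> _\<close> by (auto simp: dist_norm norm_minus_commute)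
  qed
  then show "\<exists>d>0. \<forall>x'\<in>{a..b}. dist x' x < d \<longrightarrow> dist (f x') (f x) \<le> e"
    using \<open>\<delta> > 0\<close> by blast
qed

lemma sum_increments_division:
  fixes f :: "real \<Rightarrow> 'b::real_normed_vector"
  assumes "\<D> division_of {a..b}" "a \<le> b"
  shows "(\<Sum>K\<in>\<D>. f (Sup K) - f (Inf K)) = f b - f a"
proof -
  define p where "p = (\<lambda>K. (Inf K, K)) ` \<D>"
  have K: "\<exists>u v. u \<le> v \<and> K = {u..v}" if "K \<in> \<D>" for K
    using division_ofD(3,4)[OF assms(1) that] by (metis atLeastatMost_empty_iff box_real(2))
  have "p tagged_division_of {a..b}"
    unfolding tagged_division_of
  proof (intro conjI allI impI)
    show "finite p" using assms unfolding p_def by blast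
    fix x k assume "(x, k) \<in> p"
    then have k: "k \<in> \<D>" "x = Inf k" by (auto simp: p_def)
    then show "x \<in> k" using K[OF k(1)] by auto
    show "k \<subseteq> {a..b}" using division_ofD(2)[OF assms(1) k(1)] .
    show "\<exists>a b. k = cbox a b" using division_ofD(4)[OF assms(1) k(1)] .
  next
    fix x1 K1 x2 K2 assume "(x1, K1) \<in> p \<and> (x2, K2) \<in> p \<and> (x1, K1) \<noteq> (x2, K2)"
    then show "interior K1 \<inter> interior K2 = {}"
      using division_ofD(5)[OF assms(1)] by (auto simp: p_def)
  next
    show "\<Union> {K. \<exists>x. (x, K) \<in> p} = {a..b}"
      using division_ofD(6)[OF assms(1)] by (auto simp: p_def image_iff)
  qed
  then have "(\<Sum>(x, K)\<in>p. f (Sup K) - f (Inf K)) = f b - f a"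
    using additive_tagged_division_1[OF assms(2)] by blast
  moreover have "(\<Sum>(x, K)\<in>p. f (Sup K) - f (Inf K)) = (\<Sum>K\<in>\<D>. f (Sup K) - f (Inf K))"
    unfolding p_def by (subst sum.reindex) (auto simp: inj_on_def)
  ultimately show ?thesis by simp
qed

text \<open>Compare \<open>f\<close> with Riemann sums of \<open>g\<close> for a fine tagged division. On the intervals tagged outside \<open>N\<close>
  the increment of \<open>f\<close> is at most \<open>(g x + e)\<close> times the length. The intervals tagged in \<open>N\<close> lie in an open set
  of small measure, where absolute continuity makes the total increment small.\<close>

lemma abs_continuous_on_le_integral:
  fixes f g :: "real \<Rightarrow> real"
  assumes "a \<le> b" and ac: "abs_continuous_on a b f" and g: "g integrable_on {a..b}"
    and N: "negligible N"
    and deriv: "\<And>x. x \<in> {a..b} - N \<Longrightarrow> \<exists>D. (f has_real_derivative D) (at x within {a..b}) \<and> D \<le> g x"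
  shows "f b - f a \<le> integral {a..b} g"
proof -
  define g' where "g' x = (if x \<in> N then 0 else g x)" for x
  define I where "I = integral {a..b} g"
  have gI: "(g' has_integral I) {a..b}"
    unfolding I_def by (rule has_integral_spike[OF N _ integrable_integral[OF g]]) (auto simp: g'_def)
  have main: "f b - f a \<le> I + e * (2 + (b - a))" if "e > 0" for e
  proof -
    obtain d1 where d1: "gauge d1" "\<And>p. p tagged_division_of {a..b} \<Longrightarrow> d1 fine p \<Longrightarrow>
        norm ((\<Sum>(x,K)\<in>p. measure lborel K *\<^sub>R g' x) - I) < e"
      using gI \<open>e > 0\<close> unfolding has_integral_real by metis
    obtain \<delta> where "\<delta> > 0" and
    \<delta>: "\<And>(I::(real \<times> real set) set) s t. finite I \<Longrightarrow> (\<And>i. i \<in> I \<Longrightarrow> a \<le> s i \<and> s i \<le> t i \<and> t i \<le> b)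
       \<Longrightarrow> (\<And>i j. i \<in> I \<Longrightarrow> j \<in> I \<Longrightarrow> i \<noteq> j \<Longrightarrow> {s i<..<t i} \<inter> {s j<..<t j} = {})
       \<Longrightarrow> (\<Sum>i\<in>I. t i - s i) < \<delta> \<Longrightarrow> (\<Sum>i\<in>I. norm (f (t i) - f (s i))) < e"
      by (rule abs_continuous_on_finite_family[OF ac \<open>e > 0\<close>]) blast
    obtain T where T: "open T" "N \<subseteq> T" "T \<in> lmeasurable" "measure lebesgue T < \<delta>"
    proof -
      have Nm: "N \<in> sets lebesgue" "N \<in> null_sets lebesgue"
        using N by (auto simp: negligible_iff_null_sets)
      obtain T where T: "open T" "N \<subseteq> T" "(T - N) \<in> lmeasurable" "emeasure lebesgue (T - N) < ennreal \<delta>"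
        using sets_lebesgue_outer_open[OF Nm(1) \<open>\<delta> > 0\<close>] by blast
      have e: "emeasure lebesgue T = emeasure lebesgue (T - N)"
        using emeasure_Diff_null_set[OF Nm(2), of T] T(1) by (simp add: borel_open)
      have "T \<in> lmeasurable"
        using T e by (auto simp: fmeasurable_def top.not_eq_extremum)
      then show thesis
        using that T e emeasure_eq_measure2[of T lebesgue]
        by (metis (no_types, lifting) \<open>0 < \<delta>\<close> ennreal_less_iff measure_nonneg)
    qed
    have "\<exists>r>0. \<forall>y\<in>{a..b}. \<bar>y - x\<bar> < r \<longrightarrow> 
        (x \<le> y \<longrightarrow> f y - f x \<le> (g x + e) * (y - x)) \<and> (y \<le> x \<longrightarrow> f x - f y \<le> (g x + e) * (x - y))"
      if x: "x \<in> {a..b} - N" for x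
    proof -
      obtain D where D: "(f has_real_derivative D) (at x within {a..b})" "D \<le> g x"
        using deriv[OF x] by blast
      have "(f has_derivative (\<lambda>h. h * D)) (at x within {a..b})"
        using D(1) by (simp add: has_field_derivative_def mult.commute[of D] mult_commute_abs)
      then obtain r where r: "r > 0" "\<And>y. y\<in>{a..b} \<Longrightarrow> norm (y - x) < r \<Longrightarrow> norm (f y - f x - (y - x) * D) \<le> e * norm (y - x)"
        using \<open>e > 0\<close> unfolding has_derivative_within_alt by blast
      show ?thesis
      proof (intro exI[of _ r] conjI ballI impI r(1))
        fix y assume y: "y \<in> {a..b}" "\<bar>y - x\<bar> < r" "x \<le> y"
        have "f y - f x \<le> (D + e) * (y - x)"
          using r(2)[of y] y by (simp add: algebra_simps)
        also have "\<dots> \<le> (g x + e) * (y - x)" using y D(2) by (intro mult_right_mono) auto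
        finally show "f y - f x \<le> (g x + e) * (y - x)" .
      next
        fix y assume y: "y \<in> {a..b}" "\<bar>y - x\<bar> < r" "y \<le> x"
        have "f x - f y \<le> (D + e) * (x - y)"
          using r(2)[of y] y by (simp add: algebra_simps abs_if split: if_splits)
        also have "\<dots> \<le> (g x + e) * (x - y)" using y D(2) by (intro mult_right_mono) auto
        finally show "f x - f y \<le> (g x + e) * (x - y)" .
      qed
    qed
    then obtain r where r: "\<And>x. x \<in> {a..b} - N \<Longrightarrow> r x > 0"
      "\<And>x y. x \<in> {a..b} - N \<Longrightarrow> y\<in>{a..b} \<Longrightarrow> \<bar>y - x\<bar> < r x \<Longrightarrow> x \<le> y \<Longrightarrow> f y - f x \<le> (g x + e) * (y - x)"
      "\<And>x y. x \<in> {a..b} - N \<Longrightarrow> y\<in>{a..b} \<Longrightarrow> \<bar>y - x\<bar> < r x \<Longrightarrow> y \<le> x \<Longrightarrow> f x - f y \<le> (g x + e) * (x - y)"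
      by metis
    \<comment> \<open>The gauge imposes closeness to the integral, containment in \<open>T\<close> at the exceptional tags, and the
      derivative estimate at the other tags.\<close>
    define d where "d x = d1 x \<inter> (if x \<in> N then T else if x \<in> {a..b} then ball x (r x) else UNIV)" for x
    have "gauge d"
      unfolding gauge_def
    proof safe
      fix x
      show "x \<in> d x" using d1(1) T(2) r(1) by (auto simp: d_def gauge_def)
      show "open (d x)" using d1(1) T(1) by (auto simp: d_def gauge_def)
    qed
    then obtain p where p: "p tagged_division_of {a..b}" "d fine p"
      using fine_division_exists_real by blast
    have fin: "finite p" using p(1) by blast
    have K: "\<exists>u v. a \<le> u \<and> u \<le> x \<and> x \<le> v \<and> v \<le> b \<and> K = {u..v} \<and> Inf K = u \<and> Sup K = v \<and> K \<subseteq> d x \<and> measure lborel K = v - u"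
      if xK: "(x, K) \<in> p" for x K
    proof -
      obtain u v where uv: "K = {u..v}" using tagged_division_ofD(4)[OF p(1) xK] by (auto simp: box_real)
      have "x \<in> K" "K \<subseteq> {a..b}" using tagged_division_ofD(2,3)[OF p(1) xK] by auto
      moreover have "K \<subseteq> d x" using p(2) xK by (auto simp: fine_def)
      ultimately show ?thesis using uv by (intro exI[of _ u] exI[of _ v]) auto
    qed
    have int: "interior K = {Inf K<..<Sup K}" if "(x, K) \<in> p" for x K
      using K[OF that] interior_atLeastAtMost_real by metis
    define p1 where "p1 = {(x,K). (x,K) \<in> p \<and> x \<in> N}"
    have p1p: "p1 \<subseteq> p" by (auto simp: p1_def)
    have p1t: "p1 tagged_division_of \<Union>{K. \<exists>x. (x,K) \<in> p1}"
      using p1p p(1) by (auto simp: tagged_division_of intro: finite_subset; blast)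
    have "(\<Sum>(x,K)\<in>p1. Sup K - Inf K) = (\<Sum>(x,K)\<in>p1. measure lborel K)"
    proof (rule sum.cong[OF refl], clarify)
      fix x k assume "(x, k) \<in> p1"
      then have "(x, k) \<in> p" using p1p by auto
      from K[OF this] show "Sup k - Inf k = measure lborel k" by auto
    qed
    also have "\<dots> = sum (measure lborel) (snd ` p1)"
      by (rule sum.over_tagged_division_lemma[OF p1t]) (simp add: content_eq_0_interior)
    also have "\<dots> = sum (measure lebesgue) (snd ` p1)"
    proof (rule sum.cong[OF refl])
      fix k assume "k \<in> snd ` p1"
      then obtain x where "(x, k) \<in> p" using p1p by auto
      then obtain u v where "k = {u..v}" using K by metis
      then have "k \<in> sets lborel" by simp
      then show "measure lborel k = measure lebesgue k" by (simp add: measure_completion)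
    qed
    also have "\<dots> = measure lebesgue (\<Union>{K. \<exists>x. (x,K) \<in> p1})"
      using content_division[OF division_of_tagged_division[OF p1t]] by simp
    also have "\<dots> \<le> measure lebesgue T"
    proof (rule measure_mono_fmeasurable)
      show "\<Union>{K. \<exists>x. (x,K) \<in> p1} \<subseteq> T" 
      proof clarify
        fix y x k assume "(x, k) \<in> p1" "y \<in> k"
        then have "(x, k) \<in> p" "x \<in> N" by (auto simp: p1_def)
        with K[OF this(1)] \<open>y \<in> k\<close> show "y \<in> T" by (auto simp: d_def)
      qed
      show "\<Union>{K. \<exists>x. (x,K) \<in> p1} \<in> sets lebesgue"
        using lmeasurable_division[OF division_of_tagged_division[OF p1t]] by blast
    qed (rule T)
    finally have len: "(\<Sum>(x,K)\<in>p1. Sup K - Inf K) < \<delta>" using T(4) by linarith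
    have "(\<Sum>i\<in>p1. norm (f (Sup (snd i)) - f (Inf (snd i)))) < e"
    proof (rule \<delta>)
      show "finite p1" using fin p1p finite_subset by blast
      show "a \<le> Inf (snd i) \<and> Inf (snd i) \<le> Sup (snd i) \<and> Sup (snd i) \<le> b" if "i \<in> p1" for i
        using K[of "fst i" "snd i"] p1p that by force
      show "{Inf (snd i)<..<Sup (snd i)} \<inter> {Inf (snd j)<..<Sup (snd j)} = {}" if "i \<in> p1" "j \<in> p1" "i \<noteq> j" for i j
      proof -
        have "(fst i, snd i) \<in> p" "(fst j, snd j) \<in> p" using that p1p by auto
        then show ?thesis
          using tagged_division_ofD(5)[OF p(1), of "fst i" "snd i" "fst j" "snd j"]
            int[of "fst i" "snd i"] int[of "fst j" "snd j"] that(3) by (simp add: prod_eq_iff)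
      qed
      show "(\<Sum>i\<in>p1. Sup (snd i) - Inf (snd i)) < \<delta>" using len by (simp add: case_prod_unfold)
    qed
    then have s1: "(\<Sum>(x,K)\<in>p1. f (Sup K) - f (Inf K)) \<le> e"
      using sum_mono[of p1 "\<lambda>(x,K). f (Sup K) - f (Inf K)" "\<lambda>i. norm (f (Sup (snd i)) - f (Inf (snd i)))"]
      by (force simp: case_prod_unfold)
    have s2: "(\<Sum>(x,K)\<in>p - p1. f (Sup K) - f (Inf K)) \<le> (\<Sum>(x,K)\<in>p - p1. measure lborel K * g' x + e * (Sup K - Inf K))"
    proof (rule sum_mono, clarify)
      fix x K assume xK: "(x, K) \<in> p" "(x, K) \<notin> p1"
      then have xN: "x \<notin> N" by (auto simp: p1_def)
      obtain u v where uv: "a \<le> u" "u \<le> x" "x \<le> v" "v \<le> b" "K = {u..v}" "Inf K = u" "Sup K = v" "K \<subseteq> d x" "measure lborel K = v - u"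
        using K[OF xK(1)] by blast
      have x: "x \<in> {a..b} - N" using uv xN by auto
      have b: "u \<in> ball x (r x)" "v \<in> ball x (r x)"
        using uv(2,3,5,8) x by (auto simp: d_def subset_iff)
      have "f v - f x \<le> (g x + e) * (v - x)" "f x - f u \<le> (g x + e) * (x - u)"
        using r(2)[OF x, of v] r(3)[OF x, of u] b uv by (auto simp: dist_real_def abs_minus_commute)
      then show "f (Sup K) - f (Inf K) \<le> measure lborel K * g' x + e * (Sup K - Inf K)"
        using xN uv by (simp add: g'_def algebra_simps)
    qed
    have "f b - f a = (\<Sum>(x,K)\<in>p. f (Sup K) - f (Inf K))"
      using additive_tagged_division_1[OF \<open>a \<le> b\<close> p(1), of f] by simp
    also have "\<dots> = (\<Sum>(x,K)\<in>p - p1. f (Sup K) - f (Inf K)) + (\<Sum>(x,K)\<in>p1. f (Sup K) - f (Inf K))"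
      using sum.subset_diff[OF p1p fin] .
    also have "\<dots> \<le> (\<Sum>(x,K)\<in>p - p1. measure lborel K * g' x + e * (Sup K - Inf K)) + e"
      using s1 s2 by linarith
    also have "(\<Sum>(x,K)\<in>p - p1. measure lborel K * g' x + e * (Sup K - Inf K)) 
       \<le> (\<Sum>(x,K)\<in>p. measure lborel K * g' x + e * (Sup K - Inf K))"
    proof (rule sum_mono2[OF fin])
      fix i assume "i \<in> p - (p - p1)"
      then show "0 \<le> (case i of (x, K) \<Rightarrow> measure lborel K * g' x + e * (Sup K - Inf K))"
        using K[of "fst i" "snd i"] \<open>e > 0\<close> by (auto simp: p1_def g'_def case_prod_unfold)
    qed auto
    also have "\<dots> = (\<Sum>(x,K)\<in>p. measure lborel K *\<^sub>R g' x) + e * (\<Sum>(x,K)\<in>p. Sup K - Inf K)"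
      by (simp add: case_prod_unfold sum.distrib sum_distrib_left)
    also have "(\<Sum>(x,K)\<in>p. Sup K - Inf K) = b - a"
      using additive_tagged_division_1[OF \<open>a \<le> b\<close> p(1), of "\<lambda>x. x"] by simp
    also have "(\<Sum>(x,K)\<in>p. measure lborel K *\<^sub>R g' x) \<le> I + e"
    proof -
      have "d1 fine p" using p(2) by (auto simp: fine_def d_def)
      then show ?thesis using d1(2)[OF p(1)] by (simp add: abs_diff_less_iff)
    qed
    finally show ?thesis by (simp add: algebra_simps)
  qed
  have "f b - f a \<le> I + e" if "e > 0" for e
  proof -
    have "e / (2 + (b - a)) > 0" using that \<open>a \<le> b\<close> by simp
    from main[OF this] show ?thesis using \<open>a \<le> b\<close> by simp
  qed
  then show ?thesis unfolding I_def by (rule field_le_epsilon)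
qed

section \<open>Differentiability almost everywhere of absolutely continuous functions\<close>

text \<open>With \<open>Q\<close> a condition on the slope of a function over \<open>[s, t]\<close>, these are the points where a derivate
  of the function satisfies that condition. Since \<open>x\<close> must be interior to the interval, the set is a
  countable intersection of open sets.\<close>

definition steep_points :: "(real \<Rightarrow> real \<Rightarrow> bool) \<Rightarrow> real set" where
  "steep_points Q = {x. \<forall>d>0. \<exists>s t. s < x \<and> x < t \<and> t - s < d \<and> Q s t}"

lemma steep_points_borel: "steep_points Q \<in> sets borel"
proof -
  define U where "U n = (\<Union>{{s<..<t} | s t. t - s < 1 / Suc n \<and> Q s t})" for n :: nat
  have "steep_points Q = (\<Inter>n. U n)"
  proof (intro set_eqI iffI)
    fix x assume x: "x \<in> steep_points Q"
    show "x \<in> (\<Inter>n. U n)"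
    proof
      fix n
      have "1 / real (Suc n) > 0" by simp
      then obtain s t where "s < x \<and> x < t \<and> t - s < 1 / Suc n \<and> Q s t"
        using x unfolding steep_points_def by blast
      then have "x \<in> {s<..<t}" "{s<..<t} \<in> {{s<..<t} | s t. t - s < 1 / Suc n \<and> Q s t}"
        by auto
      then show "x \<in> U n" unfolding U_def by blast
    qed
  next
    fix x assume x: "x \<in> (\<Inter>n. U n)"
    show "x \<in> steep_points Q"
      unfolding steep_points_def
    proof clarify
      fix d :: real assume "d > 0"
      then obtain n where n: "1 / real (Suc n) < d" using nat_approx_posE by metis
      have "x \<in> U n" using x by blast
      then obtain s t where "s < x" "x < t" "t - s < 1 / Suc n" "Q s t"
        unfolding U_def by auto
      then show "\<exists>s t. s < x \<and> x < t \<and> t - s < d \<and> Q s t"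
        using n by (intro exI[of _ s] exI[of _ t]) linarith
    qed
  qed
  moreover have "open (U n)" for n unfolding U_def by (intro open_Union) auto
  ultimately show ?thesis by auto
qed

text \<open>The intervals with property \<open>Q\<close> inside \<open>G\<close> form a Vitali cover of \<open>E\<close>, so countably many disjoint
  ones cover \<open>E\<close> up to a null set; finitely many of these already capture all but \<open>\<epsilon>\<close> of the measure.\<close>

lemma Vitali_covering_steep_points:
  assumes E: "E \<subseteq> steep_points Q" "E \<in> lmeasurable" and G: "open G" "E \<subseteq> G" "G \<in> lmeasurable" and "\<epsilon> > 0"
  obtains \<C> where "finite \<C>" "\<And>K. K \<in> \<C> \<Longrightarrow> \<exists>s t. s < t \<and> K = {s..t} \<and> Q s t \<and> K \<subseteq> G"
    "pairwise disjnt \<C>" "measure lebesgue E - \<epsilon> \<le> measure lebesgue (E \<inter> \<Union>\<C>)"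
    "(\<Sum>K\<in>\<C>. Sup K - Inf K) = measure lebesgue (\<Union>\<C>)"
    "\<Union>\<C> \<in> lmeasurable" "\<Union>\<C> \<subseteq> G"
proof -
  let ?K = "{(s,t). s < t \<and> Q s t \<and> {s..t} \<subseteq> G}"
  let ?a = "\<lambda>(s,t). (s + t) / 2 :: real" and ?r = "\<lambda>(s,t). (t - s) / 2 :: real"
  have cb: "cball (?a i) (?r i) = {fst i..snd i}" for i
    by (cases i) (auto simp: cball_eq_atLeastAtMost field_simps)
  obtain C where C: "countable C" "C \<subseteq> ?K"
     "pairwise (\<lambda>i j. disjnt (cball (?a i) (?r i)) (cball (?a j) (?r j))) C"
     "negligible (E - (\<Union>i \<in> C. cball (?a i) (?r i)))"
  proof (rule Vitali_covering_theorem_cballs[of ?K ?r E ?a])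
    show "0 < ?r i" if "i \<in> ?K" for i using that by auto
    fix x d :: real assume x: "x \<in> E" "d > 0"
    then obtain e where e: "e > 0" "ball x e \<subseteq> G" using G by (meson open_contains_ball subsetD)
    have "min d e > 0" using e x by auto
    then obtain s t where st: "s < x" "x < t" "t - s < min d e" "Q s t"
      using x E unfolding steep_points_def by blast
    have xc: "x \<in> cball (?a (s,t)) (?r (s,t))" unfolding cb using st by auto
    have "{s..t} \<subseteq> ball x e" using st by (auto simp: dist_real_def)
    then show "\<exists>i. i \<in> ?K \<and> x \<in> cball (?a i) (?r i) \<and> ?r i < d"
      using st e xc by (intro exI[of _ "(s,t)"]) auto
  qed
  let ?D = "(\<lambda>i. E \<inter> {fst i..snd i}) ` C"
  have Dm: "d \<in> lmeasurable" if "d \<in> ?D" for d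
    using that E(2) by (auto intro!: fmeasurable.Int)
  obtain D' where D': "D' \<subseteq> ?D" "finite D'" "measure lebesgue (\<Union>?D) - \<epsilon> < measure lebesgue (\<Union>D')"
  proof (rule measure_countable_Union_approachable[of ?D \<epsilon> "measure lebesgue E"])
    show "measure lebesgue (\<Union>D') \<le> measure lebesgue E" if "D' \<subseteq> ?D" "finite D'" for D'
    proof (rule measure_mono_fmeasurable[OF _ _ E(2)])
      show "\<Union>D' \<subseteq> E" using that by blast
      show "\<Union>D' \<in> sets lebesgue"
        using that Dm by (intro sets.finite_Union) (auto dest: fmeasurableD)
    qed
  qed (use C(1) \<open>\<epsilon> > 0\<close> Dm in auto)
  obtain C' where C': "C' \<subseteq> C" "finite C'" "D' = (\<lambda>i. E \<inter> {fst i..snd i}) ` C'"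
    using finite_subset_image[OF D'(2,1)] by blast
  let ?C = "(\<lambda>i. {fst i..snd i}) ` C'"
  show thesis
  proof (rule that[of ?C])
    show "finite ?C" using C' by simp
    show CK: "\<exists>s t. s < t \<and> K = {s..t} \<and> Q s t \<and> K \<subseteq> G" if K: "K \<in> ?C" for K
    proof -
      obtain i where i: "i \<in> C'" "K = {fst i..snd i}" using K by blast
      then have "i \<in> ?K" using C'(1) C(2) by blast
      then show ?thesis using i(2) by (auto simp: case_prod_unfold)
    qed
    have pw: "pairwise (\<lambda>i j. disjnt {fst i..snd i} {fst j..snd j}) C'"
      using C(3) C'(1) unfolding cb by (rule pairwise_subset)
    then show pw': "pairwise disjnt ?C" by (auto simp: pairwise_def)
    have "measure lebesgue E = measure lebesgue (\<Union>?D)"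
    proof -
      have "E = \<Union>?D \<union> (E - (\<Union>i \<in> C. cball (?a i) (?r i)))" unfolding cb by auto
      moreover have "\<Union>?D \<in> sets lebesgue" using C(1) Dm by (intro sets.countable_Union) (auto dest: fmeasurableD)
      ultimately show ?thesis
        using measure_Un_null_set[of "\<Union>?D" lebesgue "E - (\<Union>i \<in> C. cball (?a i) (?r i))"] C(4) 
        by (simp add: negligible_iff_null_sets)
    qed
    moreover have "\<Union>D' = E \<inter> \<Union>?C" using C'(3) by auto
    ultimately show "measure lebesgue E - \<epsilon> \<le> measure lebesgue (E \<inter> \<Union>?C)" using D'(3) by simp
    have "measure lebesgue (\<Union>?C) = (\<Sum>K\<in>?C. measure lebesgue K)"
    proof (rule measure_negligible_finite_Union)
      show "pairwise (\<lambda>S T. negligible (S \<inter> T)) ?C"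
        by (rule pairwise_mono[OF pw' _ subset_refl]) (simp add: disjnt_def)
    qed (use C' in auto)
    also have "\<dots> = (\<Sum>K\<in>?C. Sup K - Inf K)"
    proof (rule sum.cong[OF refl])
      fix K assume "K \<in> ?C"
      then obtain s t where "K = {s..t}" "s < t" using CK by blast
      then show "measure lebesgue K = Sup K - Inf K" by simp
    qed
    finally show "(\<Sum>K\<in>?C. Sup K - Inf K) = measure lebesgue (\<Union>?C)" by simp
    show "\<Union>?C \<in> lmeasurable" using C'(2) by (intro fmeasurable.finite_UN) auto
    show "\<Union>?C \<subseteq> G" using CK by (metis Union_least)
  qed
qed


text \<open>Let \<open>m\<close> be the measure of this set. Cover it almost exactly by disjoint intervals \<open>C1\<close> of slope less than
  \<open>p\<close>, and then, inside them, by disjoint intervals \<open>C2\<close> of slope greater than \<open>q\<close>. Both families have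
  total length close to \<open>m\<close>, so what \<open>C1\<close> has in addition to \<open>C2\<close> is short, and by absolute continuity
  \<open>f\<close> changes little there. Hence \<open>q m\<close> is at most \<open>p m\<close> up to an arbitrarily small error, which forces
  \<open>m = 0\<close>.\<close>

lemma negligible_derivate_gap:
  fixes f :: "real \<Rightarrow> real"
  assumes "a \<le> b" and ac: "abs_continuous_on a b f" and "p < q"
  shows "negligible (steep_points (\<lambda>s t. a \<le> s \<and> t \<le> b \<and> f t - f s < p * (t - s)) \<inter>
                     steep_points (\<lambda>s t. a \<le> s \<and> t \<le> b \<and> q * (t - s) < f t - f s))"
    (is "negligible (steep_points ?P \<inter> steep_points ?Q)")
proof -
  define E where "E = steep_points ?P \<inter> steep_points ?Q"
  define m where "m = measure lebesgue E"
  have "E \<subseteq> {a..b}" unfolding E_def steep_points_def by (auto dest!: spec[of _ 1])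
  have Em: "E \<in> lmeasurable"
  proof (rule bounded_set_imp_lmeasurable)
    show "bounded E" using \<open>E \<subseteq> {a..b}\<close> bounded_subset bounded_closed_interval by blast
    show "E \<in> sets lebesgue"
      unfolding E_def using steep_points_borel by (intro sets.Int) auto
  qed
  have main: "(q - p) * m \<le> 2 * e" if "e > 0" for e
  proof -
    obtain \<delta> where "\<delta> > 0" and
    \<delta>: "\<And>(I::real set set) s t. finite I \<Longrightarrow> (\<And>i. i \<in> I \<Longrightarrow> a \<le> s i \<and> s i \<le> t i \<and> t i \<le> b)
       \<Longrightarrow> (\<And>i j. i \<in> I \<Longrightarrow> j \<in> I \<Longrightarrow> i \<noteq> j \<Longrightarrow> {s i<..<t i} \<inter> {s j<..<t j} = {})
       \<Longrightarrow> (\<Sum>i\<in>I. t i - s i) < \<delta> \<Longrightarrow> (\<Sum>i\<in>I. norm (f (t i) - f (s i))) < e"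
      by (rule abs_continuous_on_finite_family[OF ac \<open>e > 0\<close>]) blast
    \<comment> \<open>The remainder of \<open>C1\<close> has length at most \<open>3 * \<epsilon>\<close>, which must stay below \<open>\<delta>\<close>; the total lengths of
      \<open>C1\<close> and \<open>C2\<close> are within \<open>\<epsilon>\<close> and \<open>2 * \<epsilon>\<close> of \<open>m\<close>, which explains the second bound.\<close>
    define \<epsilon> where "\<epsilon> = min (\<delta> / 4) (e / (2 * \<bar>q\<bar> + \<bar>p\<bar> + 1))"
    have \<epsilon>: "\<epsilon> > 0" "3 * \<epsilon> < \<delta>" using \<open>\<delta> > 0\<close> \<open>e > 0\<close> unfolding \<epsilon>_def by (auto simp: min_def)
    have \<epsilon>e: "(2 * \<bar>q\<bar> + \<bar>p\<bar>) * \<epsilon> \<le> e"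
    proof -
      have "(2 * \<bar>q\<bar> + \<bar>p\<bar>) * \<epsilon> \<le> (2 * \<bar>q\<bar> + \<bar>p\<bar> + 1) * \<epsilon>" using \<epsilon> by simp
      also have "\<dots> \<le> (2 * \<bar>q\<bar> + \<bar>p\<bar> + 1) * (e / (2 * \<bar>q\<bar> + \<bar>p\<bar> + 1))"
        unfolding \<epsilon>_def by (intro mult_left_mono) auto
      also have "\<dots> = e" by (simp add: add_nonneg_eq_0_iff)
      finally show ?thesis .
    qed
    obtain G where G: "open G" "E \<subseteq> G" "G \<in> lmeasurable" "measure lebesgue G \<le> m + \<epsilon>"
    proof -
      obtain T where T: "open T" "E \<subseteq> T" "(T - E) \<in> lmeasurable" "emeasure lebesgue (T - E) < ennreal \<epsilon>"
        using sets_lebesgue_outer_open[of E \<epsilon>] Em \<epsilon>(1) by (metis fmeasurableD)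
      have "T = E \<union> (T - E)" using T by auto
      then have Tm: "T \<in> lmeasurable" using fmeasurable.Un[OF Em T(3)] by simp
      have "measure lebesgue (T - E) < \<epsilon>"
        using T(3,4) \<epsilon>(1) by (metis emeasure_eq_measure2 ennreal_less_iff measure_nonneg)
      moreover have "measure lebesgue (T - E) = measure lebesgue T - m"
        unfolding m_def using measurable_measure_Diff[OF Tm _ T(2)] Em by auto
      ultimately show thesis using that T Tm by auto
    qed
    obtain C1 where C1: "finite C1" "\<And>K. K \<in> C1 \<Longrightarrow> \<exists>s t. s < t \<and> K = {s..t} \<and> ?P s t \<and> K \<subseteq> G"
      "pairwise disjnt C1" "m - \<epsilon> \<le> measure lebesgue (E \<inter> \<Union>C1)"
      "(\<Sum>K\<in>C1. Sup K - Inf K) = measure lebesgue (\<Union>C1)"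
      and C1m: "\<Union>C1 \<in> lmeasurable" and C1G: "\<Union>C1 \<subseteq> G"
      unfolding m_def
      by (rule Vitali_covering_steep_points[OF _ Em G(1-3) \<epsilon>(1), of ?P]) (auto simp: E_def)
    define M1 where "M1 = measure lebesgue (\<Union>C1)"
    have M1: "m - \<epsilon> \<le> M1" "M1 \<le> m + \<epsilon>"
    proof -
      have "measure lebesgue (E \<inter> \<Union>C1) \<le> M1"
        unfolding M1_def using C1m Em by (intro measure_mono_fmeasurable) auto
      then show "m - \<epsilon> \<le> M1" using C1(4) by linarith
      have "M1 \<le> measure lebesgue G"
        unfolding M1_def by (rule measure_mono_fmeasurable[OF C1G fmeasurableD[OF C1m] G(3)])
      then show "M1 \<le> m + \<epsilon>" using G(4) by linarith
    qed
    define G1 where "G1 = (\<Union>K\<in>C1. interior K)"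
    define E1 where "E1 = E \<inter> G1"
    have "open G1" unfolding G1_def by auto
    have "G1 \<subseteq> \<Union>C1" unfolding G1_def using interior_subset by blast
    have G1m: "G1 \<in> lmeasurable"
    proof (rule fmeasurableI2[OF C1m \<open>G1 \<subseteq> \<Union>C1\<close>])
      show "G1 \<in> sets lebesgue" using \<open>open G1\<close> by (simp add: borel_open)
    qed
    have E1m: "E1 \<in> lmeasurable" unfolding E1_def using Em G1m by (metis fmeasurable.Int)
    have mE1: "m - \<epsilon> \<le> measure lebesgue E1"
    proof -
      define F where "F = (\<Union>K\<in>C1. {Inf K, Sup K})"
      have "F \<in> null_sets lebesgue"
        unfolding negligible_iff_null_sets[symmetric] F_def using C1(1) by (intro negligible_finite) auto
      have "E \<inter> \<Union>C1 \<subseteq> E1 \<union> F"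
      proof
        fix x assume x: "x \<in> E \<inter> \<Union>C1"
        then obtain K where K: "K \<in> C1" "x \<in> K" by auto
        then obtain s t where "s < t" "K = {s..t}" using C1(2) by blast
        with K x show "x \<in> E1 \<union> F" unfolding E1_def F_def G1_def
          by (cases "x = s \<or> x = t") (force intro!: bexI[of _ K])+
      qed
      then have "measure lebesgue (E \<inter> \<Union>C1) \<le> measure lebesgue (E1 \<union> F)"
        using E1m \<open>F \<in> null_sets lebesgue\<close> Em C1m
        by (intro measure_mono_fmeasurable) (auto intro: fmeasurable.Un null_setsD2 fmeasurableI_null_sets)
      also have "\<dots> = measure lebesgue E1"
        using E1m \<open>F \<in> null_sets lebesgue\<close> by (intro measure_Un_null_set) auto
      finally show ?thesis using C1(4) by linarith
    qed
    obtain C2 where C2: "finite C2" "\<And>K. K \<in> C2 \<Longrightarrow> \<exists>s t. s < t \<and> K = {s..t} \<and> ?Q s t \<and> K \<subseteq> G1"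
      "pairwise disjnt C2" "measure lebesgue E1 - \<epsilon> \<le> measure lebesgue (E1 \<inter> \<Union>C2)"
      "(\<Sum>K\<in>C2. Sup K - Inf K) = measure lebesgue (\<Union>C2)"
      and C2m: "\<Union>C2 \<in> lmeasurable" and C2G: "\<Union>C2 \<subseteq> G1"
      by (rule Vitali_covering_steep_points[OF _ E1m \<open>open G1\<close> _ G1m \<epsilon>(1), of ?Q]) (auto simp: E1_def E_def)
    define M2 where "M2 = measure lebesgue (\<Union>C2)"
    have M2: "m - 2 * \<epsilon> \<le> M2" "M2 \<le> M1"
    proof -
      have "measure lebesgue (E1 \<inter> \<Union>C2) \<le> M2"
        unfolding M2_def using C2m E1m by (intro measure_mono_fmeasurable) auto
      then show "m - 2 * \<epsilon> \<le> M2" using C2(4) mE1 by linarith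
      have "\<Union>C2 \<subseteq> \<Union>C1" using C2G \<open>G1 \<subseteq> \<Union>C1\<close> by (rule order_trans)
      then show "M2 \<le> M1"
        unfolding M2_def M1_def by (rule measure_mono_fmeasurable[OF _ fmeasurableD[OF C2m] C1m])
    qed
    have "C1 division_of \<Union>C1"
      unfolding division_of_def
    proof (intro conjI ballI impI)
      fix K assume "K \<in> C1"
      then obtain s t where st: "s < t" "K = {s..t}" using C1(2) by blast
      then show "K \<noteq> {}" by auto
      show "\<exists>a b. K = cbox a b" unfolding st box_real by blast
    next
      fix K1 K2 assume "K1 \<in> C1" "K2 \<in> C1" "K1 \<noteq> K2"
      then have "K1 \<inter> K2 = {}" using C1(3) by (auto simp: pairwise_def disjnt_def)
      then show "interior K1 \<inter> interior K2 = {}" using interior_subset by blast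
    qed (use C1(1) in auto)
    moreover have "\<Union>C1 \<subseteq> cbox a b"
    proof (rule Union_least)
      fix K assume "K \<in> C1"
      then obtain s t where "K = {s..t}" "?P s t" using C1(2) by blast
      then show "K \<subseteq> cbox a b" by (auto simp: box_real)
    qed
    ultimately obtain A where A: "C1 \<subseteq> A" "A division_of cbox a b"
      by (rule partial_division_extend_interval)
    \<comment> \<open>Both \<open>A\<close> and an extension \<open>B\<close> of \<open>B0\<close> divide \<open>[a, b]\<close>, and they share the intervals outside \<open>C1\<close>. So the
      increments over \<open>C1\<close> are those over \<open>C2\<close> plus those over the remaining intervals \<open>R\<close>.\<close>
    define B0 where "B0 = C2 \<union> (A - C1)"
    have int0: "interior K2 \<inter> interior K = {}" if "K2 \<in> C2" "K \<in> A - C1" for K2 K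
    proof -
      have "interior K2 \<subseteq> G1" using that(1) C2(2) interior_subset by (meson order_trans)
      moreover have "interior K \<inter> interior K1 = {}" if "K1 \<in> C1" for K1
        using division_ofD(5)[OF A(2), of K K1] \<open>K \<in> A - C1\<close> that A(1) by blast
      ultimately show ?thesis unfolding G1_def by blast
    qed
    have disj: "C2 \<inter> (A - C1) = {}"
    proof -
      have "interior K \<noteq> {}" if "K \<in> C2" for K using C2(2)[OF that] by auto
      then show ?thesis using int0 by (metis Int_absorb disjoint_iff)
    qed
    have C2int: "K \<noteq> {}" "\<exists>s t. K = cbox s t" if K: "K \<in> C2" for K
    proof -
      obtain s t where st: "s < t" "K = {s..t}" using C2(2)[OF K] by blast
      then show "K \<noteq> {}" by auto
      show "\<exists>s t. K = cbox s t" using st unfolding box_real by blast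
    qed
    have "B0 division_of \<Union>B0"
      unfolding division_of_def
    proof (intro conjI ballI impI)
      show "finite B0" using A(2) C2(1) unfolding B0_def by auto
      fix K assume K: "K \<in> B0"
      show "K \<noteq> {}" "\<exists>a b. K = cbox a b"
        using K C2int[of K] division_ofD(3,4)[OF A(2), of K] unfolding B0_def by blast+
    next
      fix K1 K2 assume K12: "K1 \<in> B0" "K2 \<in> B0" "K1 \<noteq> K2"
      have "interior K1 \<inter> interior K2 = {}" if "K1 \<in> C2" "K2 \<in> C2"
      proof -
        have "K1 \<inter> K2 = {}" using that C2(3) K12(3) by (auto simp: pairwise_def disjnt_def)
        then show "interior K1 \<inter> interior K2 = {}" using interior_subset by blast
      qed
      then show "interior K1 \<inter> interior K2 = {}"
        using K12 int0 division_ofD(5)[OF A(2), of K1 K2] unfolding B0_def by blast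
    qed auto
    moreover have "\<Union>B0 \<subseteq> cbox a b"
    proof -
      have "K \<subseteq> {a..b}" if K: "K \<in> C2" for K
      proof -
        obtain s t where "K = {s..t}" "?Q s t" using C2(2)[OF K] by blast
        then show ?thesis by auto
      qed
      moreover have "K \<subseteq> {a..b}" if "K \<in> A" for K
        using division_ofD(2)[OF A(2) that] unfolding box_real .
      ultimately show ?thesis unfolding B0_def box_real by blast
    qed
    ultimately obtain B where B: "B0 \<subseteq> B" "B division_of cbox a b"
      by (rule partial_division_extend_interval)
    define R where "R = B - B0"
    have decomp: "(\<Sum>K\<in>C1. g (Sup K) - g (Inf K)) 
        = (\<Sum>K\<in>C2. g (Sup K) - g (Inf K)) + (\<Sum>K\<in>R. g (Sup K) - g (Inf K))" for g :: "real \<Rightarrow> real"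
    proof -
      let ?S = "sum (\<lambda>K. g (Sup K) - g (Inf K))"
      have "?S A = g b - g a" "?S B = g b - g a"
        using sum_increments_division A(2) B(2) \<open>a \<le> b\<close> unfolding box_real by blast+
      moreover have "?S A = ?S (A - C1) + ?S C1"
        using A by (intro sum.subset_diff) auto
      moreover have "?S B = ?S R + ?S B0"
        unfolding R_def using B by (intro sum.subset_diff) auto
      moreover have "?S B0 = ?S C2 + ?S (A - C1)"
        unfolding B0_def using C2(1) A(2) disj by (intro sum.union_disjoint) auto
      ultimately show ?thesis by linarith
    qed
    have KR: "\<exists>s t. a \<le> s \<and> s \<le> t \<and> t \<le> b \<and> K = {s..t}" if KB: "K \<in> B" for K
    proof -
      obtain s t where st: "K = {s..t}" using division_ofD(4)[OF B(2) KB] unfolding box_real by blast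
      have "{s..t} \<subseteq> {a..b}" "{s..t} \<noteq> {}" using division_ofD(2,3)[OF B(2) KB] st unfolding box_real by auto
      then show ?thesis using st by (intro exI[of _ s] exI[of _ t]) auto
    qed
    have "(\<Sum>K\<in>R. norm (f (Sup K) - f (Inf K))) < e"
    proof (rule \<delta>)
      show "finite R" using B(2) unfolding R_def by auto
      show "a \<le> Inf K \<and> Inf K \<le> Sup K \<and> Sup K \<le> b" if "K \<in> R" for K
        using KR[of K] that unfolding R_def by auto
      show "{Inf K<..<Sup K} \<inter> {Inf J<..<Sup J} = {}" if KJ: "K \<in> R" "J \<in> R" "K \<noteq> J" for K J
      proof -
        obtain s t s' t' where st: "s \<le> t" "s' \<le> t'" "K = {s..t}" "J = {s'..t'}"
          using KR[of K] KR[of J] KJ(1,2) unfolding R_def by blast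
        have "interior K \<inter> interior J = {}"
          using division_ofD(5)[OF B(2)] KJ unfolding R_def by auto
        then show ?thesis using st(1,2) unfolding st(3,4) by simp
      qed
      show "(\<Sum>K\<in>R. Sup K - Inf K) < \<delta>"
        using decomp[of "\<lambda>x. x"] C1(5) C2(5) M1 M2 \<epsilon>(2) unfolding M1_def M2_def by simp
    qed
    moreover have "\<bar>\<Sum>K\<in>R. f (Sup K) - f (Inf K)\<bar> \<le> (\<Sum>K\<in>R. norm (f (Sup K) - f (Inf K)))"
      using sum_abs by auto
    ultimately have r: "\<bar>\<Sum>K\<in>R. f (Sup K) - f (Inf K)\<bar> < e" by linarith
    have "(\<Sum>K\<in>C1. f (Sup K) - f (Inf K)) \<le> (\<Sum>K\<in>C1. p * (Sup K - Inf K))"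
    proof (rule sum_mono)
      fix K assume "K \<in> C1"
      then obtain s t where "s < t" "K = {s..t}" "?P s t" using C1(2) by blast
      then show "f (Sup K) - f (Inf K) \<le> p * (Sup K - Inf K)" by simp
    qed
    also have "\<dots> = p * M1" using C1(5) by (simp add: sum_distrib_left[symmetric] M1_def)
    finally have low: "(\<Sum>K\<in>C1. f (Sup K) - f (Inf K)) \<le> p * M1" .
    have "q * M2 = (\<Sum>K\<in>C2. q * (Sup K - Inf K))" using C2(5) by (simp add: sum_distrib_left[symmetric] M2_def)
    also have "\<dots> \<le> (\<Sum>K\<in>C2. f (Sup K) - f (Inf K))"
    proof (rule sum_mono)
      fix K assume "K \<in> C2"
      then obtain s t where "s < t" "K = {s..t}" "?Q s t" using C2(2) by blast
      then show "q * (Sup K - Inf K) \<le> f (Sup K) - f (Inf K)" by simp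
    qed
    finally have "q * M2 - e \<le> p * M1" using low r decomp[of f] by linarith
    moreover have "q * m - 2 * \<bar>q\<bar> * \<epsilon> \<le> q * M2"
    proof -
      have "\<bar>q * (M2 - m)\<bar> \<le> \<bar>q\<bar> * (2 * \<epsilon>)"
        unfolding abs_mult using M1 M2 \<epsilon>(1) by (intro mult_left_mono) auto
      then show ?thesis by (simp add: algebra_simps abs_le_iff)
    qed
    moreover have "p * M1 \<le> p * m + \<bar>p\<bar> * \<epsilon>"
    proof -
      have "\<bar>p * (M1 - m)\<bar> \<le> \<bar>p\<bar> * \<epsilon>"
        unfolding abs_mult using M1 by (intro mult_left_mono) auto
      then show ?thesis by (simp add: algebra_simps abs_le_iff)
    qed
    ultimately show ?thesis using \<epsilon>e by (simp add: algebra_simps)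
  qed
  have "(q - p) * m \<le> 0"
  proof (rule field_le_epsilon)
    fix e :: real assume "e > 0"
    then show "(q - p) * m \<le> 0 + e" using main[of "e / 2"] by simp
  qed
  then have "m \<le> 0" using \<open>p < q\<close> by (simp add: mult_le_0_iff)
  then have "m = 0" unfolding m_def by (simp add: antisym)
  then show ?thesis using Em unfolding m_def E_def[symmetric]
    by (simp add: negligible_iff_measure)
qed

text \<open>Within a ball of length less than the \<open>\<delta>\<close> that belongs to \<open>\<epsilon> = 1\<close>, disjoint intervals on which the
  slope exceeds \<open>n\<close> in absolute value have total increment less than 1, hence total length less than \<open>1 / n\<close>.\<close>

lemma negligible_infinite_derivate:
  fixes f :: "real \<Rightarrow> real"
  assumes "a \<le> b" and ac: "abs_continuous_on a b f"
  shows "negligible (\<Inter>n::nat. steep_points (\<lambda>s t. a \<le> s \<and> t \<le> b \<and> real n * (t - s) < \<bar>f t - f s\<bar>))"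
    (is "negligible (\<Inter>n. steep_points (?Q n))")
proof -
  define E where "E = (\<Inter>n. steep_points (?Q n))"
  have EQ: "E \<subseteq> steep_points (?Q n)" for n unfolding E_def by (rule INF_lower[OF UNIV_I])
  have "E \<in> sets lebesgue"
    unfolding E_def using steep_points_borel by (intro sets.countable_INT) auto
  obtain \<delta> where "\<delta> > 0" and
  \<delta>: "\<And>(I::real set set) s t. finite I \<Longrightarrow> (\<And>i. i \<in> I \<Longrightarrow> a \<le> s i \<and> s i \<le> t i \<and> t i \<le> b)
       \<Longrightarrow> (\<And>i j. i \<in> I \<Longrightarrow> j \<in> I \<Longrightarrow> i \<noteq> j \<Longrightarrow> {s i<..<t i} \<inter> {s j<..<t j} = {})
       \<Longrightarrow> (\<Sum>i\<in>I. t i - s i) < \<delta> \<Longrightarrow> (\<Sum>i\<in>I. norm (f (t i) - f (s i))) < 1"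
    by (rule abs_continuous_on_finite_family[OF ac zero_less_one]) blast
  have loc: "negligible (E \<inter> ball x (\<delta> / 4))" for x
  proof -
    let ?G = "ball x (\<delta> / 4)"
    define m where "m = measure lebesgue (E \<inter> ?G)"
    have Em: "E \<inter> ?G \<in> lmeasurable"
    proof (rule bounded_set_imp_lmeasurable)
      show "bounded (E \<inter> ?G)" by (simp add: bounded_Int)
      show "E \<inter> ?G \<in> sets lebesgue" using \<open>E \<in> sets lebesgue\<close> by (intro sets.Int) (auto simp: borel_open)
    qed
    have mG: "measure lebesgue ?G = \<delta> / 2" using \<open>\<delta> > 0\<close> by (simp add: ball_eq_greaterThanLessThan)
    have main: "real n * (m - \<epsilon>) \<le> 1" if "\<epsilon> > 0" for n \<epsilon>
    proof -
      have sub: "E \<inter> ?G \<subseteq> steep_points (?Q n)" "E \<inter> ?G \<subseteq> ?G" using EQ[of n] by auto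
      obtain C where C: "finite C" "\<And>K. K \<in> C \<Longrightarrow> \<exists>s t. s < t \<and> K = {s..t} \<and> ?Q n s t \<and> K \<subseteq> ?G"
        "pairwise disjnt C" "m - \<epsilon> \<le> measure lebesgue (E \<inter> ?G \<inter> \<Union>C)"
        "(\<Sum>K\<in>C. Sup K - Inf K) = measure lebesgue (\<Union>C)"
        and Cm: "\<Union>C \<in> lmeasurable" and CG: "\<Union>C \<subseteq> ?G"
        unfolding m_def by (rule Vitali_covering_steep_points[OF sub(1) Em open_ball sub(2) lmeasurable_ball \<open>\<epsilon> > 0\<close>]) (rule that[unfolded m_def])
      have "m - \<epsilon> \<le> (\<Sum>K\<in>C. Sup K - Inf K)"
      proof -
        have "E \<inter> ?G \<inter> \<Union>C \<in> sets lebesgue"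
          by (rule sets.Int[OF fmeasurableD[OF Em] fmeasurableD[OF Cm]])
        then have "measure lebesgue (E \<inter> ?G \<inter> \<Union>C) \<le> measure lebesgue (\<Union>C)"
          using Cm by (intro measure_mono_fmeasurable) blast+
        then show ?thesis using C(4,5) by linarith
      qed
      then have "real n * (m - \<epsilon>) \<le> real n * (\<Sum>K\<in>C. Sup K - Inf K)"
        by (intro mult_left_mono) auto
      also have "\<dots> = (\<Sum>K\<in>C. real n * (Sup K - Inf K))" by (simp add: sum_distrib_left)
      also have "\<dots> \<le> (\<Sum>K\<in>C. norm (f (Sup K) - f (Inf K)))"
      proof (rule sum_mono)
        fix K assume "K \<in> C"
        then obtain s t where "s < t" "K = {s..t}" "?Q n s t" using C(2) by blast
        then show "real n * (Sup K - Inf K) \<le> norm (f (Sup K) - f (Inf K))" by simp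
      qed
      also have "\<dots> < 1"
      proof (rule \<delta>[OF C(1)])
        show "a \<le> Inf K \<and> Inf K \<le> Sup K \<and> Sup K \<le> b" if KC: "K \<in> C" for K
        proof -
          obtain s t where "s < t" "K = {s..t}" "?Q n s t" using C(2)[OF KC] by blast
          then show ?thesis by simp
        qed
        show "{Inf K<..<Sup K} \<inter> {Inf J<..<Sup J} = {}" if KJ: "K \<in> C" "J \<in> C" "K \<noteq> J" for K J
        proof -
          obtain s t s' t' where st: "s < t" "s' < t'" "K = {s..t}" "J = {s'..t'}"
            using C(2)[OF KJ(1)] C(2)[OF KJ(2)] by metis
          have "K \<inter> J = {}"
            using C(3) KJ by (auto simp: pairwise_def disjnt_def)
          then have "interior K \<inter> interior J = {}" using interior_subset by blast
          then show ?thesis using st(1,2) unfolding st(3,4) by (simp add: interior_atLeastAtMost_real)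
        qed
        have "measure lebesgue (\<Union>C) \<le> measure lebesgue ?G"
          by (rule measure_mono_fmeasurable[OF CG fmeasurableD[OF Cm] lmeasurable_ball])
        then show "(\<Sum>K\<in>C. Sup K - Inf K) < \<delta>" using C(5) mG \<open>\<delta> > 0\<close> by linarith
      qed
      finally show ?thesis by simp
    qed
    have "m \<le> 0"
    proof (rule ccontr)
      assume "\<not> m \<le> 0"
      then have "m > 0" by simp
      then obtain n :: nat where "2 < real n * m" using reals_Archimedean3[of m] by blast
      then show False using main[of "m / 2" n] \<open>m > 0\<close> by (simp add: algebra_simps)
    qed
    then have "m = 0" unfolding m_def by (simp add: antisym)
    then show ?thesis using Em unfolding m_def by (simp add: negligible_iff_measure)
  qed
  have "negligible E"
  proof (subst locally_negligible_alt, intro ballI)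
    fix x assume "x \<in> E"
    have "openin (top_of_set E) (E \<inter> ball x (\<delta> / 4))" by (simp add: openin_open_Int)
    moreover have "x \<in> E \<inter> ball x (\<delta> / 4)" using \<open>x \<in> E\<close> \<open>\<delta> > 0\<close> by simp
    ultimately show "\<exists>U. openin (top_of_set E) U \<and> x \<in> U \<and> negligible U"
      using loc[of x] by blast
  qed
  then show ?thesis unfolding E_def .
qed

text \<open>Let the end of the interval that lies on the other side of \<open>x\<close> tend to \<open>x\<close>.\<close>

lemma two_sided_slopes_imp_one_sided:
  fixes f :: "real \<Rightarrow> real"
  assumes cont: "isCont f x" and "d > 0"
    and up: "\<And>s t. s < x \<Longrightarrow> x < t \<Longrightarrow> t - s < d \<Longrightarrow> f t - f s \<le> q * (t - s)"
    and y: "\<bar>y - x\<bar> < d"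
  shows "x \<le> y \<Longrightarrow> f y - f x \<le> q * (y - x)" "y \<le> x \<Longrightarrow> f x - f y \<le> q * (x - y)"
proof -
  have f: "(f \<longlongrightarrow> f x) (at x within A)" for A 
    using cont unfolding isCont_def by (rule tendsto_within_subset) simp
  have "f y - f x \<le> q * (y - x)" if "x < y"
  proof (rule tendsto_le[OF trivial_limit_at_left_real])
    show "((\<lambda>s. f y - f s) \<longlongrightarrow> f y - f x) (at_left x)" by (intro tendsto_intros f)
    show "((\<lambda>s. q * (y - s)) \<longlongrightarrow> q * (y - x)) (at_left x)" by (intro tendsto_intros)
    show "\<forall>\<^sub>F s in at_left x. f y - f s \<le> q * (y - s)"
      unfolding eventually_at_left_field
      by (rule exI[of _ "y - d"]) (use that y in \<open>auto intro!: up\<close>)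
  qed
  then show "x \<le> y \<Longrightarrow> f y - f x \<le> q * (y - x)" by (cases "x = y") auto
  have "f x - f y \<le> q * (x - y)" if "y < x"
  proof (rule tendsto_le[OF trivial_limit_at_right_real])
    show "((\<lambda>s. f s - f y) \<longlongrightarrow> f x - f y) (at_right x)" by (intro tendsto_intros f)
    show "((\<lambda>s. q * (s - y)) \<longlongrightarrow> q * (x - y)) (at_right x)" by (intro tendsto_intros)
    show "\<forall>\<^sub>F s in at_right x. f s - f y \<le> q * (s - y)"
      unfolding eventually_at_right_field
      by (rule exI[of _ "y + d"]) (use that y in \<open>auto intro!: up\<close>)
  qed
  then show "y \<le> x \<Longrightarrow> f x - f y \<le> q * (x - y)" by (cases "x = y") auto
qed

text \<open>Outside the null sets of the two kinds above, for rational \<open>p < q\<close>, the lower and the upper derivate are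
  finite and no pair of rationals separates them; so they agree, and their common value is the derivative.\<close>

lemma abs_continuous_on_real_differentiable_ae:
  fixes f :: "real \<Rightarrow> real"
  assumes "a \<le> b" and ac: "abs_continuous_on a b f"
  shows "negligible {x \<in> {a<..<b}. \<not> f differentiable (at x)}"
proof -
  let ?P = "\<lambda>p s t. a \<le> s \<and> t \<le> b \<and> f t - f s < p * (t - s)"
  let ?Q = "\<lambda>q s t. a \<le> s \<and> t \<le> b \<and> q * (t - s) < f t - f s"
  let ?A = "\<lambda>n s t. a \<le> s \<and> t \<le> b \<and> real n * (t - s) < \<bar>f t - f s\<bar>"
  define N where "N = (\<Union>(p, q)\<in>{(p, q) \<in> \<rat> \<times> \<rat>. p < q}. steep_points (?P p) \<inter> steep_points (?Q q))
    \<union> (\<Inter>n. steep_points (?A n))"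
  have "countable {(p, q) \<in> \<rat> \<times> \<rat>. p < (q::real)}"
    by (rule countable_subset[of _ "\<rat> \<times> \<rat>"]) (auto intro: countable_rat)
  moreover have "negligible (case pq of (p, q) \<Rightarrow> steep_points (?P p) \<inter> steep_points (?Q q))"
    if "pq \<in> {(p, q) \<in> \<rat> \<times> \<rat>. p < q}" for pq
    using that negligible_derivate_gap[OF \<open>a \<le> b\<close> ac, of "fst pq" "snd pq"] by (simp add: case_prod_unfold)
  ultimately have "negligible (\<Union>(p, q)\<in>{(p, q) \<in> \<rat> \<times> \<rat>. p < q}. steep_points (?P p) \<inter> steep_points (?Q q))"
    by (intro negligible_countable_Union countable_image) blast+
  then have "negligible N"
    unfolding N_def by (rule negligible_Un) (rule negligible_infinite_derivate[OF \<open>a \<le> b\<close> ac])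
  have "f differentiable (at x)" if x: "x \<in> {a<..<b}" "x \<notin> N" for x
  proof -
    define I where "I d s t \<longleftrightarrow> a \<le> s \<and> t \<le> b \<and> s < x \<and> x < t \<and> t - s < d" for d s t :: real
    define Low where "Low p \<longleftrightarrow> (\<exists>d>0. \<forall>s t. I d s t \<longrightarrow> p * (t - s) \<le> f t - f s)" for p
    define High where "High q \<longleftrightarrow> (\<exists>d>0. \<forall>s t. I d s t \<longrightarrow> f t - f s \<le> q * (t - s))" for q
    have alt: "Low p \<or> High q" if "p \<in> \<rat>" "q \<in> \<rat>" "p < q" for p q
    proof -
      have "x \<notin> steep_points (?P p) \<or> x \<notin> steep_points (?Q q)"
        using x(2) that unfolding N_def by blast
      then show ?thesis
      proof
        assume "x \<notin> steep_points (?P p)"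
        then have "Low p" unfolding steep_points_def Low_def I_def mem_Collect_eq by (meson not_less)
        then show ?thesis ..
      next
        assume "x \<notin> steep_points (?Q q)"
        then have "High q" unfolding steep_points_def High_def I_def mem_Collect_eq by (meson not_less)
        then show ?thesis ..
      qed
    qed
    obtain n where "x \<notin> steep_points (?A n)" using x(2) unfolding N_def by blast
    then obtain d0 where d0: "d0 > 0" "\<And>s t. I d0 s t \<Longrightarrow> \<bar>f t - f s\<bar> \<le> real n * (t - s)"
      unfolding steep_points_def I_def mem_Collect_eq by (meson not_less)
    have "Low (- real n)" unfolding Low_def 
      by (intro exI[of _ d0] conjI allI impI d0(1)) (use d0(2) in fastforce)
    have "High (real n)" unfolding High_def 
      by (intro exI[of _ d0] conjI allI impI d0(1)) (use d0(2) in fastforce)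
    have I_ex: "\<exists>s t. I d1 s t \<and> I d2 s t" if "d1 > 0" "d2 > 0" for d1 d2
    proof -
      define e where "e = min (min (d1 / 3) (d2 / 3)) (min (x - a) (b - x))"
      have "e > 0" using that x(1) by (auto simp: e_def)
      moreover have "e \<le> d1 / 3" "e \<le> d2 / 3" "e \<le> x - a" "e \<le> b - x"
        unfolding e_def by linarith+
      ultimately have "I d1 (x - e) (x + e) \<and> I d2 (x - e) (x + e)" unfolding I_def by auto
      then show ?thesis by blast
    qed
    have le: "p \<le> q" if LH: "Low p" "High q" for p q
    proof -
      obtain d1 d2 where d: "d1 > 0" "d2 > 0" "\<And>s t. I d1 s t \<Longrightarrow> p * (t - s) \<le> f t - f s"
        "\<And>s t. I d2 s t \<Longrightarrow> f t - f s \<le> q * (t - s)" using LH unfolding Low_def High_def by blast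
      obtain s t where st: "I d1 s t" "I d2 s t" using I_ex d by blast
      then have "p * (t - s) \<le> q * (t - s)" using d(3,4)[of s t] by linarith
      moreover have "s < t" using st unfolding I_def by linarith
      ultimately show ?thesis by simp
    qed
    \<comment> \<open>The lower derivate.\<close>
    define D where "D = Sup {p \<in> \<rat>. Low p}"
    have bdd: "bdd_above {p \<in> \<rat>. Low p}" 
      using le \<open>High (real n)\<close> by (auto intro!: bdd_aboveI[of _ "real n"])
    have ne: "{p \<in> \<rat>. Low p} \<noteq> {}" using \<open>Low (- real n)\<close> by (auto intro!: exI[of _ "- real n"])
    have slopes: "\<exists>d>0. \<forall>s t. I d s t \<longrightarrow> (D - e) * (t - s) \<le> f t - f s \<and> f t - f s \<le> (D + e) * (t - s)"
      if "e > 0" for e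
    proof -
      obtain p where p: "p \<in> \<rat>" "Low p" "D - e < p"
        using less_cSup_iff[OF ne bdd, of "D - e"] \<open>e > 0\<close> unfolding D_def by auto
      obtain r where r: "r \<in> \<rat>" "D < r" "r < D + e" using Rats_dense_in_real[of D "D + e"] \<open>e > 0\<close> by auto
      obtain q where q: "q \<in> \<rat>" "r < q" "q < D + e" using Rats_dense_in_real[OF r(3)] by auto
      have "\<not> Low r"
      proof
        assume "Low r"
        then have "r \<le> D" unfolding D_def using r bdd by (intro cSup_upper) auto
        then show False using r by simp
      qed
      then have "High q" using alt r q by blast
      obtain d1 d2 where d: "d1 > 0" "d2 > 0" "\<And>s t. I d1 s t \<Longrightarrow> p * (t - s) \<le> f t - f s"
        "\<And>s t. I d2 s t \<Longrightarrow> f t - f s \<le> q * (t - s)" 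
        using \<open>Low p\<close> \<open>High q\<close> unfolding Low_def High_def by blast
      show ?thesis
      proof (intro exI[of _ "min d1 d2"] conjI allI impI)
        show "min d1 d2 > 0" using d by simp
        fix s t assume st: "I (min d1 d2) s t"
        then have "I d1 s t" "I d2 s t" "s < t" unfolding I_def by auto
        moreover have "(D - e) * (t - s) \<le> p * (t - s)" "q * (t - s) \<le> (D + e) * (t - s)"
          using \<open>s < t\<close> p(3) q(3) by (auto intro!: mult_right_mono)
        ultimately show "(D - e) * (t - s) \<le> f t - f s" "f t - f s \<le> (D + e) * (t - s)"
          using d(3,4)[of s t] by linarith+
      qed
    qed
    have cont: "isCont f x"
      using abs_continuous_on_imp_continuous_on[OF ac] x(1) 
      by (metis continuous_on_interior interior_atLeastAtMost_real)
    have "(f has_derivative (\<lambda>h. D * h)) (at x)"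
      unfolding has_derivative_at_alt
    proof (intro conjI allI impI)
      show "bounded_linear (\<lambda>h. D * h)" by (rule bounded_linear_mult_right)
      fix e :: real assume "e > 0"
      obtain d where d: "d > 0" "\<And>s t. I d s t \<Longrightarrow> (D - e) * (t - s) \<le> f t - f s"
        "\<And>s t. I d s t \<Longrightarrow> f t - f s \<le> (D + e) * (t - s)" using slopes[OF \<open>e > 0\<close>] by blast
      define d' where "d' = min d (min (x - a) (b - x))"
      have d': "d' > 0" using d(1) x(1) by (auto simp: d'_def)
      have I: "I d s t" if "s < x" "x < t" "t - s < d'" for s t
        using that unfolding I_def d'_def by auto
      show "\<exists>d>0. \<forall>y. norm (y - x) < d \<longrightarrow> norm (f y - f x - D * (y - x)) \<le> e * norm (y - x)"
      proof (intro exI[of _ d'] conjI allI impI d')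
        fix y assume y: "norm (y - x) < d'"
        have cont': "isCont (\<lambda>y. - f y) x" using cont by (intro continuous_intros)
        note up = two_sided_slopes_imp_one_sided[OF cont d', of "D + e" y]
        note lo = two_sided_slopes_imp_one_sided[OF cont' d', of "- (D - e)" y]
        have 1: "x \<le> y \<Longrightarrow> f y - f x \<le> (D + e) * (y - x)" "y \<le> x \<Longrightarrow> f x - f y \<le> (D + e) * (x - y)"
          by (rule up; use d(3) I y in auto)+
        have 2: "x \<le> y \<Longrightarrow> - f y - - f x \<le> - (D - e) * (y - x)" "y \<le> x \<Longrightarrow> - f x - - f y \<le> - (D - e) * (x - y)"
          by (rule lo; use d(2) I y in \<open>auto simp: algebra_simps\<close>)+
        show "norm (f y - f x - D * (y - x)) \<le> e * norm (y - x)"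
          using 1 2 by (cases "x \<le> y") (auto simp: algebra_simps abs_le_iff)
      qed
    qed
    then show ?thesis by (auto simp: differentiable_def)
  qed
  then have "{x \<in> {a<..<b}. \<not> f differentiable (at x)} \<subseteq> N" by blast
  with \<open>negligible N\<close> show ?thesis by (rule negligible_subset)
qed

text \<open>The term \<open>t - s\<close> covers functions of \<open>f\<close> and of time, and, for constant \<open>f\<close>, Lipschitz functions.\<close>

lemma abs_continuous_on_compose_Lipschitz:
  fixes f :: "real \<Rightarrow> 'b::real_normed_vector" and \<phi> :: "real \<Rightarrow> 'c::real_normed_vector"
  assumes ac: "abs_continuous_on a b f" and "C \<ge> 0"
    and lip: "\<And>s t. a \<le> s \<Longrightarrow> s \<le> t \<Longrightarrow> t \<le> b \<Longrightarrow> norm (\<phi> t - \<phi> s) \<le> C * (norm (f t - f s) + (t - s))"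
  shows "abs_continuous_on a b \<phi>"
  unfolding abs_continuous_on_def
proof (intro allI impI)
  fix \<epsilon> :: real assume "\<epsilon> > 0"
  define \<eta> where "\<eta> = \<epsilon> / (2 * (C + 1))"
  have "\<eta> > 0" using \<open>\<epsilon> > 0\<close> \<open>C \<ge> 0\<close> by (simp add: \<eta>_def)
  obtain \<delta> where \<delta>: "\<delta> > 0" "\<forall>(n::nat) s t.
        (\<forall>i<n. a \<le> s i \<and> s i \<le> t i \<and> t i \<le> b) \<and>
        disjoint_family_on (\<lambda>i. {s i<..<t i}) {..<n} \<and>
        (\<Sum>i<n. t i - s i) < \<delta>
        \<longrightarrow> (\<Sum>i<n. norm (f (t i) - f (s i))) < \<eta>"
    using ac \<open>\<eta> > 0\<close> unfolding abs_continuous_on_def by blast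
  show "\<exists>\<delta>>0. \<forall>(n::nat) s t.
        (\<forall>i<n. a \<le> s i \<and> s i \<le> t i \<and> t i \<le> b) \<and>
        disjoint_family_on (\<lambda>i. {s i<..<t i}) {..<n} \<and>
        (\<Sum>i<n. t i - s i) < \<delta>
        \<longrightarrow> (\<Sum>i<n. norm (\<phi> (t i) - \<phi> (s i))) < \<epsilon>"
  proof (intro exI[of _ "min \<delta> \<eta>"] conjI allI impI)
    show "min \<delta> \<eta> > 0" using \<delta>(1) \<open>\<eta> > 0\<close> by simp
    fix n :: nat and s t
    assume st: "(\<forall>i<n. a \<le> s i \<and> s i \<le> t i \<and> t i \<le> b) \<and>
        disjoint_family_on (\<lambda>i. {s i<..<t i}) {..<n} \<and> (\<Sum>i<n. t i - s i) < min \<delta> \<eta>"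
    then have small: "(\<Sum>i<n. norm (f (t i) - f (s i))) < \<eta>" using \<delta>(2) by auto
    have "(\<Sum>i<n. norm (\<phi> (t i) - \<phi> (s i))) \<le> (\<Sum>i<n. C * (norm (f (t i) - f (s i)) + (t i - s i)))"
      using st by (intro sum_mono lip) auto
    also have "\<dots> = C * ((\<Sum>i<n. norm (f (t i) - f (s i))) + (\<Sum>i<n. t i - s i))"
      by (simp only: sum.distrib[symmetric] sum_distrib_left)
    also have "\<dots> \<le> C * (\<eta> + \<eta>)"
      using small st \<open>C \<ge> 0\<close> by (intro mult_left_mono) auto
    also have "\<dots> < (C + 1) * (\<eta> + \<eta>)" using \<open>\<eta> > 0\<close> by simp
    also have "\<dots> = (2 * (C + 1)) * \<eta>" by (simp add: algebra_simps)
    also have "\<dots> = \<epsilon>" unfolding \<eta>_def using \<open>C \<ge> 0\<close> by simp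
    finally show "(\<Sum>i<n. norm (\<phi> (t i) - \<phi> (s i))) < \<epsilon>" .
  qed
qed

lemma abs_continuous_on_differentiable_ae:
  fixes f :: "real \<Rightarrow> 'b::euclidean_space"
  assumes "a \<le> b" and ac: "abs_continuous_on a b f"
  shows "negligible {x \<in> {a<..<b}. \<not> f differentiable (at x)}"
proof -
  have "negligible (\<Union>i\<in>Basis. {x \<in> {a<..<b}. \<not> (\<lambda>x. f x \<bullet> i) differentiable (at x)})"
  proof (intro negligible_Union finite_imageI finite_Basis, clarify)
    fix i :: 'b assume i: "i \<in> Basis"
    have "norm (f t \<bullet> i - f s \<bullet> i) \<le> 1 * (norm (f t - f s) + (t - s))" if "s \<le> t" for s t
      using norm_nth_le[OF i, of "f t - f s"] that by (simp add: inner_diff_left)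
    then have "abs_continuous_on a b (\<lambda>x. f x \<bullet> i)"
      by (intro abs_continuous_on_compose_Lipschitz[OF ac, of 1]) auto
    then show "negligible {x \<in> {a<..<b}. \<not> (\<lambda>x. f x \<bullet> i) differentiable (at x)}"
      by (rule abs_continuous_on_real_differentiable_ae[OF \<open>a \<le> b\<close>])
  qed
  then show ?thesis
    by (rule negligible_subset) (auto simp: differentiable_componentwise_within[of f])
qed

lemma abs_continuous_on_if_Lipschitz:
  fixes f :: "real \<Rightarrow> 'b::real_normed_vector"
  assumes "C-lipschitz_on {a..b} f"
  shows "abs_continuous_on a b f"
proof (rule abs_continuous_on_compose_Lipschitz[of _ _ "\<lambda>_. 0 :: real" C])
  show "abs_continuous_on a b (\<lambda>_. 0 :: real)" by (auto simp: abs_continuous_on_def intro: exI[of _ 1])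
  show "C \<ge> 0" using assms by (rule lipschitz_on_nonneg)
  show "norm (f t - f s) \<le> C * (norm (0 - 0 :: real) + (t - s))" if "a \<le> s" "s \<le> t" "t \<le> b" for s t
    using lipschitz_onD[OF assms, of t s] that by (simp add: dist_norm)
qed

section \<open>Peano's existence theorem\<close>

text \<open>Tonelli's method. The equation with delay \<open>\<delta> = h / (n + 1)\<close>, in which the right-hand side at time \<open>\<tau>\<close> is
  evaluated at the state of time \<open>\<tau> - \<delta>\<close>, is solved by \<open>n + 1\<close> Picard iterations, since each of them
  determines the solution on a further interval of length \<open>\<delta>\<close>. The solutions have the common Lipschitz
  constant \<open>B\<close>, and by the Arzela-Ascoli theorem a subsequence converges to a solution without delay.\<close>

lemma Peano_existence:
  fixes f :: "real \<Rightarrow> 'e::euclidean_space \<Rightarrow> 'e"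
  assumes "h > 0" and "B \<ge> 0" and cont: "continuous_on ({s..s + h} \<times> cball x0 r) (\<lambda>(t, x). f t x)"
    and bnd: "\<And>t x. t \<in> {s..s + h} \<Longrightarrow> x \<in> cball x0 r \<Longrightarrow> norm (f t x) \<le> B"
    and Bh: "B * h \<le> r"
  obtains q where "q s = x0" "\<And>t. t \<in> {s..s + h} \<Longrightarrow> q t \<in> cball x0 r"
    "\<And>t. t \<in> {s..s + h} \<Longrightarrow> (q has_vector_derivative f t (q t)) (at t within {s..s + h})"
proof -
  let ?I = "{s..s + h}"
  define rhs where "rhs \<delta> g \<tau> = f \<tau> (g (max s (\<tau> - \<delta>)))" for \<delta> :: real and g \<tau>
  define T where "T \<delta> g t = x0 + integral {s..t} (rhs \<delta> g)" for \<delta> g t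
  define good where "good g \<longleftrightarrow> g s = x0 \<and> g ` ?I \<subseteq> cball x0 r \<and>
    (\<forall>t t'. s \<le> t \<and> t \<le> t' \<and> t' \<le> s + h \<longrightarrow> norm (g t' - g t) \<le> B * (t' - t))" for g
  have good_cont: "continuous_on ?I g" if "good g" for g
  proof -
    have "norm (g y - g x) \<le> B * norm (y - x)" if "x \<in> ?I" "y \<in> ?I" for x y
    proof (cases "x \<le> y")
      case True
      then show ?thesis using \<open>good g\<close> that unfolding good_def by auto
    next
      case False
      then have "norm (g x - g y) \<le> B * (x - y)" using \<open>good g\<close> that unfolding good_def by auto
      then show ?thesis using False by (simp add: norm_minus_commute)
    qed
    then have "B-lipschitz_on ?I g"
      using \<open>B \<ge> 0\<close> by (intro lipschitz_onI) (simp_all add: dist_norm norm_minus_commute abs_minus_commute)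
    then show ?thesis by (rule lipschitz_on_continuous_on)
  qed
  have fg_cont: "continuous_on ?I (\<lambda>\<tau>. f \<tau> (g \<tau>))" if "continuous_on ?I g" "g ` ?I \<subseteq> cball x0 r" for g
  proof -
    have "continuous_on ?I (\<lambda>\<tau>. (\<lambda>(t, x). f t x) (\<tau>, g \<tau>))"
      by (rule continuous_on_compose2[OF cont]) (use that in \<open>auto intro!: continuous_intros\<close>)
    then show ?thesis by simp
  qed
  have delay: "(\<lambda>\<tau>. g (max s (\<tau> - \<delta>))) ` ?I \<subseteq> cball x0 r" "continuous_on ?I (rhs \<delta> g)"
    if "good g" "\<delta> \<ge> 0" for g \<delta>
  proof -
    have m: "(\<lambda>\<tau>. max s (\<tau> - \<delta>)) ` ?I \<subseteq> ?I" using that by auto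
    show im: "(\<lambda>\<tau>. g (max s (\<tau> - \<delta>))) ` ?I \<subseteq> cball x0 r"
      using m \<open>good g\<close> unfolding good_def by blast
    show "continuous_on ?I (rhs \<delta> g)"
      unfolding rhs_def
      by (rule fg_cont[OF _ im], rule continuous_on_compose2[OF good_cont[OF \<open>good g\<close>] _ m])
        (intro continuous_intros)
  qed
  have rhs_int: "rhs \<delta> g integrable_on {t..t'}" if "good g" "\<delta> \<ge> 0" "s \<le> t" "t' \<le> s + h" for g \<delta> t t'
    by (rule integrable_continuous_interval, rule continuous_on_subset[OF delay(2)]) (use that in auto)
  have rhs_bnd: "norm (rhs \<delta> g \<tau>) \<le> B" if "good g" "\<delta> \<ge> 0" "\<tau> \<in> ?I" for g \<delta> \<tau>
    unfolding rhs_def using bnd delay(1)[OF that(1,2)] that(3) by blast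
  have T_good: "good (T \<delta> g)" if g: "good g" and "\<delta> \<ge> 0" for g \<delta>
  proof -
    have Tdiff: "norm (T \<delta> g t' - T \<delta> g t) \<le> B * (t' - t)" if t: "s \<le> t" "t \<le> t'" "t' \<le> s + h" for t t'
    proof -
      have "T \<delta> g t' - T \<delta> g t = integral {t..t'} (rhs \<delta> g)"
        unfolding T_def using Henstock_Kurzweil_Integration.integral_combine[OF t(1,2), of "rhs \<delta> g"]
          rhs_int[OF g \<open>\<delta> \<ge> 0\<close>, of s t'] t by (simp add: algebra_simps)
      also have "norm \<dots> \<le> B * (t' - t)"
        by (rule integral_bound[OF t(2)]) (use delay(2)[OF g \<open>\<delta> \<ge> 0\<close>] t rhs_bnd[OF g \<open>\<delta> \<ge> 0\<close>] in
          \<open>auto intro: continuous_on_subset\<close>)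
      finally show ?thesis .
    qed
    moreover have Ts: "T \<delta> g s = x0" unfolding T_def by simp
    moreover have "T \<delta> g t \<in> cball x0 r" if "t \<in> ?I" for t
    proof -
      have "norm (T \<delta> g t - x0) \<le> B * (t - s)" using Tdiff[of s t] that Ts by auto
      also have "\<dots> \<le> B * h"
        using that \<open>B \<ge> 0\<close> by (intro mult_left_mono) auto
      finally show ?thesis using Bh by (simp add: dist_norm norm_minus_commute)
    qed
    ultimately show ?thesis unfolding good_def by auto
  qed
  have "r \<ge> 0" using Bh \<open>B \<ge> 0\<close> \<open>h > 0\<close> by (meson less_imp_le mult_nonneg_nonneg order_trans)
  then have "good (\<lambda>_. x0)" unfolding good_def using \<open>B \<ge> 0\<close> by auto
  have "\<exists>g. good g \<and> (\<forall>t\<in>?I. g t = T (h / Suc n) g t)" for n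
  proof -
    define \<delta> where "\<delta> = h / Suc n"
    have "\<delta> > 0" using \<open>h > 0\<close> by (simp add: \<delta>_def)
    define G where "G m = (T \<delta> ^^ m) (\<lambda>_. x0)" for m
    have G_Suc: "G (Suc m) = T \<delta> (G m)" for m by (simp add: G_def)
    have G_good: "good (G m)" for m
    proof (induction m)
      case 0
      then show ?case using \<open>good (\<lambda>_. x0)\<close> by (simp add: G_def)
    next
      case (Suc m)
      then show ?case unfolding G_Suc using T_good \<open>\<delta> > 0\<close> by simp
    qed
    have agree: "\<forall>t\<in>?I. t \<le> s + m * \<delta> \<longrightarrow> G (Suc m) t = G m t" for m :: nat
    proof (induction m)
      case 0
      have "G 0 s = x0" "G (Suc 0) s = x0" using G_good unfolding good_def by blast+
      then show ?case by (auto dest: antisym)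
    next
      case (Suc m)
      show ?case
      proof (intro ballI impI)
        fix t assume t: "t \<in> ?I" "t \<le> s + Suc m * \<delta>"
        have "integral {s..t} (rhs \<delta> (G (Suc m))) = integral {s..t} (rhs \<delta> (G m))"
        proof (rule integral_cong)
          fix \<tau> assume \<tau>: "\<tau> \<in> {s..t}"
          have "max s (\<tau> - \<delta>) \<in> ?I" "max s (\<tau> - \<delta>) \<le> s + m * \<delta>"
            using \<tau> t \<open>\<delta> > 0\<close> by (auto simp: algebra_simps)
          then show "rhs \<delta> (G (Suc m)) \<tau> = rhs \<delta> (G m) \<tau>"
            unfolding rhs_def using Suc.IH by simp
        qed
        then show "G (Suc (Suc m)) t = G (Suc m) t"
          unfolding G_Suc[of "Suc m"] G_Suc[of m] T_def by (simp add: G_Suc)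
      qed
    qed
    have "s + Suc n * \<delta> = s + h" by (simp add: \<delta>_def field_simps)
    then have "\<forall>t\<in>?I. G (Suc n) t = T \<delta> (G (Suc n)) t"
      using agree[of "Suc n"] G_Suc[of "Suc n"] by auto
    then show ?thesis using G_good unfolding \<delta>_def by blast
  qed
  then obtain q where q: "\<And>n. good (q n)" "\<And>n t. t \<in> ?I \<Longrightarrow> q n t = T (h / Suc n) (q n) t"
    by metis
  have qI: "q n t \<in> cball x0 r" if "t \<in> ?I" for n t using q(1)[of n] that unfolding good_def by blast
  have qL: "norm (q n x - q n y) \<le> B * norm (x - y)" if xy: "x \<in> ?I" "y \<in> ?I" for n x y
  proof (cases "x \<le> y")
    case True
    then have "norm (q n y - q n x) \<le> B * (y - x)" using q(1)[of n] xy unfolding good_def by auto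
    then show ?thesis using True by (simp add: norm_minus_commute)
  next
    case False
    then show ?thesis using q(1)[of n] xy unfolding good_def by auto
  qed
  obtain g k where g: "continuous_on ?I g" "strict_mono (k :: nat \<Rightarrow> nat)"
    "\<And>e. 0 < e \<Longrightarrow> \<exists>N. \<forall>n x. n \<ge> N \<and> x \<in> ?I \<longrightarrow> norm (q (k n) x - g x) < e"
  proof (rule Arzela_Ascoli[of ?I q "norm x0 + r"])
    show "norm (q n x) \<le> norm x0 + r" if "x \<in> ?I" for n x
      using qI[OF that, of n] norm_triangle_sub[of "q n x" x0] by (simp add: dist_norm norm_minus_commute)
    show "\<exists>d>0. \<forall>n y. y \<in> ?I \<and> norm (x - y) < d \<longrightarrow> norm (q n x - q n y) < e"
      if x: "x \<in> ?I" and "0 < e" for x e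
    proof (intro exI[of _ "e / (B + 1)"] conjI allI impI)
      show "0 < e / (B + 1)" using \<open>e > 0\<close> \<open>B \<ge> 0\<close> by simp
      fix n y assume y: "y \<in> ?I \<and> norm (x - y) < e / (B + 1)"
      have "norm (q n x - q n y) \<le> B * norm (x - y)" using qL x y by blast
      also have "\<dots> \<le> (B + 1) * norm (x - y)" by (intro mult_right_mono) auto
      also have "\<dots> < e" using y \<open>B \<ge> 0\<close> by (simp add: field_simps)
      finally show "norm (q n x - q n y) < e" .
    qed
  qed auto
  have lim: "(\<lambda>n. q (k n) t) \<longlonglongrightarrow> g t" if "t \<in> ?I" for t
    unfolding LIMSEQ_iff using g(3) that by meson
  have gI: "g t \<in> cball x0 r" if "t \<in> ?I" for t
    by (rule closed_sequentially[OF closed_cball _ lim[OF that]]) (use qI that in auto)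
  define \<delta> where "\<delta> n = h / Suc (k n)" for n
  have \<delta>pos: "\<delta> n \<ge> 0" for n using \<open>h > 0\<close> by (simp add: \<delta>_def)
  have \<delta>lim: "\<delta> \<longlonglongrightarrow> 0"
  proof -
    have "(\<lambda>n. h / real (Suc n)) \<longlonglongrightarrow> 0" using LIMSEQ_inverse_real_of_nat[THEN tendsto_mult_right_zero, of h]
      by (simp add: divide_inverse)
    then show ?thesis unfolding \<delta>_def using LIMSEQ_subseq_LIMSEQ[OF _ g(2)] by (auto simp: o_def)
  qed
  have lim_delay: "(\<lambda>n. q (k n) (max s (t - \<delta> n))) \<longlonglongrightarrow> g t" if t: "t \<in> ?I" for t
  proof -
    have "(\<lambda>n. q (k n) (max s (t - \<delta> n)) - q (k n) t) \<longlonglongrightarrow> 0"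
    proof (rule Lim_null_comparison)
      show "\<forall>\<^sub>F n in sequentially. norm (q (k n) (max s (t - \<delta> n)) - q (k n) t) \<le> B * \<delta> n"
      proof (rule always_eventually, rule allI)
        fix n
        have "norm (q (k n) (max s (t - \<delta> n)) - q (k n) t) \<le> B * norm (max s (t - \<delta> n) - t)"
          using t \<delta>pos[of n] by (intro qL) auto
        also have "\<dots> \<le> B * \<delta> n" using t \<delta>pos[of n] \<open>B \<ge> 0\<close> by (intro mult_left_mono) auto
        finally show "norm (q (k n) (max s (t - \<delta> n)) - q (k n) t) \<le> B * \<delta> n" .
      qed
      show "(\<lambda>n. B * \<delta> n) \<longlonglongrightarrow> 0" using \<delta>lim by (rule tendsto_mult_right_zero)
    qed
    from tendsto_add[OF this lim[OF t]] show ?thesis by simp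
  qed
  have eq: "g t = x0 + integral {s..t} (\<lambda>\<tau>. f \<tau> (g \<tau>))" if t: "t \<in> ?I" for t
  proof -
    have "(\<lambda>n. integral {s..t} (rhs (\<delta> n) (q (k n)))) \<longlonglongrightarrow> integral {s..t} (\<lambda>\<tau>. f \<tau> (g \<tau>))"
    proof (rule dominated_convergence(2)[where h = "\<lambda>_. B"])
      show "rhs (\<delta> n) (q (k n)) integrable_on {s..t}" for n
        by (rule rhs_int[OF q(1) \<delta>pos]) (use t in auto)
      show "(\<lambda>_. B) integrable_on {s..t}" by (rule integrable_const_ivl)
      show "norm (rhs (\<delta> n) (q (k n)) x) \<le> B" if "x \<in> {s..t}" for n x
        by (rule rhs_bnd[OF q(1) \<delta>pos]) (use t that in auto)
      show "(\<lambda>n. rhs (\<delta> n) (q (k n)) x) \<longlonglongrightarrow> f x (g x)" if "x \<in> {s..t}" for x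
      proof -
        have x: "x \<in> ?I" using that t by auto
        have "(\<lambda>n. (\<lambda>(t, x). f t x) (x, q (k n) (max s (x - \<delta> n)))) \<longlonglongrightarrow> (\<lambda>(t, x). f t x) (x, g x)"
        proof (rule continuous_on_tendsto_compose[OF cont])
          show "(\<lambda>n. (x, q (k n) (max s (x - \<delta> n)))) \<longlonglongrightarrow> (x, g x)"
            by (intro tendsto_intros lim_delay[OF x])
          show "(x, g x) \<in> ?I \<times> cball x0 r" using x gI[OF x] by blast
          have "max s (x - \<delta> n) \<in> ?I" for n using x \<delta>pos[of n] by auto
          then show "\<forall>\<^sub>F n in sequentially. (x, q (k n) (max s (x - \<delta> n))) \<in> ?I \<times> cball x0 r"
            using x qI by (intro always_eventually) blast
        qed
        then show ?thesis unfolding rhs_def by simp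
      qed
    qed
    then have "(\<lambda>n. q (k n) t) \<longlonglongrightarrow> x0 + integral {s..t} (\<lambda>\<tau>. f \<tau> (g \<tau>))"
      unfolding q(2)[OF t] T_def \<delta>_def by (intro tendsto_intros)
    then show ?thesis using lim[OF t] LIMSEQ_unique by blast
  qed
  show thesis
  proof (rule that[of g])
    show "g s = x0" using eq[of s] \<open>h > 0\<close> by simp
    show "g t \<in> cball x0 r" if "t \<in> ?I" for t by (rule gI[OF that])
    fix t assume t: "t \<in> ?I"
    have "continuous_on ?I (\<lambda>\<tau>. f \<tau> (g \<tau>))" using gI by (intro fg_cont g(1)) auto
    from integral_has_vector_derivative[OF this t]
    have "((\<lambda>t. x0 + integral {s..t} (\<lambda>\<tau>. f \<tau> (g \<tau>))) has_vector_derivative f t (g t)) (at t within ?I)"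
      by (auto intro!: derivative_eq_intros)
    then show "(g has_vector_derivative f t (g t)) (at t within ?I)"
      by (rule has_vector_derivative_transform[OF t, rotated]) (use eq in auto)
  qed
qed

section \<open>Tangent vectors and curves on a manifold\<close>

lemma continuous_on_if_locally_openin:
  fixes f :: "'a::t2_space \<Rightarrow> 'b::topological_space"
  assumes "\<And>x. x \<in> S \<Longrightarrow> \<exists>T. openin (top_of_set S) T \<and> x \<in> T \<and> continuous_on T f"
  shows "continuous_on S f"
proof (rule continuous_on_eq_continuous_within[THEN iffD2], rule ballI)
  fix x assume "x \<in> S"
  then obtain T where T: "openin (top_of_set S) T" "x \<in> T" "continuous_on T f" using assms by blast
  then obtain U where U: "open U" "T = S \<inter> U" by (auto simp: openin_open)
  have "at x within S = at x within T"
    using at_within_nhd[of x U S T] T U by auto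
  then show "continuous (at x within S) f"
    using T(2,3) continuous_on_eq_continuous_within by metis
qed

lemma has_vector_derivative_within_Un:
  assumes "(f has_vector_derivative D) (at x within S)" "(f has_vector_derivative D) (at x within T)"
  shows "(f has_vector_derivative D) (at x within (S \<union> T))"
  using assms unfolding has_vector_derivative_def has_derivative_within
  by (simp add: at_within_union filterlim_sup)

lemma periodic_shift_int:
  fixes f :: "real \<Rightarrow> 'b"
  assumes "\<And>t. f (t + 1) = f t"
  shows "f (t + of_int n) = f t"
proof (induction n rule: int_induct[where k = 0])
  case (step1 i)
  then show ?case using assms[of "t + of_int i"] by (simp add: algebra_simps)
next
  case (step2 i)
  then show ?case using assms[of "t + of_int (i - 1)"] by (simp add: algebra_simps)
qed simp

lemma periodic_frac:
  fixes f :: "real \<Rightarrow> 'b"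
  assumes "\<And>t. f (t + 1) = f t"
  shows "f (frac t) = f t"
  using periodic_shift_int[of f "frac t" "\<lfloor>t\<rfloor>", OF assms] by (simp add: frac_def)

lemma circle_of_plus_one [simp]: "circle_of (t + 1) = circle_of t"
  by (simp add: circle.abs_eq_iff)

lemma smooth_on_imp_C2:
  assumes "smooth_on S f" "z \<in> S"
  shows "f differentiable (at z)" "(\<lambda>z. frechet_derivative f (at z) v) differentiable (at z)"
proof -
  have "Ck_on (Suc (Suc 0)) S f" using assms unfolding smooth_on_def by blast
  then show "f differentiable (at z)" "(\<lambda>z. frechet_derivative f (at z) v) differentiable (at z)"
    using assms(2) unfolding Ck_on.simps by blast+
qed

lemma smooth_on_imp_continuous_on: "smooth_on S f \<Longrightarrow> continuous_on S f"
  unfolding smooth_on_def by (metis Ck_on.simps(1))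

lemma bilinear_Basis_expansion:
  fixes h :: "'e::euclidean_space \<Rightarrow> 'e \<Rightarrow> real"
  assumes "bilinear h"
  shows "h v w = (\<Sum>i\<in>Basis. \<Sum>j\<in>Basis. (v \<bullet> i) * (w \<bullet> j) * h i j)"
proof -
  have "h v w = h (\<Sum>i\<in>Basis. (v \<bullet> i) *\<^sub>R i) (\<Sum>j\<in>Basis. (w \<bullet> j) *\<^sub>R j)"
    by (simp add: euclidean_representation)
  also have "\<dots> = (\<Sum>(i,j)\<in>Basis \<times> Basis. h ((v \<bullet> i) *\<^sub>R i) ((w \<bullet> j) *\<^sub>R j))"
    by (rule bilinear_sum[OF assms])
  also have "\<dots> = (\<Sum>(i,j)\<in>Basis \<times> Basis. (v \<bullet> i) * (w \<bullet> j) * h i j)"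
    by (rule sum.cong) (auto simp: bilinear_lmul[OF assms] bilinear_rmul[OF assms])
  finally show ?thesis by (simp add: sum.cartesian_product)
qed

lemma circle_of_nat: "circle_of (real n) = circle_of 0"
  by (simp add: circle.abs_eq_iff)

lemma action_join:
  assumes "action A L k \<gamma> a b = ereal p" "action A L k \<gamma> b e = ereal q" and ab: "a \<le> b" "b \<le> e"
  shows "action A L k \<gamma> a e = ereal (p + q)"
proof -
  define f where "f \<tau> = L (\<gamma> \<tau>) (velocity A \<gamma> \<tau>) \<tau> + k" for \<tau>
  have 1: "f absolutely_integrable_on {a..b}" "integral {a..b} f = p"
    using assms(1) unfolding action_def Let_def f_def[symmetric] by (auto split: if_splits)
  have 2: "f absolutely_integrable_on {b..e}" "integral {b..e} f = q"
    using assms(2) unfolding action_def Let_def f_def[symmetric] by (auto split: if_splits)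
  have 3: "f absolutely_integrable_on {a..e}"
    using 1(1) 2(1) Henstock_Kurzweil_Integration.integrable_combine[OF ab] unfolding absolutely_integrable_on_def by blast
  then have "integral {a..e} f = p + q"
    using Henstock_Kurzweil_Integration.integral_combine[OF ab, of f] 1(2) 2(2)
    unfolding absolutely_integrable_on_def by simp
  with 3 show ?thesis unfolding action_def Let_def f_def[symmetric] by simp
qed

locale smooth_manifold =
  fixes A :: "('a::t2_space, 'e::euclidean_space) chart set"
  assumes smooth_atlas: "smooth_atlas A"
begin

lemma ex_chart: "\<exists>c\<in>A. x \<in> fst c"
proof -
  have "x \<in> (\<Union>c\<in>A. fst c)" using smooth_atlas unfolding smooth_atlas_def by simp
  then show ?thesis by blast
qed

lemma
  assumes "c \<in> A"
  shows open_chart_domain: "open (fst c)"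
    and open_chart_image: "open (chart_image c)"
    and chart_homeomorphism: "homeomorphism (fst c) (chart_image c) (snd c) (chart_inv c)"
  using bspec[OF smooth_atlas[unfolded smooth_atlas_def, THEN conjunct2, THEN conjunct1] assms] by blast+

lemma chart_inv_chart [simp]: "c \<in> A \<Longrightarrow> x \<in> fst c \<Longrightarrow> chart_inv c (snd c x) = x"
  by (rule homeomorphism_apply1[OF chart_homeomorphism])

lemma chart_chart_inv [simp]: "c \<in> A \<Longrightarrow> q \<in> chart_image c \<Longrightarrow> snd c (chart_inv c q) = q"
  by (rule homeomorphism_apply2[OF chart_homeomorphism])

lemma chart_inv_in_domain [simp]: "c \<in> A \<Longrightarrow> q \<in> chart_image c \<Longrightarrow> chart_inv c q \<in> fst c"
  by (auto intro: inv_into_into)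

lemma continuous_on_chart: "c \<in> A \<Longrightarrow> continuous_on (fst c) (snd c)"
  by (rule homeomorphism_cont1[OF chart_homeomorphism])

lemma continuous_on_chart_inv: "c \<in> A \<Longrightarrow> continuous_on (chart_image c) (chart_inv c)"
  by (rule homeomorphism_cont2[OF chart_homeomorphism])

abbreviation transition :: "('a, 'e) chart \<Rightarrow> ('a, 'e) chart \<Rightarrow> 'e \<Rightarrow> 'e" where
  "transition c d \<equiv> snd d \<circ> chart_inv c"

abbreviation overlap :: "('a, 'e) chart \<Rightarrow> ('a, 'e) chart \<Rightarrow> 'e set" where
  "overlap c d \<equiv> snd c ` (fst c \<inter> fst d)"

lemma open_overlap:
  assumes "c \<in> A" "d \<in> A"
  shows "open (overlap c d)"
proof -
  have "openin (top_of_set (chart_image c)) (chart_image c \<inter> chart_inv c -` fst d)"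
    by (rule continuous_openin_preimage_gen[OF continuous_on_chart_inv[OF assms(1)] open_chart_domain[OF assms(2)]])
  then have "open (chart_image c \<inter> chart_inv c -` fst d)"
    by (rule openin_open_trans) (rule open_chart_image[OF assms(1)])
  moreover have "overlap c d = chart_image c \<inter> chart_inv c -` fst d"
  proof (intro set_eqI iffI)
    fix q assume "q \<in> overlap c d"
    then obtain x where "x \<in> fst c" "x \<in> fst d" "q = snd c x" by blast
    then show "q \<in> chart_image c \<inter> chart_inv c -` fst d" using assms by simp
  next
    fix q assume q: "q \<in> chart_image c \<inter> chart_inv c -` fst d"
    then have "q = snd c (chart_inv c q)" "chart_inv c q \<in> fst c" using assms by simp_all
    with q show "q \<in> overlap c d" by blast
  qed
  ultimately show ?thesis by simp
qed

lemma overlap_mem: "x \<in> fst c \<Longrightarrow> x \<in> fst d \<Longrightarrow> snd c x \<in> overlap c d"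
  by blast

lemma
  assumes "c \<in> A" "d \<in> A"
  shows transition_differentiable: "q \<in> overlap c d \<Longrightarrow> transition c d differentiable (at q)"
    and continuous_on_transition_derivative:
      "continuous_on (overlap c d) (\<lambda>q. frechet_derivative (transition c d) (at q) v)"
proof -
  have "smooth_on (overlap c d) (transition c d)"
    using smooth_atlas[unfolded smooth_atlas_def, THEN conjunct2, THEN conjunct2] assms by blast
  then have "Ck_on (Suc 0) (overlap c d) (transition c d)" unfolding smooth_on_def by blast
  then show "q \<in> overlap c d \<Longrightarrow> transition c d differentiable (at q)"
    and "continuous_on (overlap c d) (\<lambda>q. frechet_derivative (transition c d) (at q) v)"
    unfolding Ck_on.simps by blast+
qed

lemma transition_has_derivative:
  assumes "c \<in> A" "d \<in> A" "x \<in> fst c" "x \<in> fst d"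
  shows "(transition c d has_derivative frechet_derivative (transition c d) (at (snd c x))) (at (snd c x))"
  using transition_differentiable[OF assms(1,2) overlap_mem[OF assms(3,4)]]
  unfolding frechet_derivative_works .

lemma tangent_of_same_chart:
  assumes "c \<in> A" "x \<in> fst c"
  shows "tangent_of A c x w c = w"
proof -
  have "(transition c c has_derivative (\<lambda>v. v)) (at (snd c x))"
    by (rule has_derivative_transform_within_open[OF has_derivative_ident open_chart_image[OF assms(1)]])
      (use assms in auto)
  then have "frechet_derivative (transition c c) (at (snd c x)) = (\<lambda>v. v)"
    using frechet_derivative_at by metis
  then show ?thesis using assms by (simp add: tangent_of_def)
qed

lemma frechet_derivative_transition_trans:
  assumes "c \<in> A" "d \<in> A" "e \<in> A" "x \<in> fst c" "x \<in> fst d" "x \<in> fst e"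
  shows "frechet_derivative (transition c e) (at (snd c x)) w
       = frechet_derivative (transition d e) (at (snd d x)) (frechet_derivative (transition c d) (at (snd c x)) w)"
proof -
  have D: "(transition d e has_derivative frechet_derivative (transition d e) (at (snd d x)))
      (at (transition c d (snd c x)))"
    using transition_has_derivative[of d e x] assms by simp
  have "(transition d e \<circ> transition c d has_derivative
     frechet_derivative (transition d e) (at (snd d x)) \<circ> frechet_derivative (transition c d) (at (snd c x)))
     (at (snd c x))"
    by (rule diff_chain_at[OF transition_has_derivative[OF assms(1,2,4,5)] D])
  then have "(transition c e has_derivative
     frechet_derivative (transition d e) (at (snd d x)) \<circ> frechet_derivative (transition c d) (at (snd c x)))
     (at (snd c x))"
  proof (rule has_derivative_transform_within_open[OF _ open_overlap[OF assms(1,2)] overlap_mem[OF assms(4,5)]])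
    fix q assume "q \<in> overlap c d"
    then obtain y where "y \<in> fst c" "y \<in> fst d" "q = snd c y" by blast
    then show "(transition d e \<circ> transition c d) q = transition c e q" using assms by simp
  qed
  from frechet_derivative_at[OF this, symmetric] show ?thesis by simp
qed

lemma tangent_of_in_tangent_space:
  assumes "c \<in> A" "x \<in> fst c"
  shows "tangent_of A c x w \<in> tangent_space A x"
  unfolding tangent_space_def mem_Collect_eq
proof (intro conjI allI ballI impI)
  show "tangent_of A c x w d = 0" if "\<not> (d \<in> A \<and> x \<in> fst d)" for d
    using that unfolding tangent_of_def by (rule if_not_P)
  fix d e assume "d \<in> A" "e \<in> A" "x \<in> fst d \<and> x \<in> fst e"
  then show "tangent_of A c x w e = frechet_derivative (transition d e) (at (snd d x)) (tangent_of A c x w d)"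
    using frechet_derivative_transition_trans[of c d e x w] assms by (simp add: tangent_of_def)
qed

lemma tangent_of_chart_coordinates:
  assumes "v \<in> tangent_space A x" "c \<in> A" "x \<in> fst c"
  shows "tangent_of A c x (v c) = v"
proof
  fix d
  have v: "\<And>d. \<not> (d \<in> A \<and> x \<in> fst d) \<Longrightarrow> v d = 0"
    "\<And>d. d \<in> A \<Longrightarrow> x \<in> fst d \<Longrightarrow> v d = frechet_derivative (transition c d) (at (snd c x)) (v c)"
    using assms unfolding tangent_space_def by blast+
  show "tangent_of A c x (v c) d = v d"
  proof (cases "d \<in> A \<and> x \<in> fst d")
    case True
    then show ?thesis using v(2)[of d] by (simp add: tangent_of_def)
  next
    case False
    show ?thesis unfolding tangent_of_def if_not_P[OF False] using v(1)[OF False] by simp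
  qed
qed

lemma continuous_imp_eventually_in_chart:
  assumes "continuous (at \<tau> within S) \<gamma>" "c \<in> A" "\<gamma> \<tau> \<in> fst c"
  shows "\<forall>\<^sub>F \<sigma> in at \<tau> within S. \<gamma> \<sigma> \<in> fst c"
  using assms(1) unfolding continuous_within
  by (rule topological_tendstoD[OF _ open_chart_domain[OF assms(2)] assms(3)])

text \<open>The coordinate velocities of a curve in two charts are related by the derivative of the transition map, which
  is how the coordinates of a tangent vector are related.\<close>

lemma chart_derivative_change:
  assumes \<gamma>: "continuous (at \<tau> within S) \<gamma>" "\<tau> \<in> S" and c: "c \<in> A" "\<gamma> \<tau> \<in> fst c" and d: "d \<in> A" "\<gamma> \<tau> \<in> fst d"
    and deriv: "(snd c \<circ> \<gamma> has_vector_derivative w) (at \<tau> within S)"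
  shows "(snd d \<circ> \<gamma> has_vector_derivative tangent_of A c (\<gamma> \<tau>) w d) (at \<tau> within S)"
proof -
  have D: "(transition c d has_derivative frechet_derivative (transition c d) (at (snd c (\<gamma> \<tau>))))
     (at ((snd c \<circ> \<gamma>) \<tau>) within (snd c \<circ> \<gamma>) ` S)"
    using has_derivative_at_withinI[OF transition_has_derivative[OF c(1) d(1) c(2) d(2)]] by simp
  have e: "tangent_of A c (\<gamma> \<tau>) w d = frechet_derivative (transition c d) (at (snd c (\<gamma> \<tau>))) w"
    using d by (simp add: tangent_of_def)
  have "(transition c d \<circ> (snd c \<circ> \<gamma>) has_vector_derivative tangent_of A c (\<gamma> \<tau>) w d) (at \<tau> within S)"
    unfolding e by (rule vector_derivative_diff_chain_within[OF deriv D])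
  then show ?thesis
    unfolding has_vector_derivative_def
  proof (rule has_derivative_transform_eventually)
    show "\<forall>\<^sub>F \<sigma> in at \<tau> within S. (transition c d \<circ> (snd c \<circ> \<gamma>)) \<sigma> = (snd d \<circ> \<gamma>) \<sigma>"
      using continuous_imp_eventually_in_chart[OF \<gamma>(1) c] by eventually_elim (simp add: c(1))
  qed (simp_all add: c \<gamma>(2))
qed

text \<open>One chart in which the curve is differentiable determines the velocity in all charts.\<close>

lemma velocity_eq_tangent_of:
  assumes \<gamma>: "continuous (at \<tau>) \<gamma>" and c: "c \<in> A" "\<gamma> \<tau> \<in> fst c"
    and deriv: "(snd c \<circ> \<gamma> has_vector_derivative w) (at \<tau>)"
  shows "velocity A \<gamma> \<tau> = tangent_of A c (\<gamma> \<tau>) w"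
proof
  fix d
  show "velocity A \<gamma> \<tau> d = tangent_of A c (\<gamma> \<tau>) w d"
  proof (cases "d \<in> A \<and> \<gamma> \<tau> \<in> fst d")
    case True
    then have "vector_derivative (snd d \<circ> \<gamma>) (at \<tau>) = tangent_of A c (\<gamma> \<tau>) w d"
      using vector_derivative_at[OF chart_derivative_change[OF \<gamma> UNIV_I c _ _ deriv, of d]] by blast
    then show ?thesis using True unfolding velocity_def by simp
  next
    case False
    then show ?thesis unfolding velocity_def tangent_of_def by meson
  qed
qed

text \<open>Being Lipschitz in charts passes to concatenations at once. It serves to show that the piecewise
  continuously differentiable curves below are absolutely continuous.\<close>

definition Lipschitz_curve :: "(real \<Rightarrow> 'a) \<Rightarrow> real \<Rightarrow> real \<Rightarrow> bool" where
  "Lipschitz_curve \<gamma> a b \<longleftrightarrow> a \<le> b \<and> continuous_on {a..b} \<gamma> \<and>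
     (\<forall>c\<in>A. \<forall>a' b'. a \<le> a' \<and> a' \<le> b' \<and> b' \<le> b \<and> \<gamma> ` {a'..b'} \<subseteq> fst c
        \<longrightarrow> (\<exists>C. C-lipschitz_on {a'..b'} (snd c \<circ> \<gamma>)))"

lemma Lipschitz_curve_imp_ac_curve: "Lipschitz_curve \<gamma> a b \<Longrightarrow> ac_curve A \<gamma> a b"
  unfolding Lipschitz_curve_def ac_curve_def using abs_continuous_on_if_Lipschitz by blast

lemma Lipschitz_curve_join:
  assumes 1: "Lipschitz_curve \<gamma> a b" and 2: "Lipschitz_curve \<gamma> b e"
  shows "Lipschitz_curve \<gamma> a e"
  unfolding Lipschitz_curve_def
proof (intro conjI ballI allI impI)
  show "a \<le> e" using 1 2 unfolding Lipschitz_curve_def by linarith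
  have "continuous_on ({a..b} \<union> {b..e}) \<gamma>"
    using 1 2 unfolding Lipschitz_curve_def by (intro continuous_on_closed_Un) auto
  then show "continuous_on {a..e} \<gamma>" using 1 2 unfolding Lipschitz_curve_def
    by (simp add: ivl_disj_un_two_touch)
  fix c a' b' assume c: "c \<in> A" and ab: "a \<le> a' \<and> a' \<le> b' \<and> b' \<le> e \<and> \<gamma> ` {a'..b'} \<subseteq> fst c"
  consider "b' \<le> b" | "b \<le> a'" | "a' < b" "b < b'" by linarith
  then show "\<exists>C. C-lipschitz_on {a'..b'} (snd c \<circ> \<gamma>)"
  proof cases
    case 1
    then show ?thesis using assms(1) c ab unfolding Lipschitz_curve_def by blast
  next
    case 2
    then show ?thesis using assms(2) c ab unfolding Lipschitz_curve_def by blast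
  next
    case 3
    have "\<exists>C. C-lipschitz_on {a'..b} (snd c \<circ> \<gamma>)"
      using assms(1) c ab 3 unfolding Lipschitz_curve_def by (auto simp: image_subset_iff)
    moreover have "\<exists>C. C-lipschitz_on {b..b'} (snd c \<circ> \<gamma>)"
      using assms(2) c ab 3 unfolding Lipschitz_curve_def by (auto simp: image_subset_iff)
    ultimately obtain C1 C2 where "C1-lipschitz_on {a'..b} (snd c \<circ> \<gamma>)" "C2-lipschitz_on {b..b'} (snd c \<circ> \<gamma>)"
      by blast
    from lipschitz_on_concat_max[OF this refl] show ?thesis by auto
  qed
qed

text \<open>The velocity \<open>V\<close> is prescribed up to the ends of \<open>S\<close>, where only one-sided derivatives exist.\<close>

definition C1_curve :: "(real \<Rightarrow> 'a) \<Rightarrow> (real \<Rightarrow> ('a, 'e) tangent) \<Rightarrow> real set \<Rightarrow> bool" where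
  "C1_curve \<gamma> V S \<longleftrightarrow> continuous_on S \<gamma> \<and>
     (\<forall>\<tau>\<in>S. V \<tau> \<in> tangent_space A (\<gamma> \<tau>)) \<and>
     (\<forall>c\<in>A. continuous_on {\<tau>\<in>S. \<gamma> \<tau> \<in> fst c} (\<lambda>\<tau>. V \<tau> c) \<and>
        (\<forall>\<tau>\<in>S. \<gamma> \<tau> \<in> fst c \<longrightarrow> (snd c \<circ> \<gamma> has_vector_derivative V \<tau> c) (at \<tau> within S)))"

lemma C1_curve_subset:
  assumes "C1_curve \<gamma> V S" "T \<subseteq> S"
  shows "C1_curve \<gamma> V T"
proof -
  have "continuous_on {\<tau>\<in>T. \<gamma> \<tau> \<in> fst c} (\<lambda>\<tau>. V \<tau> c)" if "c \<in> A" for c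
    using assms that unfolding C1_curve_def by (elim conjE) (rule continuous_on_subset, auto)
  moreover have "(snd c \<circ> \<gamma> has_vector_derivative V \<tau> c) (at \<tau> within T)"
    if "c \<in> A" "\<tau> \<in> T" "\<gamma> \<tau> \<in> fst c" for c \<tau>
    using assms that unfolding C1_curve_def by (blast intro: has_vector_derivative_within_subset)
  ultimately show ?thesis
    using assms continuous_on_subset unfolding C1_curve_def by blast
qed

lemma C1_curve_imp_Lipschitz_curve:
  assumes \<gamma>: "C1_curve \<gamma> V {a..b}" and "a \<le> b"
  shows "Lipschitz_curve \<gamma> a b"
  unfolding Lipschitz_curve_def
proof (intro conjI ballI allI impI)
  show "continuous_on {a..b} \<gamma>" using \<gamma> unfolding C1_curve_def by blast
  fix c a' b' assume c: "c \<in> A" and ab: "a \<le> a' \<and> a' \<le> b' \<and> b' \<le> b \<and> \<gamma> ` {a'..b'} \<subseteq> fst c"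
  have \<gamma>': "C1_curve \<gamma> V {a'..b'}" by (rule C1_curve_subset[OF \<gamma>]) (use ab in auto)
  have sub: "{\<tau>\<in>{a'..b'}. \<gamma> \<tau> \<in> fst c} = {a'..b'}" using ab by blast
  have "continuous_on {a'..b'} (\<lambda>\<tau>. V \<tau> c)"
    using \<gamma>' c sub unfolding C1_curve_def by metis
  then have "bounded ((\<lambda>\<tau>. V \<tau> c) ` {a'..b'})"
    by (intro compact_imp_bounded compact_continuous_image) auto
  then obtain B where B: "B > 0" "\<And>\<tau>. \<tau> \<in> {a'..b'} \<Longrightarrow> norm (V \<tau> c) \<le> B"
    unfolding bounded_pos by blast
  have "B-lipschitz_on {a'..b'} (snd c \<circ> \<gamma>)"
  proof (rule bounded_derivative_imp_lipschitz)
    show "(snd c \<circ> \<gamma> has_derivative (\<lambda>h. h *\<^sub>R V \<tau> c)) (at \<tau> within {a'..b'})" if "\<tau> \<in> {a'..b'}" for \<tau>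
      using \<gamma>' c that ab unfolding C1_curve_def has_vector_derivative_def by blast
    show "onorm (\<lambda>h. h *\<^sub>R V \<tau> c) \<le> B" if "\<tau> \<in> {a'..b'}" for \<tau>
    proof (rule onorm_le)
      show "norm (h *\<^sub>R V \<tau> c) \<le> B * norm h" for h
        using mult_right_mono[OF B(2)[OF that] abs_ge_zero[of h]] by (simp add: mult.commute)
    qed
  qed (use B in auto)
  then show "\<exists>C. C-lipschitz_on {a'..b'} (snd c \<circ> \<gamma>)" by blast
qed (rule \<open>a \<le> b\<close>)

lemma C1_curve_velocity:
  assumes \<gamma>: "C1_curve \<gamma> V S" and \<tau>: "\<tau> \<in> interior S"
  shows "velocity A \<gamma> \<tau> = V \<tau>"
proof -
  obtain c where c: "c \<in> A" "\<gamma> \<tau> \<in> fst c" using ex_chart by blast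
  have "\<tau> \<in> S" using \<tau> interior_subset by blast
  have at: "at \<tau> within S = at \<tau>" using \<tau> by (rule at_within_interior)
  have "continuous (at \<tau> within S) \<gamma>"
    using \<gamma> \<open>\<tau> \<in> S\<close> unfolding C1_curve_def continuous_on_eq_continuous_within by blast
  moreover have "(snd c \<circ> \<gamma> has_vector_derivative V \<tau> c) (at \<tau> within S)"
    using \<gamma> \<open>\<tau> \<in> S\<close> c unfolding C1_curve_def by blast
  ultimately have "velocity A \<gamma> \<tau> = tangent_of A c (\<gamma> \<tau>) (V \<tau> c)"
    unfolding at using velocity_eq_tangent_of c by blast
  moreover have "V \<tau> \<in> tangent_space A (\<gamma> \<tau>)" using \<gamma> \<open>\<tau> \<in> S\<close> unfolding C1_curve_def by blast
  ultimately show ?thesis using tangent_of_chart_coordinates c by simp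
qed

section \<open>Integral curves of time-dependent vector fields and chart segments\<close>

definition time_dependent_field :: "('a \<Rightarrow> real \<Rightarrow> ('a, 'e) tangent) \<Rightarrow> bool" where
  "time_dependent_field W \<longleftrightarrow> (\<forall>x t. W x t \<in> tangent_space A x) \<and>
     (\<forall>c\<in>A. continuous_on (chart_image c \<times> UNIV) (\<lambda>(q, t). W (chart_inv c q) t c))"

definition integral_curve :: "('a \<Rightarrow> real \<Rightarrow> ('a, 'e) tangent) \<Rightarrow> (real \<Rightarrow> 'a) \<Rightarrow> real set \<Rightarrow> bool" where
  "integral_curve W \<gamma> S \<longleftrightarrow> continuous_on S \<gamma> \<and>
     (\<forall>\<tau>\<in>S. \<forall>c\<in>A. \<gamma> \<tau> \<in> fst c \<longrightarrow> (snd c \<circ> \<gamma> has_vector_derivative W (\<gamma> \<tau>) \<tau> c) (at \<tau> within S))"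

lemma integral_curve_imp_C1_curve:
  assumes W: "time_dependent_field W" and \<gamma>: "integral_curve W \<gamma> S"
  shows "C1_curve \<gamma> (\<lambda>\<tau>. W (\<gamma> \<tau>) \<tau>) S"
proof -
  have "continuous_on {\<tau>\<in>S. \<gamma> \<tau> \<in> fst c} (\<lambda>\<tau>. W (\<gamma> \<tau>) \<tau> c)" if c: "c \<in> A" for c
  proof -
    let ?T = "{\<tau>\<in>S. \<gamma> \<tau> \<in> fst c}"
    have Wc: "continuous_on (chart_image c \<times> UNIV) (\<lambda>(q, t). W (chart_inv c q) t c)"
      using W c unfolding time_dependent_field_def by blast
    have "continuous_on ?T \<gamma>" using \<gamma> unfolding integral_curve_def by (auto intro: continuous_on_subset)
    then have "continuous_on ?T (\<lambda>\<tau>. snd c (\<gamma> \<tau>))"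
      by (rule continuous_on_compose2[OF continuous_on_chart[OF c]]) auto
    then have "continuous_on ?T (\<lambda>\<tau>. (\<lambda>(q, t). W (chart_inv c q) t c) (snd c (\<gamma> \<tau>), \<tau>))"
      by (intro continuous_on_compose2[OF Wc] continuous_intros) auto
    then show ?thesis
      by (rule continuous_on_eq) (use c in auto)
  qed
  then show ?thesis
    using W \<gamma> unfolding C1_curve_def integral_curve_def time_dependent_field_def by blast
qed

lemma integral_curve_cong:
  assumes "integral_curve W \<gamma> S" "\<And>\<tau>. \<tau> \<in> S \<Longrightarrow> \<gamma>' \<tau> = \<gamma> \<tau>"
  shows "integral_curve W \<gamma>' S"
  unfolding integral_curve_def
proof (intro conjI ballI impI)
  show "continuous_on S \<gamma>'"
    using assms continuous_on_cong[OF refl, of S \<gamma>' \<gamma>] unfolding integral_curve_def by blast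
  fix \<tau> c assume "\<tau> \<in> S" "c \<in> A" "\<gamma>' \<tau> \<in> fst c"
  then have "(snd c \<circ> \<gamma> has_vector_derivative W (\<gamma>' \<tau>) \<tau> c) (at \<tau> within S)"
    using assms unfolding integral_curve_def by metis
  then show "(snd c \<circ> \<gamma>' has_vector_derivative W (\<gamma>' \<tau>) \<tau> c) (at \<tau> within S)"
    by (rule has_vector_derivative_transform[OF \<open>\<tau> \<in> S\<close>, rotated]) (simp add: assms(2))
qed

lemma integral_curve_join:
  assumes 1: "integral_curve W \<gamma> {a..b}" and 2: "integral_curve W \<gamma> {b..e}" and ab: "a \<le> b" "b \<le> e"
  shows "integral_curve W \<gamma> {a..e}"
  unfolding integral_curve_def
proof (intro conjI ballI impI)
  have Un: "{a..e} = {a..b} \<union> {b..e}" using ab by auto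
  show "continuous_on {a..e} \<gamma>" unfolding Un
    using 1 2 unfolding integral_curve_def by (intro continuous_on_closed_Un) auto
  fix \<tau> c assume \<tau>: "\<tau> \<in> {a..e}" and c: "c \<in> A" "\<gamma> \<tau> \<in> fst c"
  consider "\<tau> < b" | "\<tau> = b" | "b < \<tau>" by linarith
  then show "(snd c \<circ> \<gamma> has_vector_derivative W (\<gamma> \<tau>) \<tau> c) (at \<tau> within {a..e})"
  proof cases
    case 1
    then have "at \<tau> within {a..e} = at \<tau> within {a..b}"
      using \<tau> ab by (intro at_within_nhd[of _ "{..<b}"]) auto
    then show ?thesis using assms(1) \<tau> c 1 unfolding integral_curve_def by auto
  next
    case 2
    then have "b \<in> {a..b}" "b \<in> {b..e}" using ab by auto
    then show ?thesis using assms(1,2) c unfolding Un 2 integral_curve_def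
      by (intro has_vector_derivative_within_Un) blast+
  next
    case 3
    then have "at \<tau> within {a..e} = at \<tau> within {b..e}"
      using \<tau> ab by (intro at_within_nhd[of _ "{b<..}"]) auto
    then show ?thesis using assms(2) \<tau> c 3 unfolding integral_curve_def by auto
  qed
qed

text \<open>Solve the equation in a chart by Peano's theorem. By periodicity the field is bounded in a coordinate ball
  uniformly in time, so the length \<open>h\<close> of the time interval depends neither on the initial time nor, for \<open>x\<close>
  near \<open>x0\<close>, on the initial point.\<close>

lemma local_integral_curves:
  assumes W: "time_dependent_field W" and per: "\<And>x t. W x (t + 1) = W x t"
  shows "\<exists>U h. open U \<and> x0 \<in> U \<and> h > 0 \<and> (\<forall>x\<in>U. \<forall>s. \<exists>\<gamma>. \<gamma> s = x \<and> integral_curve W \<gamma> {s..s + h})"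
proof -
  obtain c where c: "c \<in> A" "x0 \<in> fst c" using ex_chart by blast
  then obtain R where R: "R > 0" "cball (snd c x0) R \<subseteq> chart_image c"
    using open_chart_image[OF c(1)] open_contains_cball by blast
  define r where "r = R / 2"
  have r: "r > 0" using R by (simp add: r_def)
  define f where "f t q = W (chart_inv c q) t c" for t q
  have Wc: "continuous_on (chart_image c \<times> UNIV) (\<lambda>(q, t). f t q)"
    using W c unfolding time_dependent_field_def f_def by blast
  have "compact (cball (snd c x0) R \<times> {0..1::real})" by (intro compact_Times compact_cball compact_Icc)
  then have "bounded ((\<lambda>(q, t). f t q) ` (cball (snd c x0) R \<times> {0..1}))"
    by (intro compact_imp_bounded compact_continuous_image continuous_on_subset[OF Wc]) (use R in auto)
  then obtain B where B: "B > 0" "\<And>q t. q \<in> cball (snd c x0) R \<Longrightarrow> t \<in> {0..1} \<Longrightarrow> norm (f t q) \<le> B"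
    unfolding bounded_pos by (auto simp del: mem_cball)
  have bnd: "norm (f t q) \<le> B" if "q \<in> cball (snd c x0) R" for q t
  proof -
    have "f (frac t) q = f t q" by (rule periodic_frac[of "\<lambda>t. f t q"]) (simp add: f_def per)
    moreover have "frac t \<in> {0..1}" using frac_lt_1[of t] frac_ge_0[of t] by auto
    ultimately show ?thesis using B(2)[OF that] by metis
  qed
  define h where "h = r / B"
  have h: "h > 0" "B * h \<le> r" using r B(1) by (auto simp: h_def)
  define U where "U = fst c \<inter> snd c -` ball (snd c x0) r"
  have "open U" unfolding U_def
    by (rule openin_open_trans[OF continuous_openin_preimage_gen[OF continuous_on_chart[OF c(1)] open_ball]
          open_chart_domain[OF c(1)]])
  moreover have "x0 \<in> U" using c r by (simp add: U_def)
  moreover have "\<exists>\<gamma>. \<gamma> s = x \<and> integral_curve W \<gamma> {s..s + h}" if x: "x \<in> U" for x s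
  proof -
    have xc: "x \<in> fst c" and xr: "dist (snd c x0) (snd c x) < r" using x by (auto simp: U_def)
    have sub: "cball (snd c x) r \<subseteq> cball (snd c x0) R"
    proof
      fix q assume "q \<in> cball (snd c x) r"
      then have "dist (snd c x0) q \<le> r + r"
        using dist_triangle[of "snd c x0" q "snd c x"] xr by (simp add: dist_commute)
      then show "q \<in> cball (snd c x0) R" by (simp add: r_def)
    qed
    have sub': "cball (snd c x) r \<subseteq> chart_image c" using sub R(2) by blast
    have "continuous_on ({s..s + h} \<times> cball (snd c x) r) (\<lambda>p. (\<lambda>(q, t). f t q) (snd p, fst p))"
      by (rule continuous_on_compose2[OF Wc]) (use sub' in \<open>auto intro!: continuous_intros\<close>)
    then have cont: "continuous_on ({s..s + h} \<times> cball (snd c x) r) (\<lambda>(t, q). f t q)"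
      by (simp add: case_prod_unfold)
    obtain q where q: "q s = snd c x" "\<And>t. t \<in> {s..s + h} \<Longrightarrow> q t \<in> cball (snd c x) r"
      "\<And>t. t \<in> {s..s + h} \<Longrightarrow> (q has_vector_derivative f t (q t)) (at t within {s..s + h})"
    proof (rule Peano_existence[OF h(1) less_imp_le[OF B(1)] cont _ h(2)])
      show "norm (f t q) \<le> B" if "q \<in> cball (snd c x) r" for t q using bnd that sub by blast
    qed blast
    define \<gamma> where "\<gamma> = chart_inv c \<circ> q"
    have qI: "q t \<in> chart_image c" if "t \<in> {s..s + h}" for t using q(2)[OF that] sub' by blast
    have \<gamma>c: "\<gamma> t \<in> fst c" if "t \<in> {s..s + h}" for t unfolding \<gamma>_def using qI[OF that] c by simp
    have "continuous_on {s..s + h} q"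
      using q(3) by (meson continuous_on_eq_continuous_within has_vector_derivative_continuous)
    then have cont\<gamma>: "continuous_on {s..s + h} \<gamma>"
      unfolding \<gamma>_def by (rule continuous_on_compose[OF _ continuous_on_subset[OF continuous_on_chart_inv[OF c(1)]]])
        (use qI in blast)
    have "integral_curve W \<gamma> {s..s + h}"
      unfolding integral_curve_def
    proof (intro conjI ballI impI cont\<gamma>)
      fix \<tau> d assume \<tau>: "\<tau> \<in> {s..s + h}" and d: "d \<in> A" "\<gamma> \<tau> \<in> fst d"
      have "W (\<gamma> \<tau>) \<tau> c = f \<tau> (q \<tau>)" by (simp add: f_def \<gamma>_def)
      then have "(snd c \<circ> \<gamma> has_vector_derivative W (\<gamma> \<tau>) \<tau> c) (at \<tau> within {s..s + h})"
        using has_vector_derivative_transform[OF \<tau> _ q(3)[OF \<tau>], of "snd c \<circ> \<gamma>"] qI c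
        by (simp add: \<gamma>_def)
      moreover have "continuous (at \<tau> within {s..s + h}) \<gamma>"
        using cont\<gamma> \<tau> continuous_on_eq_continuous_within by metis
      ultimately have "(snd d \<circ> \<gamma> has_vector_derivative tangent_of A c (\<gamma> \<tau>) (W (\<gamma> \<tau>) \<tau> c) d) (at \<tau> within {s..s + h})"
        using chart_derivative_change \<tau> c(1) \<gamma>c[OF \<tau>] d by blast
      moreover have "tangent_of A c (\<gamma> \<tau>) (W (\<gamma> \<tau>) \<tau> c) = W (\<gamma> \<tau>) \<tau>"
        using tangent_of_chart_coordinates[OF _ c(1) \<gamma>c[OF \<tau>]] W unfolding time_dependent_field_def by blast
      ultimately show "(snd d \<circ> \<gamma> has_vector_derivative W (\<gamma> \<tau>) \<tau> d) (at \<tau> within {s..s + h})" by simp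
    qed
    moreover have "\<gamma> s = x" using q(1) c xc by (simp add: \<gamma>_def)
    ultimately show ?thesis by blast
  qed
  ultimately show ?thesis using h(1) by blast
qed

lemma integral_curve_subset:
  "integral_curve W \<gamma> S \<Longrightarrow> T \<subseteq> S \<Longrightarrow> integral_curve W \<gamma> T"
  unfolding integral_curve_def 
  by (meson continuous_on_subset has_vector_derivative_within_subset subsetD)

lemma uniform_integral_curves:
  assumes "compact (UNIV :: 'a set)" and W: "time_dependent_field W" and per: "\<And>x t. W x (t + 1) = W x t"
  obtains h where "h > 0" "\<And>x s. \<exists>\<gamma>. \<gamma> s = x \<and> integral_curve W \<gamma> {s..s + h}"
proof -
  obtain U H where UH: "\<And>x0. open (U x0)" "\<And>x0. x0 \<in> U x0" "\<And>x0. H x0 > 0"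
    "\<And>x0 x s. x \<in> U x0 \<Longrightarrow> \<exists>\<gamma>. \<gamma> s = x \<and> integral_curve W \<gamma> {s..s + H x0}"
    using local_integral_curves[OF W per] by metis
  obtain C where C: "finite C" "UNIV \<subseteq> (\<Union>x0\<in>C. U x0)"
    by (rule compactE_image[OF assms(1), of UNIV U]) (use UH in auto)
  have "C \<noteq> {}" using C(2) by auto
  define h where "h = Min (H ` C)"
  show thesis
  proof (rule that[of h])
    show "h > 0" unfolding h_def using C(1) \<open>C \<noteq> {}\<close> UH(3) by simp
    fix x s
    obtain x0 where x0: "x0 \<in> C" "x \<in> U x0" using C(2) by blast
    then obtain \<gamma> where "\<gamma> s = x" "integral_curve W \<gamma> {s..s + H x0}" using UH(4) by blast
    moreover have "h \<le> H x0" unfolding h_def using x0 C(1) by simp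
    ultimately show "\<exists>\<gamma>. \<gamma> s = x \<and> integral_curve W \<gamma> {s..s + h}"
      by (intro exI[of _ \<gamma>]) (auto intro: integral_curve_subset)
  qed
qed

text \<open>Concatenate solutions on successive intervals of the uniform length \<open>h\<close> provided by compactness. At the
  junctions the two one-sided derivatives agree, because both are given by the field.\<close>

lemma forward_integral_curve_exists:
  assumes "compact (UNIV :: 'a set)" and W: "time_dependent_field W" and per: "\<And>x t. W x (t + 1) = W x t"
  shows "\<exists>\<gamma>. \<gamma> s = x \<and> integral_curve W \<gamma> {s..}"
proof -
  obtain h where h: "h > 0" and ex: "\<And>x s. \<exists>\<gamma>. \<gamma> s = x \<and> integral_curve W \<gamma> {s..s + h}"
    using uniform_integral_curves[OF assms] by metis
  define sol where "sol x s = (SOME \<gamma>. \<gamma> s = x \<and> integral_curve W \<gamma> {s..s + h})" for x s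
  have sol: "sol x s s = x" "integral_curve W (sol x s) {s..s + h}" for x s
    using someI_ex[OF ex[of s x]] unfolding sol_def by blast+
  define T where "T n = s + real n * h" for n
  define y where "y = rec_nat x (\<lambda>n z. sol z (T n) (T (Suc n)))"
  have y: "y 0 = x" "y (Suc n) = sol (y n) (T n) (T (Suc n))" for n by (simp_all add: y_def)
  have T_Suc: "T (Suc n) = T n + h" for n by (simp add: T_def algebra_simps)
  define \<gamma> where "\<gamma> t = (let n = nat \<lfloor>(t - s) / h\<rfloor> in sol (y n) (T n) t)" for t
  have \<gamma>_eq: "\<gamma> t = sol (y n) (T n) t" if t: "T n \<le> t" "t \<le> T (Suc n)" for n t
  proof (cases "t = T (Suc n)")
    case True
    have "(t - s) / h = real (Suc n)" using h unfolding True T_def by simp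
    then have "nat \<lfloor>(t - s) / h\<rfloor> = Suc n" by (simp only: floor_of_nat nat_int)
    then have "\<gamma> t = sol (y (Suc n)) (T (Suc n)) t" by (simp add: \<gamma>_def Let_def)
    then show ?thesis unfolding True by (simp add: sol y)
  next
    case False
    then have "t < T (Suc n)" using t by simp
    then have "real n \<le> (t - s) / h" "(t - s) / h < real n + 1"
      using t h unfolding T_def by (simp_all add: field_simps)
    then have "\<lfloor>(t - s) / h\<rfloor> = int n" by (intro floor_unique) auto
    then show ?thesis by (simp add: \<gamma>_def Let_def)
  qed
  have piece: "integral_curve W \<gamma> {T n..T (Suc n)}" for n
    by (rule integral_curve_cong[of W "sol (y n) (T n)"]) (use sol(2)[of "y n" "T n"] \<gamma>_eq T_Suc in auto)
  have T_mono: "T m \<le> T n" if "m \<le> n" for m n using that h by (simp add: T_def mult_right_mono)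
  have upto: "integral_curve W \<gamma> {s..T (Suc n)}" for n
  proof (induction n)
    case 0
    then show ?case using piece[of 0] by (simp add: T_def)
  next
    case (Suc n)
    show ?case
      by (rule integral_curve_join[OF Suc piece]) (use T_mono[of 0 "Suc n"] T_mono[of "Suc n" "Suc (Suc n)"] in \<open>auto simp: T_def\<close>)
  qed
  have near: "\<exists>n. \<tau> < T (Suc n)" for \<tau>
  proof -
    obtain n where "(\<tau> - s) / h < real n" using reals_Archimedean2 by blast
    then have "\<tau> < T n" using h by (simp add: T_def field_simps)
    then show ?thesis using T_mono[of n "Suc n"] by (intro exI[of _ n]) simp
  qed
  have at_eq: "at \<tau> within {s..} = at \<tau> within {s..T (Suc n)}" if "\<tau> < T (Suc n)" for \<tau> n
    by (rule at_within_nhd[of _ "{..<T (Suc n)}"]) (use that in auto)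
  have "integral_curve W \<gamma> {s..}"
    unfolding integral_curve_def continuous_on_eq_continuous_within
  proof (intro conjI ballI impI)
    fix \<tau> assume \<tau>: "\<tau> \<in> {s..}"
    obtain n where n: "\<tau> < T (Suc n)" using near by blast
    have \<tau>': "\<tau> \<in> {s..T (Suc n)}" using \<tau> n by auto
    show "continuous (at \<tau> within {s..}) \<gamma>"
      using upto[of n] \<tau>' unfolding at_eq[OF n] integral_curve_def continuous_on_eq_continuous_within by blast
    fix c assume "c \<in> A" "\<gamma> \<tau> \<in> fst c"
    then show "(snd c \<circ> \<gamma> has_vector_derivative W (\<gamma> \<tau>) \<tau> c) (at \<tau> within {s..})"
      using upto[of n] \<tau>' unfolding at_eq[OF n] integral_curve_def by blast
  qed
  moreover have "\<gamma> s = x" using \<gamma>_eq[of 0 s] h sol(1) y(1) by (simp add: T_def)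
  ultimately show ?thesis by blast
qed

lemma tangent_space_uminus:
  assumes "v \<in> tangent_space A x"
  shows "(\<lambda>c. - v c) \<in> tangent_space A x"
  unfolding tangent_space_def mem_Collect_eq
proof (intro conjI allI ballI impI)
  show "- v c = 0" if "\<not> (c \<in> A \<and> x \<in> fst c)" for c
  proof -
    have "v c = 0" using assms that unfolding tangent_space_def by blast
    then show ?thesis by simp
  qed
  fix c d assume cd: "c \<in> A" "d \<in> A" "x \<in> fst c \<and> x \<in> fst d"
  then have "v d = frechet_derivative (transition c d) (at (snd c x)) (v c)"
    using assms unfolding tangent_space_def by blast
  moreover have "linear (frechet_derivative (transition c d) (at (snd c x)))"
    using transition_has_derivative cd has_derivative_linear by blast
  ultimately show "- v d = frechet_derivative (transition c d) (at (snd c x)) (- v c)"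
    by (simp add: linear_neg)
qed

text \<open>Reversing time turns \<open>W(x, t)\<close> into \<open>- W(x, -t)\<close> and backward into forward integral curves.\<close>

lemma backward_integral_curve_exists:
  assumes comp: "compact (UNIV :: 'a set)" and W: "time_dependent_field W" and per: "\<And>x t. W x (t + 1) = W x t"
  shows "\<exists>\<gamma>. \<gamma> s = x \<and> integral_curve W \<gamma> {..s}"
proof -
  define W' where "W' x t = (\<lambda>c. - W x (- t) c)" for x t
  have W': "time_dependent_field W'"
    unfolding time_dependent_field_def
  proof (intro conjI allI ballI)
    show "W' x t \<in> tangent_space A x" for x t
      unfolding W'_def using W tangent_space_uminus unfolding time_dependent_field_def by blast
    fix c assume "c \<in> A"
    then have Wc: "continuous_on (chart_image c \<times> UNIV) (\<lambda>(q, t). W (chart_inv c q) t c)"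
      using W unfolding time_dependent_field_def by blast
    have "continuous_on (chart_image c \<times> UNIV) (\<lambda>p. - (\<lambda>(q, t). W (chart_inv c q) t c) (fst p, - snd p))"
      by (intro continuous_intros continuous_on_compose2[OF Wc]) auto
    then show "continuous_on (chart_image c \<times> UNIV) (\<lambda>(q, t). W' (chart_inv c q) t c)"
      by (simp add: W'_def case_prod_unfold)
  qed
  have "W' x (t + 1) = W' x t" for x t
    using per[of x "- (t + 1)"] by (simp add: W'_def)
  then obtain \<gamma> where \<gamma>: "\<gamma> (- s) = x" "integral_curve W' \<gamma> {- s..}"
    using forward_integral_curve_exists[OF comp W'] by blast
  have im: "uminus ` {..s} = {- s..}" by simp
  have "integral_curve W (\<gamma> \<circ> uminus) {..s}"
    unfolding integral_curve_def
  proof (intro conjI ballI impI)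
    show "continuous_on {..s} (\<gamma> \<circ> uminus)"
      using \<gamma>(2) unfolding integral_curve_def im[symmetric]
      by (intro continuous_on_compose continuous_intros) auto
    fix \<tau> c assume \<tau>: "\<tau> \<in> {..s}" and c: "c \<in> A" "(\<gamma> \<circ> uminus) \<tau> \<in> fst c"
    have "(snd c \<circ> \<gamma> has_vector_derivative W' (\<gamma> (- \<tau>)) (- \<tau>) c) (at (- \<tau>) within uminus ` {..s})"
      using \<gamma>(2) \<tau> c unfolding im integral_curve_def by simp
    moreover have "(uminus has_vector_derivative - 1) (at \<tau> within {..s})"
      by (auto intro!: derivative_eq_intros)
    ultimately have "((snd c \<circ> \<gamma>) \<circ> uminus has_vector_derivative (- 1) *\<^sub>R W' (\<gamma> (- \<tau>)) (- \<tau>) c) (at \<tau> within {..s})"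
      by (intro vector_diff_chain_within)
    then show "(snd c \<circ> (\<gamma> \<circ> uminus) has_vector_derivative W ((\<gamma> \<circ> uminus) \<tau>) \<tau> c) (at \<tau> within {..s})"
      by (simp add: W'_def o_assoc)
  qed
  moreover have "(\<gamma> \<circ> uminus) s = x" using \<gamma>(1) by simp
  ultimately show ?thesis by blast
qed

lemma C1_curve_cong:
  assumes "C1_curve \<gamma> V S" and eq: "\<And>\<tau>. \<tau> \<in> S \<Longrightarrow> \<gamma>' \<tau> = \<gamma> \<tau>"
  shows "C1_curve \<gamma>' V S"
proof -
  have "{\<tau>\<in>S. \<gamma>' \<tau> \<in> fst c} = {\<tau>\<in>S. \<gamma> \<tau> \<in> fst c}" for c :: "('a, 'e) chart" using eq by auto
  moreover have "continuous_on S \<gamma>'"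
    using assms continuous_on_cong[OF refl, of S \<gamma>' \<gamma>] unfolding C1_curve_def by blast
  moreover have "(snd c \<circ> \<gamma>' has_vector_derivative V \<tau> c) (at \<tau> within S)"
    if \<tau>: "\<tau> \<in> S" and c: "c \<in> A" "\<gamma>' \<tau> \<in> fst c" for \<tau> c
  proof (rule has_vector_derivative_transform[OF \<tau>])
    show "(snd c \<circ> \<gamma> has_vector_derivative V \<tau> c) (at \<tau> within S)"
      using assms(1) \<tau> c eq[OF \<tau>] unfolding C1_curve_def by simp
  qed (simp add: eq)
  moreover have "\<forall>\<tau>\<in>S. V \<tau> \<in> tangent_space A (\<gamma>' \<tau>)"
    using assms(1) eq unfolding C1_curve_def by simp
  ultimately show ?thesis using assms(1) unfolding C1_curve_def by simp
qed

text \<open>The coordinate segment from \<open>q0\<close> to \<open>q1\<close>, traversed during the unit of time after \<open>m\<close>.\<close>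

abbreviation chart_segment :: "('a, 'e) chart \<Rightarrow> 'e \<Rightarrow> 'e \<Rightarrow> real \<Rightarrow> real \<Rightarrow> 'a" where
  "chart_segment c q0 q1 m \<tau> \<equiv> chart_inv c (q0 + (\<tau> - m) *\<^sub>R (q1 - q0))"

lemma C1_curve_chart_segment:
  fixes m :: real
  assumes c: "c \<in> A" and conv: "convex B" "B \<subseteq> chart_image c" and q: "q0 \<in> B" "q1 \<in> B"
  defines "\<sigma> \<equiv> \<lambda>\<tau>. chart_segment c q0 q1 m \<tau>"
  shows "C1_curve \<sigma> (\<lambda>\<tau>. tangent_of A c (\<sigma> \<tau>) (q1 - q0)) {m..m + 1}"
proof -
  define q where "q \<tau> = q0 + (\<tau> - m) *\<^sub>R (q1 - q0)" for \<tau>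
  have \<sigma>: "\<sigma> = chart_inv c \<circ> q" by (simp add: \<sigma>_def q_def fun_eq_iff)
  have qB: "q \<tau> \<in> chart_image c" if "\<tau> \<in> {m..m + 1}" for \<tau>
  proof -
    have "(1 - (\<tau> - m)) *\<^sub>R q0 + (\<tau> - m) *\<^sub>R q1 \<in> B"
      by (rule convexD_alt[OF conv(1) q]) (use that in auto)
    moreover have "(1 - (\<tau> - m)) *\<^sub>R q0 + (\<tau> - m) *\<^sub>R q1 = q \<tau>" by (simp add: q_def algebra_simps)
    ultimately show ?thesis using conv(2) by auto
  qed
  have qc: "continuous_on S q" for S unfolding q_def by (intro continuous_intros)
  have \<sigma>c: "\<sigma> \<tau> \<in> fst c" if "\<tau> \<in> {m..m + 1}" for \<tau> unfolding \<sigma> using qB[OF that] c by simp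
  have cont\<sigma>: "continuous_on {m..m + 1} \<sigma>"
    unfolding \<sigma> by (rule continuous_on_compose[OF qc continuous_on_subset[OF continuous_on_chart_inv[OF c]]])
      (use qB in blast)
  show ?thesis
    unfolding C1_curve_def
  proof (intro conjI ballI impI cont\<sigma>)
    show "tangent_of A c (\<sigma> \<tau>) (q1 - q0) \<in> tangent_space A (\<sigma> \<tau>)" if "\<tau> \<in> {m..m + 1}" for \<tau>
      by (rule tangent_of_in_tangent_space[OF c \<sigma>c[OF that]])
    fix d assume d: "d \<in> A"
    let ?T = "{\<tau> \<in> {m..m + 1}. \<sigma> \<tau> \<in> fst d}"
    have qT: "q ` ?T \<subseteq> overlap c d"
    proof
      fix p assume "p \<in> q ` ?T"
      then obtain \<tau> where \<tau>: "\<tau> \<in> {m..m + 1}" "\<sigma> \<tau> \<in> fst d" "p = q \<tau>" by blast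
      then have "p = snd c (\<sigma> \<tau>)" using qB[OF \<tau>(1)] c by (simp add: \<sigma>)
      then show "p \<in> overlap c d" using \<sigma>c[OF \<tau>(1)] \<tau>(2) by blast
    qed
    have "continuous_on ?T (\<lambda>\<tau>. frechet_derivative (transition c d) (at (q \<tau>)) (q1 - q0))"
      by (rule continuous_on_compose2[OF continuous_on_transition_derivative[OF c d] qc qT])
    then show "continuous_on ?T (\<lambda>\<tau>. tangent_of A c (\<sigma> \<tau>) (q1 - q0) d)"
      by (rule continuous_on_eq) (use d c qB in \<open>simp add: tangent_of_def \<sigma>\<close>)
    fix \<tau> assume \<tau>: "\<tau> \<in> {m..m + 1}" "\<sigma> \<tau> \<in> fst d"
    have "(q has_vector_derivative (q1 - q0)) (at \<tau> within {m..m + 1})"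
      unfolding q_def by (auto intro!: derivative_eq_intros)
    then have "(snd c \<circ> \<sigma> has_vector_derivative (q1 - q0)) (at \<tau> within {m..m + 1})"
      by (rule has_vector_derivative_transform[OF \<tau>(1), rotated]) (use qB c in \<open>simp add: \<sigma>\<close>)
    moreover have "continuous (at \<tau> within {m..m + 1}) \<sigma>"
      using cont\<sigma> \<tau>(1) continuous_on_eq_continuous_within by metis
    ultimately show "(snd d \<circ> \<sigma> has_vector_derivative tangent_of A c (\<sigma> \<tau>) (q1 - q0) d) (at \<tau> within {m..m + 1})"
      using chart_derivative_change \<tau> c \<sigma>c[OF \<tau>(1)] d by blast
  qed
qed

lemma relatively_compact_chart_ball:
  obtains c r where "c \<in> A" "x \<in> fst c" "r > 0" "cball (snd c x) r \<subseteq> chart_image c"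
    "open (fst c \<inter> snd c -` ball (snd c x) r)"
proof -
  obtain c where c: "c \<in> A" "x \<in> fst c" using ex_chart by blast
  then obtain r where r: "r > 0" "cball (snd c x) r \<subseteq> chart_image c"
    using open_chart_image[OF c(1)] open_contains_cball by blast
  have "open (fst c \<inter> snd c -` ball (snd c x) r)"
    by (rule openin_open_trans[OF continuous_openin_preimage_gen[OF continuous_on_chart[OF c(1)] open_ball]
          open_chart_domain[OF c(1)]])
  with c r show thesis using that by blast
qed

end

section \<open>The Hamilton-Jacobi equation in charts\<close>

locale C1_Hamilton_Jacobi_solution = smooth_manifold A
  for A :: "('a::t2_space, 'e::euclidean_space) chart set" +
  fixes L :: "('a, 'e) lagrangian" and u :: "'a \<times> circle \<Rightarrow> real" and k :: real
  assumes smooth: "smooth_lagrangian A L"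
    and convex: "convex_lagrangian A L"
    and superlinear: "superlinear_lagrangian A L"
    and periodic: "periodic_lagrangian A L"
    and C1_Lip: "C1_Lip A u"
    and hj: "hamilton_jacobi A L k u"
begin

abbreviation loc :: "('a, 'e) chart \<Rightarrow> 'e \<times> 'e \<times> real \<Rightarrow> real" where
  "loc c \<equiv> local_lagrangian A L c"

abbreviation uloc :: "('a, 'e) chart \<Rightarrow> 'e \<times> real \<Rightarrow> real" where
  "uloc c \<equiv> (\<lambda>(q, t). u (chart_inv c q, circle_of t))"

lemma loc_tangent:
  assumes "c \<in> A" "x \<in> fst c" "v \<in> tangent_space A x"
  shows "loc c (snd c x, v c, t) = L x v t"
  using assms by (simp add: local_lagrangian_def tangent_of_chart_coordinates)

lemma loc_smooth: "c \<in> A \<Longrightarrow> smooth_on (chart_image c \<times> UNIV \<times> UNIV) (loc c)"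
  using smooth unfolding smooth_lagrangian_def by blast

lemma continuous_on_loc: "c \<in> A \<Longrightarrow> continuous_on (chart_image c \<times> UNIV \<times> UNIV) (loc c)"
  by (rule smooth_on_imp_continuous_on[OF loc_smooth])

text \<open>On \<open>K\<close> the Riemannian norm of a tangent vector is bounded below by a positive multiple of the Euclidean norm
  of its coordinates, by compactness of \<open>K\<close> times the unit sphere.\<close>

lemma loc_coercive:
  assumes c: "c \<in> A" and K: "compact K" "K \<subseteq> chart_image c" and C: "C \<ge> 0"
  obtains R where "\<And>q w t. q \<in> K \<Longrightarrow> norm w > R \<Longrightarrow> C * norm w \<le> loc c (q, w, t)"
proof (cases "K = {}")
  case True
  then show thesis using that by blast
next
  case False
  obtain g where g: "riemannian_metric A g" and
    sup: "\<And>K. \<exists>R>0. \<forall>x. \<forall>v\<in>tangent_space A x. \<forall>t. sqrt (g x v v) > R \<longrightarrow> L x v t / sqrt (g x v v) > K"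
    using superlinear unfolding superlinear_lagrangian_def by blast
  define G where "G q v w = g (chart_inv c q) (tangent_of A c (chart_inv c q) v) (tangent_of A c (chart_inv c q) w)" for q v w
  have bil: "bilinear (G q)" and pos: "\<And>v. v \<noteq> 0 \<Longrightarrow> G q v v > 0" if "q \<in> K" for q
    using g c chart_inv_in_domain[OF c, of q] that K(2) unfolding riemannian_metric_def G_def by blast+
  have G_cont: "continuous_on K (\<lambda>q. G q v w)" for v w
    using g c K(2) unfolding riemannian_metric_def G_def
    by (blast intro: continuous_on_subset smooth_on_imp_continuous_on)
  have "continuous_on (K \<times> sphere 0 1) (\<lambda>p. \<Sum>i\<in>Basis. \<Sum>j\<in>Basis. (snd p \<bullet> i) * (snd p \<bullet> j) * G (fst p) i j)"
    by (intro continuous_intros continuous_on_compose2[OF G_cont]) auto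
  then have "continuous_on (K \<times> sphere 0 1) (\<lambda>p. G (fst p) (snd p) (snd p))"
    by (rule continuous_on_eq) (auto simp: bilinear_Basis_expansion[OF bil, symmetric])
  moreover have "compact (K \<times> sphere (0::'e) 1)" using K(1) by (intro compact_Times compact_sphere)
  moreover obtain b :: 'e where "b \<in> Basis" using nonempty_Basis by blast
  then have "b \<in> sphere 0 1" by simp
  then have "K \<times> sphere (0::'e) 1 \<noteq> {}" using False by blast
  ultimately obtain p where p: "p \<in> K \<times> sphere 0 1"
    "\<And>p'. p' \<in> K \<times> sphere 0 1 \<Longrightarrow> G (fst p) (snd p) (snd p) \<le> G (fst p') (snd p') (snd p')"
    using continuous_attains_inf[of "K \<times> sphere (0::'e) 1" "\<lambda>p. G (fst p) (snd p) (snd p)"] by blast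
  define m where "m = G (fst p) (snd p) (snd p)"
  have "m > 0" unfolding m_def using p(1) by (intro pos) auto
  have low: "m * (norm w)\<^sup>2 \<le> G q w w" if q: "q \<in> K" and "w \<noteq> 0" for q w
  proof -
    define w' where "w' = (1 / norm w) *\<^sub>R w"
    have w': "w = norm w *\<^sub>R w'" "norm w' = 1" using \<open>w \<noteq> 0\<close> by (simp_all add: w'_def)
    have "m \<le> G q w' w'" using p(2)[of "(q, w')"] q w'(2) unfolding m_def by simp
    then have "m * (norm w)\<^sup>2 \<le> G q w' w' * (norm w)\<^sup>2" by (intro mult_right_mono) auto
    also have "\<dots> = G q (norm w *\<^sub>R w') (norm w *\<^sub>R w')"
      by (simp add: bilinear_lmul[OF bil[OF q]] bilinear_rmul[OF bil[OF q]] power2_eq_square)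
    finally show ?thesis using w'(1) by simp
  qed
  obtain R where R: "R > 0" "\<And>x v t. v \<in> tangent_space A x \<Longrightarrow> sqrt (g x v v) > R \<Longrightarrow>
      L x v t / sqrt (g x v v) > C / sqrt m"
    using sup[of "C / sqrt m"] by blast
  show thesis
  proof (rule that[of "R / sqrt m"])
    fix q w :: 'e and t assume q: "q \<in> K" and w: "norm w > R / sqrt m"
    define x where "x = chart_inv c q"
    define v where "v = tangent_of A c x w"
    have x: "x \<in> fst c" using chart_inv_in_domain[OF c] q K(2) by (auto simp: x_def)
    have "w \<noteq> 0"
    proof
      assume "w = 0"
      moreover have "R / sqrt m > 0" using R(1) \<open>m > 0\<close> by simp
      ultimately show False using w by simp
    qed
    have gv: "g x v v = G q w w" by (simp add: G_def v_def x_def)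
    have "sqrt (m * (norm w)\<^sup>2) \<le> sqrt (g x v v)" unfolding gv using low[OF q \<open>w \<noteq> 0\<close>] by simp
    then have *: "sqrt m * norm w \<le> sqrt (g x v v)" by (simp add: real_sqrt_mult)
    have "R < sqrt m * norm w" using w \<open>m > 0\<close> by (simp add: field_simps)
    then have "R < sqrt (g x v v)" using * by linarith
    moreover from this have "L x v t / sqrt (g x v v) > C / sqrt m"
      by (rule R(2)[rotated]) (simp add: v_def tangent_of_in_tangent_space[OF c x])
    moreover have "sqrt (g x v v) > 0" using R(1) \<open>R < sqrt (g x v v)\<close> by linarith
    ultimately have "C / sqrt m * sqrt (g x v v) < L x v t" by (simp add: less_divide_eq)
    moreover have "C / sqrt m * (sqrt m * norm w) \<le> C / sqrt m * sqrt (g x v v)"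
      using * C \<open>m > 0\<close> by (intro mult_left_mono) auto
    ultimately have "C * norm w \<le> L x v t" using \<open>m > 0\<close> by simp
    then show "C * norm w \<le> loc c (q, w, t)" by (simp add: local_lagrangian_def v_def x_def)
  qed
qed

lemma uloc_C1:
  assumes c: "c \<in> A"
  shows "\<exists>D. (\<forall>z\<in>chart_image c \<times> UNIV. (uloc c has_derivative blinfun_apply (D z)) (at z)) \<and>
             continuous_on (chart_image c \<times> UNIV) D"
proof -
  let ?S = "chart_image c \<times> (UNIV :: real set)"
  obtain D where D: "\<forall>z\<in>?S. (uloc c has_derivative blinfun_apply (D z)) (at z)"
    "\<forall>z\<in>?S. \<exists>r>0. \<exists>C. C-lipschitz_on (ball z r \<inter> ?S) D"
    using C1_Lip c unfolding C1_Lip_def C1_Lip_on_def by blast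
  have "continuous_on ?S D"
  proof (rule continuous_on_if_locally_openin)
    fix z assume "z \<in> ?S"
    then obtain r C where r: "r > 0" "C-lipschitz_on (ball z r \<inter> ?S) D" using D(2) by blast
    have "openin (top_of_set ?S) (ball z r \<inter> ?S)"
      unfolding Int_commute[of "ball z r"] by (rule openin_open_Int) simp
    moreover have "z \<in> ball z r \<inter> ?S" using r(1) \<open>z \<in> ?S\<close> by simp
    ultimately show "\<exists>T. openin (top_of_set ?S) T \<and> z \<in> T \<and> continuous_on T D"
      using lipschitz_on_continuous_on[OF r(2)] by blast
  qed
  with D(1) show ?thesis by blast
qed

text \<open>The differential of \<open>u\<close> in the chart \<open>c\<close>, with a choice that depends continuously on the point.\<close>

definition Du :: "('a, 'e) chart \<Rightarrow> 'e \<times> real \<Rightarrow> ('e \<times> real) \<Rightarrow>\<^sub>L real" where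
  "Du c = (SOME D. (\<forall>z\<in>chart_image c \<times> UNIV. (uloc c has_derivative blinfun_apply (D z)) (at z)) \<and>
             continuous_on (chart_image c \<times> UNIV) D)"

lemma
  assumes "c \<in> A"
  shows uloc_has_derivative: "q \<in> chart_image c \<Longrightarrow> (uloc c has_derivative blinfun_apply (Du c (q, t))) (at (q, t))"
    and continuous_on_Du: "continuous_on (chart_image c \<times> UNIV) (Du c)"
  using someI_ex[OF uloc_C1[OF assms]] unfolding Du_def by blast+

lemma uloc_space_derivative:
  assumes "c \<in> A" "q \<in> chart_image c"
  shows "((\<lambda>q. u (chart_inv c q, circle_of t)) has_derivative (\<lambda>w. Du c (q, t) (w, 0))) (at q)"
proof -
  have "((\<lambda>q. (q, t)) has_derivative (\<lambda>w. (w, 0))) (at q)"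
    by (auto intro!: derivative_eq_intros)
  from has_derivative_compose[OF this uloc_has_derivative[OF assms]]
  show ?thesis by simp
qed

lemma uloc_time_derivative:
  assumes "c \<in> A" "x \<in> fst c"
  shows "((\<lambda>s. u (x, circle_of s)) has_real_derivative Du c (snd c x, t) (0, 1)) (at t)"
proof -
  have emb: "((\<lambda>s. (snd c x, s)) has_derivative (\<lambda>h. (0, h))) (at t)"
    by (auto intro!: derivative_eq_intros)
  have q: "snd c x \<in> chart_image c" using assms by blast
  have "((\<lambda>s. uloc c (snd c x, s)) has_derivative (\<lambda>h. Du c (snd c x, t) (0, h))) (at t)"
    by (rule has_derivative_compose[OF emb uloc_has_derivative[OF assms(1) q]])
  moreover have "(\<lambda>h. Du c (snd c x, t) (0, h)) = (*) (Du c (snd c x, t) (0, 1))"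
  proof
    fix h :: real
    show "Du c (snd c x, t) (0, h) = Du c (snd c x, t) (0, 1) * h"
      using blinfun.scaleR_right[of "Du c (snd c x, t)" h "(0, 1)"] by (simp add: mult.commute)
  qed
  moreover have "(\<lambda>s. uloc c (snd c x, s)) = (\<lambda>s. u (x, circle_of s))"
    using assms by simp
  ultimately show ?thesis unfolding has_field_derivative_def by simp
qed

text \<open>The chain rule for transition maps removes the dependence on the chart that is chosen in the definition of the
  partial differential.\<close>

lemma diff_x_in_chart:
  assumes c: "c \<in> A" "x \<in> fst c" and v: "v \<in> tangent_space A x"
  shows "diff_x A u x (circle_of t) v = Du c (snd c x, t) (v c, 0)"
proof -
  define d where "d = (SOME d. d \<in> A \<and> x \<in> fst d)"
  have d: "d \<in> A" "x \<in> fst d"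
    unfolding d_def using someI_ex[of "\<lambda>d. d \<in> A \<and> x \<in> fst d"] ex_chart by blast+
  have dx: "snd d x \<in> chart_image d" using d by blast
  have "diff_x A u x (circle_of t) v = Du d (snd d x, t) (v d, 0)"
    unfolding diff_x_def Let_def d_def[symmetric]
    using frechet_derivative_at[OF uloc_space_derivative[OF d(1) dx, of t], symmetric] by simp
  also have "v d = frechet_derivative (transition c d) (at (snd c x)) (v c)"
    using v c d unfolding tangent_space_def by blast
  also have "Du d (snd d x, t) (frechet_derivative (transition c d) (at (snd c x)) (v c), 0) = Du c (snd c x, t) (v c, 0)"
  proof -
    have "((\<lambda>q. u (chart_inv d q, circle_of t)) has_derivative (\<lambda>w. Du d (snd d x, t) (w, 0))) (at (transition c d (snd c x)))"
      using uloc_space_derivative[OF d(1) dx] c by simp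
    from diff_chain_at[OF transition_has_derivative[OF c(1) d(1) c(2) d(2)] this]
    have "((\<lambda>q. u (chart_inv c q, circle_of t)) has_derivative
       (\<lambda>w. Du d (snd d x, t) (w, 0)) \<circ> frechet_derivative (transition c d) (at (snd c x))) (at (snd c x))"
    proof (rule has_derivative_transform_within_open[OF _ open_overlap[OF c(1) d(1)] overlap_mem[OF c(2) d(2)]])
      fix q assume "q \<in> overlap c d"
      then obtain y where "y \<in> fst c" "y \<in> fst d" "q = snd c y" by blast
      then show "((\<lambda>q. u (chart_inv d q, circle_of t)) \<circ> transition c d) q = u (chart_inv c q, circle_of t)"
        using c d by simp
    qed
    moreover have "((\<lambda>q. u (chart_inv c q, circle_of t)) has_derivative (\<lambda>w. Du c (snd c x, t) (w, 0))) (at (snd c x))"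
      by (rule uloc_space_derivative) (use c in auto)
    ultimately have "(\<lambda>w. Du d (snd d x, t) (w, 0)) \<circ> frechet_derivative (transition c d) (at (snd c x)) = (\<lambda>w. Du c (snd c x, t) (w, 0))"
      by (rule has_derivative_unique)
    then show ?thesis by (metis comp_apply)
  qed
  finally show ?thesis .
qed

text \<open>The deficit in the Fenchel inequality \<open>u_x v \<le> L + H\<close>, with \<open>H\<close> expressed by the Hamilton-Jacobi
  equation.\<close>

definition gap :: "'a \<Rightarrow> real \<Rightarrow> ('a, 'e) tangent \<Rightarrow> real" where
  "gap x t v = L x v t + k - deriv (\<lambda>s. u (x, circle_of s)) t - diff_x A u x (circle_of t) v"

lemma gap_in_chart:
  assumes c: "c \<in> A" "x \<in> fst c" and v: "v \<in> tangent_space A x"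
  shows "gap x t v = loc c (snd c x, v c, t) + k - Du c (snd c x, t) (v c, 1)"
proof -
  have "Du c (snd c x, t) (v c, 1) = Du c (snd c x, t) (v c, 0) + Du c (snd c x, t) (0, 1)"
    by (simp add: blinfun.add_right[symmetric])
  moreover have "deriv (\<lambda>s. u (x, circle_of s)) t = Du c (snd c x, t) (0, 1)"
    by (rule DERIV_imp_deriv[OF uloc_time_derivative[OF c]])
  ultimately show ?thesis
    unfolding gap_def diff_x_in_chart[OF assms] loc_tangent[OF assms] by simp
qed

lemma gap_tangent_of:
  assumes c: "c \<in> A" "x \<in> fst c"
  shows "gap x t (tangent_of A c x w) = loc c (snd c x, w, t) + k - Du c (snd c x, t) (w, 1)"
  using gap_in_chart[OF c tangent_of_in_tangent_space[OF c]] tangent_of_same_chart[OF c] by simp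

text \<open>By superlinearity the maximum that defines the Hamiltonian is attained; the equation says that its
  value is \<open>k - u_t\<close>.\<close>

lemma gap_minimum:
  "\<exists>v\<in>tangent_space A x. gap x t v = 0 \<and> (\<forall>w\<in>tangent_space A x. gap x t w \<ge> 0)"
proof -
  obtain c where c: "c \<in> A" "x \<in> fst c" using ex_chart by blast
  define q where "q = snd c x"
  have q: "q \<in> chart_image c" using c by (auto simp: q_def)
  define F where "F w = Du c (q, t) (w, 0) - loc c (q, w, t)" for w
  define B where "B = norm (Du c (q, t))"
  obtain R0 where R0: "\<And>w. norm w > R0 \<Longrightarrow> (B + 1) * norm w \<le> loc c (q, w, t)"
  proof (rule loc_coercive[OF c(1), of "{q}" "B + 1"])
  qed (use q in \<open>auto simp: B_def\<close>)
  define R where "R = max R0 \<bar>F 0\<bar>"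
  have far: "F w < F 0" if w: "norm w > R" for w
  proof -
    have "norm (Du c (q, t) (w, 0)) \<le> B * norm (w, 0 :: real)" unfolding B_def by (rule norm_blinfun)
    then have "Du c (q, t) (w, 0) \<le> B * norm w" by (simp add: norm_Pair)
    then have "F w \<le> - norm w" using R0[of w] w unfolding F_def R_def by (simp add: algebra_simps)
    then show ?thesis using w unfolding R_def by linarith
  qed
  have "R \<ge> 0" unfolding R_def by auto
  have "continuous_on UNIV (\<lambda>w. loc c (q, w, t))"
    by (rule continuous_on_compose2[OF continuous_on_loc[OF c(1)]]) (use q in \<open>auto intro!: continuous_intros\<close>)
  then have "continuous_on (cball 0 R) F"
    unfolding F_def by (intro continuous_intros continuous_on_subset[of UNIV _ "cball 0 R"]) auto
  then obtain w0 where w0: "w0 \<in> cball 0 R" "\<And>w. w \<in> cball 0 R \<Longrightarrow> F w \<le> F w0"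
    using continuous_attains_sup[of "cball 0 R" F] \<open>R \<ge> 0\<close> by auto
  have max: "F w \<le> F w0" for w
  proof (cases "norm w > R")
    case True
    then show ?thesis using far[OF True] w0(2)[of 0] \<open>R \<ge> 0\<close> by simp
  next
    case False
    then show ?thesis using w0(2)[of w] by simp
  qed
  have val: "diff_x A u x (circle_of t) v - L x v t = F (v c)" if "v \<in> tangent_space A x" for v
    using diff_x_in_chart[OF c that] loc_tangent[OF c that] by (simp add: F_def q_def)
  define v0 where "v0 = tangent_of A c x w0"
  have v0: "v0 \<in> tangent_space A x" "v0 c = w0"
    unfolding v0_def using tangent_of_in_tangent_space[OF c] tangent_of_same_chart[OF c] by auto
  have "hamiltonian A L x (diff_x A u x (circle_of t)) t = F w0"
    unfolding hamiltonian_def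
  proof (rule Greatest_equality)
    show "\<exists>v\<in>tangent_space A x. F w0 = diff_x A u x (circle_of t) v - L x v t"
      using v0 val by metis
    fix h assume "\<exists>v\<in>tangent_space A x. h = diff_x A u x (circle_of t) v - L x v t"
    then show "h \<le> F w0" using val max by auto
  qed
  moreover have "deriv (\<lambda>s. u (x, circle_of s)) t + hamiltonian A L x (diff_x A u x (circle_of t)) t = k"
    using hj unfolding hamilton_jacobi_def by blast
  ultimately have "gap x t v = F w0 - F (v c)" if "v \<in> tangent_space A x" for v
    using val[OF that] unfolding gap_def by linarith
  then show ?thesis using v0 max by (intro bexI[of _ v0]) auto
qed

lemma loc_fiber_derivative:
  assumes c: "c \<in> A" "q \<in> chart_image c"
  shows "((\<lambda>w. loc c (q, w, t)) has_derivative (\<lambda>h. frechet_derivative (loc c) (at (q, w, t)) (0, h, 0))) (at w)"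
    and "((\<lambda>w. frechet_derivative (\<lambda>w. loc c (q, w, t)) (at w) h) has_derivative
         frechet_derivative (\<lambda>w. frechet_derivative (\<lambda>w. loc c (q, w, t)) (at w) h) (at w)) (at w)"
proof -
  have mem: "(q, w, t) \<in> chart_image c \<times> UNIV \<times> UNIV" for w using c by simp
  have emb: "((\<lambda>w. (q, w, t)) has_derivative (\<lambda>h. (0, h, 0))) (at w)" for w
    by (auto intro!: derivative_eq_intros)
  have D: "((\<lambda>w. loc c (q, w, t)) has_derivative (\<lambda>h. frechet_derivative (loc c) (at (q, w, t)) (0, h, 0))) (at w)" for w
    using has_derivative_compose[OF emb smooth_on_imp_C2(1)[OF loc_smooth[OF c(1)] mem, unfolded frechet_derivative_works]] .
  then show "((\<lambda>w. loc c (q, w, t)) has_derivative (\<lambda>h. frechet_derivative (loc c) (at (q, w, t)) (0, h, 0))) (at w)" .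
  have eq: "frechet_derivative (\<lambda>w. loc c (q, w, t)) (at w) h = frechet_derivative (loc c) (at (q, w, t)) (0, h, 0)" for w
    using frechet_derivative_at[OF D] by metis
  have "(\<lambda>w. frechet_derivative (loc c) (at (q, w, t)) (0, h, 0)) differentiable (at w)"
    using has_derivative_compose[OF emb smooth_on_imp_C2(2)[OF loc_smooth[OF c(1)] mem, unfolded frechet_derivative_works]]
    unfolding differentiable_def by blast
  then show "((\<lambda>w. frechet_derivative (\<lambda>w. loc c (q, w, t)) (at w) h) has_derivative
         frechet_derivative (\<lambda>w. frechet_derivative (\<lambda>w. loc c (q, w, t)) (at w) h) (at w)) (at w)"
    unfolding frechet_derivative_works[symmetric] eq .
qed

text \<open>Between two zeros, which are minima, the derivative of the gap along the joining segment vanishes at both ends,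
  while the second derivative is positive by convexity of the Lagrangian.\<close>

lemma gap_zero_unique:
  assumes v: "v \<in> tangent_space A x" "gap x t v = 0" and w: "w \<in> tangent_space A x" "gap x t w = 0"
  shows "v = w"
proof (rule ccontr)
  assume "v \<noteq> w"
  obtain c where c: "c \<in> A" "x \<in> fst c" using ex_chart by blast
  define q where "q = snd c x"
  have q: "q \<in> chart_image c" using c by (auto simp: q_def)
  define h where "h = w c - v c"
  have "h \<noteq> 0"
    using \<open>v \<noteq> w\<close> tangent_of_chart_coordinates[OF v(1) c] tangent_of_chart_coordinates[OF w(1) c]
    unfolding h_def by auto
  define f where "f y = loc c (q, y, t)" for y
  define \<phi> where "\<phi> s = gap x t (tangent_of A c x (v c + s *\<^sub>R h))" for s
  define \<phi>' where "\<phi>' s = frechet_derivative f (at (v c + s *\<^sub>R h)) h - Du c (q, t) (h, 0)" for s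
  have \<phi>: "\<phi> s = f (v c + s *\<^sub>R h) + k - Du c (q, t) (v c + s *\<^sub>R h, 1)" for s
    unfolding \<phi>_def gap_tangent_of[OF c] f_def q_def ..
  have line: "((\<lambda>s. v c + s *\<^sub>R h) has_derivative (\<lambda>d. d *\<^sub>R h)) (at s)" for s
    by (auto intro!: derivative_eq_intros)
  have d1: "(\<phi> has_real_derivative \<phi>' s) (at s)" for s
  proof -
    have fD: "(f has_derivative frechet_derivative f (at y)) (at y)" for y
      using loc_fiber_derivative(1)[OF c(1) q] frechet_derivative_works differentiableI unfolding f_def by metis
    have "((\<lambda>s. f (v c + s *\<^sub>R h)) has_derivative (\<lambda>d. frechet_derivative f (at (v c + s *\<^sub>R h)) (d *\<^sub>R h))) (at s)"
      by (rule has_derivative_compose[OF line fD])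
    moreover have "frechet_derivative f (at (v c + s *\<^sub>R h)) (d *\<^sub>R h) = d * frechet_derivative f (at (v c + s *\<^sub>R h)) h" for d
      using linear_cmul[OF has_derivative_linear[OF fD]] by simp
    ultimately have "((\<lambda>s. f (v c + s *\<^sub>R h)) has_derivative (\<lambda>d. d * frechet_derivative f (at (v c + s *\<^sub>R h)) h)) (at s)"
      by simp
    moreover have "((\<lambda>s. Du c (q, t) (v c + s *\<^sub>R h, 1)) has_derivative (\<lambda>d. Du c (q, t) (d *\<^sub>R h, 0))) (at s)"
      by (auto intro!: derivative_eq_intros)
    moreover have "Du c (q, t) (d *\<^sub>R h, 0) = d * Du c (q, t) (h, 0)" for d
      using blinfun.scaleR_right[of "Du c (q, t)" d "(h, 0)"] by simp
    ultimately have "(\<phi> has_derivative (\<lambda>d. d * frechet_derivative f (at (v c + s *\<^sub>R h)) h + 0 - d * Du c (q, t) (h, 0))) (at s)"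
      unfolding \<phi> by (intro has_derivative_diff has_derivative_add has_derivative_const) simp_all
    then show ?thesis unfolding has_field_derivative_def
      by (rule has_derivative_eq_rhs) (simp add: \<phi>'_def fun_eq_iff algebra_simps)
  qed
  have nonneg: "\<phi> s \<ge> 0" for s
    unfolding \<phi>_def using gap_minimum[of x t] tangent_of_in_tangent_space[OF c] by blast
  have "\<phi> 0 = 0" "\<phi> 1 = 0"
    using v w tangent_of_chart_coordinates[OF v(1) c] tangent_of_chart_coordinates[OF w(1) c]
    unfolding \<phi>_def h_def by simp_all
  then have "\<phi>' 0 = 0" "\<phi>' 1 = 0"
    using nonneg by (auto intro!: DERIV_local_min[OF d1 zero_less_one])
  define \<phi>'' where "\<phi>'' s = hessian f (v c + s *\<^sub>R h) h h" for s
  have d2: "(\<phi>' has_real_derivative \<phi>'' s) (at s)" for s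
  proof -
    let ?g = "\<lambda>y. frechet_derivative f (at y) h"
    have gD: "(?g has_derivative frechet_derivative ?g (at y)) (at y)" for y
      using loc_fiber_derivative(2)[OF c(1) q, of t h y] unfolding f_def .
    have "((\<lambda>s. ?g (v c + s *\<^sub>R h)) has_derivative (\<lambda>d. frechet_derivative ?g (at (v c + s *\<^sub>R h)) (d *\<^sub>R h))) (at s)"
      by (rule has_derivative_compose[OF line gD])
    moreover have "frechet_derivative ?g (at (v c + s *\<^sub>R h)) (d *\<^sub>R h) = d * \<phi>'' s" for d
      unfolding \<phi>''_def hessian_def using linear_cmul[OF has_derivative_linear[OF gD]] by simp
    ultimately have "(\<phi>' has_derivative (\<lambda>d. d * \<phi>'' s - 0)) (at s)"
      unfolding \<phi>'_def by (intro has_derivative_diff has_derivative_const) simp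
    then show ?thesis unfolding has_field_derivative_def
      by (rule has_derivative_eq_rhs) (simp add: fun_eq_iff mult.commute)
  qed
  obtain s where "\<phi>' 1 - \<phi>' 0 = (1 - 0) * \<phi>'' s" using MVT2[of 0 1 \<phi>' \<phi>''] d2 by auto
  moreover have "\<phi>'' s > 0"
    unfolding \<phi>''_def f_def using convex c(1) q \<open>h \<noteq> 0\<close> unfolding convex_lagrangian_def by blast
  ultimately show False using \<open>\<phi>' 0 = 0\<close> \<open>\<phi>' 1 = 0\<close> by simp
qed

section \<open>The calibrated vector field\<close>

definition calibrated_velocity :: "'a \<Rightarrow> real \<Rightarrow> ('a, 'e) tangent" where
  "calibrated_velocity x t = (THE v. v \<in> tangent_space A x \<and> gap x t v = 0)"

lemma calibrated_velocity_unique: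
  "v \<in> tangent_space A x \<and> gap x t v = 0 \<longleftrightarrow> v = calibrated_velocity x t"
proof -
  have "\<exists>!v. v \<in> tangent_space A x \<and> gap x t v = 0"
    using gap_minimum gap_zero_unique by blast
  from theI'[OF this] this show ?thesis unfolding calibrated_velocity_def[symmetric] by blast
qed

lemma calibrated_velocity_tangent: "calibrated_velocity x t \<in> tangent_space A x"
  and gap_calibrated_velocity: "gap x t (calibrated_velocity x t) = 0"
  using calibrated_velocity_unique by blast+

lemma gap_nonneg: "v \<in> tangent_space A x \<Longrightarrow> gap x t v \<ge> 0"
  using gap_minimum by blast

lemma L_periodic: "v \<in> tangent_space A x \<Longrightarrow> L x v (t + 1) = L x v t"
  using periodic unfolding periodic_lagrangian_def by blast

lemma gap_periodic:
  assumes v: "v \<in> tangent_space A x"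
  shows "gap x (t + 1) v = gap x t v"
proof -
  obtain c where c: "c \<in> A" "x \<in> fst c" using ex_chart by blast
  let ?f = "\<lambda>s. u (x, circle_of s)"
  have "(?f has_real_derivative Du c (snd c x, t + 1) (0, 1)) (at (t + 1))"
    by (rule uloc_time_derivative[OF c])
  then have "((\<lambda>s. ?f (s + 1)) has_real_derivative Du c (snd c x, t + 1) (0, 1)) (at t)"
    unfolding DERIV_shift .
  then have "deriv ?f t = Du c (snd c x, t + 1) (0, 1)" by (intro DERIV_imp_deriv) simp
  moreover have "deriv ?f (t + 1) = Du c (snd c x, t + 1) (0, 1)"
    by (rule DERIV_imp_deriv[OF uloc_time_derivative[OF c]])
  ultimately show ?thesis unfolding gap_def L_periodic[OF v] by simp
qed

lemma calibrated_velocity_periodic: "calibrated_velocity x (t + 1) = calibrated_velocity x t"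
  using calibrated_velocity_unique[of "calibrated_velocity x (t + 1)" x t]
    calibrated_velocity_tangent[of x "t + 1"] gap_calibrated_velocity[of x "t + 1"]
    gap_periodic[OF calibrated_velocity_tangent[of x "t + 1"], of t] by simp

lemma calibrated_velocity_in_chart:
  assumes c: "c \<in> A" "q \<in> chart_image c"
  shows "loc c (q, w, t) + k - Du c (q, t) (w, 1) = 0 \<longleftrightarrow> w = calibrated_velocity (chart_inv c q) t c"
proof -
  define x where "x = chart_inv c q"
  have x: "x \<in> fst c" "snd c x = q" using c by (simp_all add: x_def)
  let ?v = "tangent_of A c x w"
  have "loc c (q, w, t) + k - Du c (q, t) (w, 1) = 0 \<longleftrightarrow> ?v = calibrated_velocity x t"
    using calibrated_velocity_unique[of ?v x t] tangent_of_in_tangent_space[OF c(1) x(1)]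
      gap_tangent_of[OF c(1) x(1), of t w] unfolding x(2) by simp
  also have "\<dots> \<longleftrightarrow> w = calibrated_velocity x t c"
    using tangent_of_same_chart[OF c(1) x(1), of w]
      tangent_of_chart_coordinates[OF calibrated_velocity_tangent[of x t] c(1) x(1)] by auto
  finally show ?thesis unfolding x_def .
qed

lemma Du_bounded:
  assumes c: "c \<in> A" and K: "compact K" "K \<subseteq> chart_image c \<times> UNIV"
  obtains B where "B \<ge> 0" "\<And>z v. z \<in> K \<Longrightarrow> \<bar>Du c z v\<bar> \<le> B * norm v"
proof -
  have "bounded (Du c ` K)"
    by (intro compact_imp_bounded compact_continuous_image continuous_on_subset[OF continuous_on_Du[OF c]] K)
  then obtain B where B: "B > 0" "\<And>z. z \<in> K \<Longrightarrow> norm (Du c z) \<le> B"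
    unfolding bounded_pos by blast
  show thesis
  proof (rule that[of B])
    fix z v assume "z \<in> K"
    have "\<bar>Du c z v\<bar> \<le> norm (Du c z) * norm v" using norm_blinfun[of "Du c z" v] by simp
    also have "\<dots> \<le> B * norm v" using B(2)[OF \<open>z \<in> K\<close>] by (rule mult_right_mono) simp
    finally show "\<bar>Du c z v\<bar> \<le> B * norm v" .
  qed (use B(1) in simp)
qed

text \<open>In a chart, the graph of the field over a compact set \<open>Z\<close> is the zero set of the continuous function \<open>gap\<close>.
  Coercivity bounds the field on \<open>Z\<close>, and a map into a compact set with closed graph is continuous.\<close>

lemma calibrated_velocity_field: "time_dependent_field calibrated_velocity"
  unfolding time_dependent_field_def
proof (intro conjI allI ballI calibrated_velocity_tangent)
  fix c assume c: "c \<in> A"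
  let ?V = "\<lambda>(q, t). calibrated_velocity (chart_inv c q) t c"
  let ?S = "chart_image c \<times> (UNIV :: real set)"
  show "continuous_on ?S ?V"
  proof (rule continuous_on_if_locally_openin)
    fix z0 assume "z0 \<in> ?S"
    then obtain q0 t0 where z0: "z0 = (q0, t0)" "q0 \<in> chart_image c" by blast
    then obtain r where r: "r > 0" "cball q0 r \<subseteq> chart_image c"
      using open_chart_image[OF c] open_contains_cball by blast
    define Z where "Z = cball q0 r \<times> cball t0 1"
    have Z: "compact Z" "Z \<subseteq> ?S" using r(2) unfolding Z_def by (auto intro!: compact_Times)
    obtain B where B: "B \<ge> 0" "\<And>z v. z \<in> Z \<Longrightarrow> \<bar>Du c z v\<bar> \<le> B * norm v"
      using Du_bounded[OF c Z] by blast
    obtain R where R: "\<And>q w t. q \<in> cball q0 r \<Longrightarrow> norm w > R \<Longrightarrow> (B + 1) * norm w \<le> loc c (q, w, t)"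
    proof (rule loc_coercive[OF c compact_cball r(2), of "B + 1"])
      show "B + 1 \<ge> 0" using B(1) by simp
    qed blast
    \<comment> \<open>If \<open>norm w > R\<close> and the gap vanishes at \<open>w\<close>, then \<open>(B + 1) * norm w \<le> B * (norm w + 1) - k\<close>.\<close>
    define R' where "R' = max R (B + \<bar>k\<bar>)"
    have bnd: "?V z \<in> cball 0 R'" if z: "z \<in> Z" for z
    proof (rule ccontr)
      obtain q t where qt: "z = (q, t)" by (cases z)
      then have q: "q \<in> cball q0 r" "q \<in> chart_image c" using z r(2) by (auto simp: Z_def)
      define w where "w = ?V z"
      assume "?V z \<notin> cball 0 R'"
      then have w: "norm w > R" "norm w > B + \<bar>k\<bar>" unfolding w_def R'_def by auto
      have "loc c (q, w, t) + k = Du c (q, t) (w, 1)"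
        using calibrated_velocity_in_chart[OF c q(2), of w t] unfolding w_def qt by simp
      also have "\<dots> \<le> B * norm (w, 1 :: real)" using B(2)[OF z, of "(w, 1)"] unfolding qt by linarith
      also have "\<dots> \<le> B * (norm w + 1)"
        using norm_Pair_le[of w "1 :: real"] B(1) by (intro mult_left_mono) auto
      finally have "(B + 1) * norm w + k \<le> B * (norm w + 1)" using R[OF q(1) w(1), of t] by linarith
      then have "norm w \<le> B - k" by (simp add: algebra_simps)
      then show False using w(2) by linarith
    qed
    have "continuous_on Z ?V"
    proof (rule continuous_from_closed_graph)
      show "compact (cball 0 R' :: 'e set)" by (rule compact_cball)
      show "?V \<in> Z \<rightarrow> cball 0 R'" using bnd by blast
      define G where "G p = loc c (fst (fst p), snd p, snd (fst p)) + k - Du c (fst p) (snd p, 1)"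
        for p :: "('e \<times> real) \<times> 'e"
      have "continuous_on (Z \<times> cball 0 R') G"
        unfolding G_def using Z(2)
        by (intro continuous_intros continuous_on_compose2[OF continuous_on_loc[OF c]]
            continuous_on_compose2[OF continuous_on_Du[OF c]]) auto
      then have "closed {p \<in> Z \<times> cball 0 R'. G p = 0}"
        by (rule continuous_closed_preimage_constant) (intro closed_Times closed_cball compact_imp_closed[OF Z(1)])
      moreover have "{p \<in> Z \<times> cball 0 R'. G p = 0} = (\<lambda>z. (z, ?V z)) ` Z"
      proof -
        have "G ((q, t), w) = 0 \<longleftrightarrow> w = ?V (q, t)" if "(q, t) \<in> Z" for q t w
          using calibrated_velocity_in_chart[OF c, of q w t] that Z(2) unfolding G_def by auto
        then have G: "G (z, w) = 0 \<longleftrightarrow> w = ?V z" if "z \<in> Z" for z w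
          using that by (metis surj_pair)
        show ?thesis
        proof (intro set_eqI iffI)
          fix p assume "p \<in> {p \<in> Z \<times> cball 0 R'. G p = 0}"
          then obtain z w where zw: "p = (z, w)" "z \<in> Z" "G (z, w) = 0" by blast
          then have "w = ?V z" using G by blast
          with zw show "p \<in> (\<lambda>z. (z, ?V z)) ` Z" by blast
        next
          fix p assume "p \<in> (\<lambda>z. (z, ?V z)) ` Z"
          then obtain z where z: "z \<in> Z" "p = (z, ?V z)" by blast
          then show "p \<in> {p \<in> Z \<times> cball 0 R'. G p = 0}"
            using bnd[OF z(1)] G[OF z(1), of "?V z"] by blast
        qed
      qed
      ultimately show "closed ((\<lambda>z. (z, ?V z)) ` Z)" by simp
    qed
    moreover have "?S \<inter> (ball q0 r \<times> ball t0 1) \<subseteq> Z" unfolding Z_def by auto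
    ultimately have "continuous_on (?S \<inter> (ball q0 r \<times> ball t0 1)) ?V" by (rule continuous_on_subset)
    moreover have "openin (top_of_set ?S) (?S \<inter> (ball q0 r \<times> ball t0 1))"
      by (intro openin_open_Int open_Times open_ball)
    moreover have "z0 \<in> ?S \<inter> (ball q0 r \<times> ball t0 1)" using z0 r(1) by auto
    ultimately show "\<exists>T. openin (top_of_set ?S) T \<and> z0 \<in> T \<and> continuous_on T ?V" by blast
  qed
qed

section \<open>Domination\<close>

lemma uloc_locally_Lipschitz:
  assumes c: "c \<in> A" and z0: "z0 \<in> chart_image c \<times> UNIV"
  obtains r B where "r > 0" "B \<ge> 0"
    "\<And>z z'. z \<in> ball z0 r \<Longrightarrow> z' \<in> ball z0 r \<Longrightarrow> norm (uloc c z' - uloc c z) \<le> B * norm (z' - z)"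
proof -
  have "open (chart_image c \<times> (UNIV :: real set))"
    by (intro open_Times open_chart_image[OF c] open_UNIV)
  then obtain r where r: "r > 0" "cball z0 r \<subseteq> chart_image c \<times> UNIV"
    using z0 unfolding open_contains_cball by blast
  obtain B where B: "B \<ge> 0" "\<And>z v. z \<in> cball z0 r \<Longrightarrow> \<bar>Du c z v\<bar> \<le> B * norm v"
    using Du_bounded[OF c compact_cball r(2)] by blast
  have sub: "ball z0 r \<subseteq> chart_image c \<times> UNIV" using r(2) ball_subset_cball by blast
  show thesis
  proof (rule that[OF r(1) B(1)])
    fix z z' assume z: "z \<in> ball z0 r" "z' \<in> ball z0 r"
    show "norm (uloc c z' - uloc c z) \<le> B * norm (z' - z)"
    proof (rule differentiable_bound[OF convex_ball _ _ z(2,1)])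
      fix y assume y: "y \<in> ball z0 r"
      then obtain q t where qt: "y = (q, t)" "q \<in> chart_image c" using sub by blast
      show "(uloc c has_derivative blinfun_apply (Du c y)) (at y within ball z0 r)"
        using uloc_has_derivative[OF c qt(2), of t] unfolding qt(1) by (rule has_derivative_at_withinI)
      show "onorm (blinfun_apply (Du c y)) \<le> B"
        by (rule onorm_le) (use B(2)[of y] y in auto)
    qed
  qed
qed

text \<open>Along a piece of curve inside one chart, \<open>u\<close> is absolutely continuous as a function of time, and at almost
  every time the chain rule and the sign of the gap bound its derivative by \<open>L + k\<close>.\<close>

lemma short_curve_dominated:
  assumes ac: "ac_curve A \<gamma> a b" and int: "(\<lambda>\<tau>. L (\<gamma> \<tau>) (velocity A \<gamma> \<tau>) \<tau> + k) integrable_on {a..b}"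
    and c: "c \<in> A" and "B \<ge> 0" and st: "a \<le> s" "s \<le> t" "t \<le> b"
    and dom: "\<gamma> ` {s..t} \<subseteq> fst c"
    and Lip: "\<And>\<tau> \<tau>'. \<tau> \<in> {s..t} \<Longrightarrow> \<tau>' \<in> {s..t} \<Longrightarrow>
      norm (uloc c (snd c (\<gamma> \<tau>'), \<tau>') - uloc c (snd c (\<gamma> \<tau>), \<tau>)) \<le> B * norm ((snd c (\<gamma> \<tau>'), \<tau>') - (snd c (\<gamma> \<tau>), \<tau>))"
  shows "u (\<gamma> t, circle_of t) - u (\<gamma> s, circle_of s) \<le> integral {s..t} (\<lambda>\<tau>. L (\<gamma> \<tau>) (velocity A \<gamma> \<tau>) \<tau> + k)"
proof -
  define q where "q = snd c \<circ> \<gamma>"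
  define \<phi> where "\<phi> \<tau> = u (\<gamma> \<tau>, circle_of \<tau>)" for \<tau>
  define N where "N = {\<tau> \<in> {s<..<t}. \<not> q differentiable (at \<tau>)} \<union> {s, t}"
  have q_ac: "abs_continuous_on s t q"
    using ac c st dom unfolding ac_curve_def q_def by blast
  have \<phi>_eq: "\<phi> \<tau> = uloc c (q \<tau>, \<tau>)" if "\<tau> \<in> {s..t}" for \<tau>
  proof -
    have "\<gamma> \<tau> \<in> fst c" using that dom by blast
    then show ?thesis using c by (simp add: \<phi>_def q_def)
  qed
  have "abs_continuous_on s t \<phi>"
  proof (rule abs_continuous_on_compose_Lipschitz[OF q_ac \<open>B \<ge> 0\<close>])
    fix \<tau> \<tau>' assume \<tau>: "s \<le> \<tau>" "\<tau> \<le> \<tau>'" "\<tau>' \<le> t"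
    have "norm (\<phi> \<tau>' - \<phi> \<tau>) \<le> B * norm (q \<tau>' - q \<tau>, \<tau>' - \<tau>)"
      using Lip[of \<tau> \<tau>'] \<phi>_eq[of \<tau>] \<phi>_eq[of \<tau>'] \<tau> by (simp add: q_def)
    also have "\<dots> \<le> B * (norm (q \<tau>' - q \<tau>) + (\<tau>' - \<tau>))"
      using norm_Pair_le[of "q \<tau>' - q \<tau>" "\<tau>' - \<tau>"] \<tau> \<open>B \<ge> 0\<close> by (intro mult_left_mono) auto
    finally show "norm (\<phi> \<tau>' - \<phi> \<tau>) \<le> B * (norm (q \<tau>' - q \<tau>) + (\<tau>' - \<tau>))" .
  qed
  moreover have "(\<lambda>\<tau>. L (\<gamma> \<tau>) (velocity A \<gamma> \<tau>) \<tau> + k) integrable_on {s..t}"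
    using int by (rule integrable_on_subinterval) (use st in auto)
  moreover have "negligible N"
    unfolding N_def using abs_continuous_on_differentiable_ae[OF st(2) q_ac] by (simp add: negligible_Un)
  moreover have "\<exists>D. (\<phi> has_real_derivative D) (at \<tau> within {s..t}) \<and> D \<le> L (\<gamma> \<tau>) (velocity A \<gamma> \<tau>) \<tau> + k"
    if "\<tau> \<in> {s..t} - N" for \<tau>
  proof -
    have \<tau>: "\<tau> \<in> {s<..<t}" "q differentiable (at \<tau>)" using that by (auto simp: N_def)
    have \<gamma>\<tau>: "\<gamma> \<tau> \<in> fst c" using dom \<tau>(1) by auto
    have q\<tau>: "q \<tau> \<in> chart_image c" unfolding q_def using \<gamma>\<tau> by simp
    obtain w where w: "(q has_vector_derivative w) (at \<tau>)"
      using \<tau>(2) by (meson vector_derivative_works)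
    have cont\<tau>: "continuous (at \<tau>) \<gamma>"
    proof -
      have "continuous_on {s<..<t} \<gamma>"
        using ac st unfolding ac_curve_def by (auto intro: continuous_on_subset)
      then show ?thesis using \<tau>(1) by (simp add: continuous_on_eq_continuous_at)
    qed
    have v: "velocity A \<gamma> \<tau> = tangent_of A c (\<gamma> \<tau>) w"
      by (rule velocity_eq_tangent_of[OF cont\<tau> c \<gamma>\<tau> w[unfolded q_def]])
    have "((\<lambda>\<tau>. (q \<tau>, \<tau>)) has_derivative (\<lambda>h. (h *\<^sub>R w, h))) (at \<tau>)"
      using w unfolding has_vector_derivative_def by (auto intro!: derivative_eq_intros)
    from has_derivative_compose[OF this uloc_has_derivative[OF c q\<tau>]]
    have "((\<lambda>\<tau>. uloc c (q \<tau>, \<tau>)) has_derivative (\<lambda>h. Du c (q \<tau>, \<tau>) (h *\<^sub>R w, h))) (at \<tau>)" .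
    then have "(\<phi> has_derivative (\<lambda>h. Du c (q \<tau>, \<tau>) (h *\<^sub>R w, h))) (at \<tau>)"
      by (rule has_derivative_transform_within_open[OF _ open_greaterThanLessThan \<tau>(1)]) (simp add: \<phi>_eq)
    moreover have "(\<lambda>h. Du c (q \<tau>, \<tau>) (h *\<^sub>R w, h)) = (*) (Du c (q \<tau>, \<tau>) (w, 1))"
    proof
      fix h :: real
      show "Du c (q \<tau>, \<tau>) (h *\<^sub>R w, h) = Du c (q \<tau>, \<tau>) (w, 1) * h"
        using blinfun.scaleR_right[of "Du c (q \<tau>, \<tau>)" h "(w, 1)"] by (simp add: mult.commute)
    qed
    ultimately have "(\<phi> has_real_derivative Du c (q \<tau>, \<tau>) (w, 1)) (at \<tau>)"
      unfolding has_field_derivative_def by simp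
    then have "(\<phi> has_real_derivative Du c (q \<tau>, \<tau>) (w, 1)) (at \<tau> within {s..t})"
      by (rule has_field_derivative_at_within)
    moreover have "Du c (q \<tau>, \<tau>) (w, 1) \<le> L (\<gamma> \<tau>) (velocity A \<gamma> \<tau>) \<tau> + k"
    proof -
      have "0 \<le> loc c (q \<tau>, w, \<tau>) + k - Du c (q \<tau>, \<tau>) (w, 1)"
        using gap_nonneg[OF tangent_of_in_tangent_space[OF c \<gamma>\<tau>], of \<tau> w] gap_tangent_of[OF c \<gamma>\<tau>, of \<tau> w]
        unfolding q_def by simp
      moreover have "loc c (q \<tau>, w, \<tau>) = L (\<gamma> \<tau>) (velocity A \<gamma> \<tau>) \<tau>"
        using \<gamma>\<tau> c unfolding v q_def local_lagrangian_def by simp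
      ultimately show ?thesis by linarith
    qed
    ultimately show ?thesis by blast
  qed
  ultimately have "\<phi> t - \<phi> s \<le> integral {s..t} (\<lambda>\<tau>. L (\<gamma> \<tau>) (velocity A \<gamma> \<tau>) \<tau> + k)"
    using abs_continuous_on_le_integral[OF st(2)] by blast
  then show ?thesis unfolding \<phi>_def .
qed

text \<open>The inequality is additive in the time interval, so by bisection it suffices to have it on short intervals
  around each time. If \<open>L + k\<close> is not integrable along the curve, its action is infinite.\<close>

lemma increment_le_action:
  assumes ac: "ac_curve A \<gamma> a b"
  shows "ereal (u (\<gamma> b, circle_of b) - u (\<gamma> a, circle_of a)) \<le> action A L k \<gamma> a b"
proof -
  define f where "f \<tau> = L (\<gamma> \<tau>) (velocity A \<gamma> \<tau>) \<tau> + k" for \<tau>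
  define \<phi> where "\<phi> \<tau> = u (\<gamma> \<tau>, circle_of \<tau>)" for \<tau>
  have ab: "a \<le> b" and cont: "continuous_on {a..b} \<gamma>" using ac unfolding ac_curve_def by auto
  have "\<phi> b - \<phi> a \<le> integral {a..b} f" if "f absolutely_integrable_on {a..b}"
  proof -
    have fint: "f integrable_on {a..b}" using that unfolding absolutely_integrable_on_def by blast
    have "a \<le> a \<and> b \<le> b \<longrightarrow> \<phi> b - \<phi> a \<le> integral {a..b} f"
    proof (rule Bolzano[of a b "\<lambda>s t. a \<le> s \<and> t \<le> b \<longrightarrow> \<phi> t - \<phi> s \<le> integral {s..t} f", OF ab])
      fix x y z assume xy: "a \<le> x \<and> y \<le> b \<longrightarrow> \<phi> y - \<phi> x \<le> integral {x..y} f"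
        and yz: "a \<le> y \<and> z \<le> b \<longrightarrow> \<phi> z - \<phi> y \<le> integral {y..z} f" and le: "x \<le> y" "y \<le> z"
      show "a \<le> x \<and> z \<le> b \<longrightarrow> \<phi> z - \<phi> x \<le> integral {x..z} f"
      proof
        assume xz: "a \<le> x \<and> z \<le> b"
        then have "f integrable_on {x..z}" by (intro integrable_on_subinterval[OF fint]) auto
        then have "integral {x..y} f + integral {y..z} f = integral {x..z} f"
          by (rule Henstock_Kurzweil_Integration.integral_combine[OF le])
        then show "\<phi> z - \<phi> x \<le> integral {x..z} f" using xy yz xz le by linarith
      qed
    next
      fix x assume x: "a \<le> x" "x \<le> b"
      obtain c where c: "c \<in> A" "\<gamma> x \<in> fst c" using ex_chart by blast
      have "(snd c (\<gamma> x), x) \<in> chart_image c \<times> UNIV" using c by blast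
      then obtain r B where rB: "r > 0" "B \<ge> 0"
        "\<And>z z'. z \<in> ball (snd c (\<gamma> x), x) r \<Longrightarrow> z' \<in> ball (snd c (\<gamma> x), x) r \<Longrightarrow>
          norm (uloc c z' - uloc c z) \<le> B * norm (z' - z)"
        using uloc_locally_Lipschitz[OF c(1)] by metis
      define T where "T = {a..b} \<inter> \<gamma> -` fst c"
      have "continuous_on T (\<lambda>\<tau>. snd c (\<gamma> \<tau>))"
        by (rule continuous_on_compose2[OF continuous_on_chart[OF c(1)] continuous_on_subset[OF cont]])
          (auto simp: T_def)
      then have "continuous_on T (\<lambda>\<tau>. (snd c (\<gamma> \<tau>), \<tau>))" by (intro continuous_intros)
      then have "openin (top_of_set T) (T \<inter> (\<lambda>\<tau>. (snd c (\<gamma> \<tau>), \<tau>)) -` ball (snd c (\<gamma> x), x) r)"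
        by (rule continuous_openin_preimage_gen) simp
      moreover have "openin (top_of_set {a..b}) T"
        unfolding T_def by (rule continuous_openin_preimage_gen[OF cont open_chart_domain[OF c(1)]])
      ultimately have "openin (top_of_set {a..b}) (T \<inter> (\<lambda>\<tau>. (snd c (\<gamma> \<tau>), \<tau>)) -` ball (snd c (\<gamma> x), x) r)"
        by (rule openin_trans)
      moreover have "x \<in> T \<inter> (\<lambda>\<tau>. (snd c (\<gamma> \<tau>), \<tau>)) -` ball (snd c (\<gamma> x), x) r"
        using x c rB(1) by (simp add: T_def)
      ultimately obtain d where d: "d > 0" "ball x d \<inter> {a..b} \<subseteq> T \<inter> (\<lambda>\<tau>. (snd c (\<gamma> \<tau>), \<tau>)) -` ball (snd c (\<gamma> x), x) r"
        unfolding openin_contains_ball by blast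
      show "\<exists>d>0. \<forall>s t. s \<le> x \<and> x \<le> t \<and> t - s < d \<longrightarrow> a \<le> s \<and> t \<le> b \<longrightarrow> \<phi> t - \<phi> s \<le> integral {s..t} f"
      proof (intro exI[of _ d] conjI allI impI d(1))
        fix s t assume st: "s \<le> x \<and> x \<le> t \<and> t - s < d" and ab': "a \<le> s \<and> t \<le> b"
        have near: "\<gamma> \<tau> \<in> fst c" "(snd c (\<gamma> \<tau>), \<tau>) \<in> ball (snd c (\<gamma> x), x) r" if "\<tau> \<in> {s..t}" for \<tau>
        proof -
          have "\<tau> \<in> ball x d \<inter> {a..b}" using that st ab' by (auto simp: dist_real_def)
          then have "\<tau> \<in> T \<inter> (\<lambda>\<tau>. (snd c (\<gamma> \<tau>), \<tau>)) -` ball (snd c (\<gamma> x), x) r" using d(2) by blast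
          then show "\<gamma> \<tau> \<in> fst c" "(snd c (\<gamma> \<tau>), \<tau>) \<in> ball (snd c (\<gamma> x), x) r" unfolding T_def by blast+
        qed
        show "\<phi> t - \<phi> s \<le> integral {s..t} f"
          unfolding \<phi>_def f_def
        proof (rule short_curve_dominated[OF ac fint[unfolded f_def] c(1) rB(2)])
          show "\<gamma> ` {s..t} \<subseteq> fst c" using near(1) by blast
          show "s \<le> t" "a \<le> s" "t \<le> b" using st ab' by auto
        qed (rule rB(3)[OF near(2) near(2)])
      qed
    qed
    then show ?thesis by simp
  qed
  then show ?thesis unfolding action_def Let_def f_def[symmetric] \<phi>_def[symmetric] by simp
qed

lemma dominated: "dominated A L k u"
  unfolding dominated_def action_potential_def action_potential_n_def
proof (intro allI INF_greatest)
  fix X Y n \<Gamma> assume "\<Gamma> \<in> connecting_curves A X Y n"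
  then obtain \<gamma> a b where \<Gamma>: "\<Gamma> = (\<gamma>, a, b)" "ac_curve A \<gamma> a b" "X = (\<gamma> a, circle_of a)" "Y = (\<gamma> b, circle_of b)"
    unfolding connecting_curves_def by (auto simp: prod_eq_iff)
  show "ereal (u Y - u X) \<le> (case \<Gamma> of (\<gamma>, a, b) \<Rightarrow> action A L k \<gamma> a b)"
    using increment_le_action[OF \<Gamma>(2)] unfolding \<Gamma>(1,3,4) by simp
qed

lemma continuous_on_lagrangian_along_C1_curve:
  assumes \<gamma>: "C1_curve \<gamma> V S"
  shows "continuous_on S (\<lambda>\<tau>. L (\<gamma> \<tau>) (V \<tau>) \<tau>)"
proof (rule continuous_on_if_locally_openin)
  fix \<tau> assume \<tau>: "\<tau> \<in> S"
  have cont: "continuous_on S \<gamma>" and tan: "\<And>\<tau>. \<tau> \<in> S \<Longrightarrow> V \<tau> \<in> tangent_space A (\<gamma> \<tau>)"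
    using \<gamma> unfolding C1_curve_def by blast+
  obtain c where c: "c \<in> A" "\<gamma> \<tau> \<in> fst c" using ex_chart by blast
  let ?T = "{\<tau>\<in>S. \<gamma> \<tau> \<in> fst c}"
  have T: "?T = S \<inter> \<gamma> -` fst c" by blast
  have "openin (top_of_set S) ?T"
    unfolding T by (rule continuous_openin_preimage_gen[OF cont open_chart_domain[OF c(1)]])
  moreover have "continuous_on ?T (\<lambda>\<tau>. L (\<gamma> \<tau>) (V \<tau>) \<tau>)"
  proof -
    have "continuous_on ?T (\<lambda>\<tau>. V \<tau> c)" using \<gamma> c(1) unfolding C1_curve_def by blast
    moreover have "continuous_on ?T (\<lambda>\<tau>. snd c (\<gamma> \<tau>))"
      by (rule continuous_on_compose2[OF continuous_on_chart[OF c(1)] continuous_on_subset[OF cont]]) auto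
    ultimately have "continuous_on ?T (\<lambda>\<tau>. (snd c (\<gamma> \<tau>), V \<tau> c, \<tau>))" by (intro continuous_intros)
    then have "continuous_on ?T (\<lambda>\<tau>. loc c (snd c (\<gamma> \<tau>), V \<tau> c, \<tau>))"
      by (rule continuous_on_compose2[OF continuous_on_loc[OF c(1)]]) auto
    then show ?thesis
    proof (rule continuous_on_eq)
      fix \<tau> assume "\<tau> \<in> ?T"
      then show "loc c (snd c (\<gamma> \<tau>), V \<tau> c, \<tau>) = L (\<gamma> \<tau>) (V \<tau>) \<tau>"
        using loc_tangent[OF c(1)] tan by blast
    qed
  qed
  ultimately show "\<exists>T. openin (top_of_set S) T \<and> \<tau> \<in> T \<and> continuous_on T (\<lambda>\<tau>. L (\<gamma> \<tau>) (V \<tau>) \<tau>)"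
    using \<tau> c(2) by blast
qed

text \<open>At the two end times the velocity may differ from \<open>V\<close>, which does not affect the integral.\<close>

lemma C1_curve_action:
  assumes \<gamma>: "C1_curve \<gamma> V {a..b}" and "a \<le> b"
  shows "action A L k' \<gamma> a b = ereal (integral {a..b} (\<lambda>\<tau>. L (\<gamma> \<tau>) (V \<tau>) \<tau>) + k' * (b - a))"
proof -
  define f where "f \<tau> = L (\<gamma> \<tau>) (V \<tau>) \<tau> + k'" for \<tau>
  define g where "g \<tau> = L (\<gamma> \<tau>) (velocity A \<gamma> \<tau>) \<tau> + k'" for \<tau>
  have cont: "continuous_on {a..b} (\<lambda>\<tau>. L (\<gamma> \<tau>) (V \<tau>) \<tau>)"
    by (rule continuous_on_lagrangian_along_C1_curve[OF \<gamma>])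
  have eq: "g \<tau> = f \<tau>" if "\<tau> \<in> {a..b} - {a, b}" for \<tau>
  proof -
    have "\<tau> \<in> interior {a..b}" using that by auto
    then show ?thesis using C1_curve_velocity[OF \<gamma>] by (simp add: f_def g_def)
  qed
  have N: "negligible {a, b}" by simp
  have "f absolutely_integrable_on {a..b}"
    unfolding f_def using cont by (intro absolutely_integrable_continuous_real continuous_intros)
  then have "g absolutely_integrable_on {a..b}"
    by (rule absolutely_integrable_spike[OF _ N]) (rule eq)
  moreover have "integral {a..b} g = integral {a..b} f"
    by (rule integral_spike[OF N]) (simp add: eq)
  moreover have "integral {a..b} f = integral {a..b} (\<lambda>\<tau>. L (\<gamma> \<tau>) (V \<tau>) \<tau>) + k' * (b - a)"
    unfolding f_def using \<open>a \<le> b\<close> cont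
    by (subst integral_add) (auto intro: integrable_continuous_interval)
  ultimately show ?thesis unfolding action_def Let_def g_def[symmetric] by simp
qed

text \<open>The chain rule and the vanishing of the gap give \<open>L + k\<close> as the derivative of \<open>u\<close> along the curve.\<close>

lemma calibrated_integral:
  assumes \<gamma>: "integral_curve calibrated_velocity \<gamma> {a..b}" and "a \<le> b"
  shows "integral {a..b} (\<lambda>\<tau>. L (\<gamma> \<tau>) (calibrated_velocity (\<gamma> \<tau>) \<tau>) \<tau>) + k * (b - a)
       = u (\<gamma> b, circle_of b) - u (\<gamma> a, circle_of a)"
proof -
  define f where "f \<tau> = L (\<gamma> \<tau>) (calibrated_velocity (\<gamma> \<tau>) \<tau>) \<tau>" for \<tau>
  have "((\<lambda>\<tau>. u (\<gamma> \<tau>, circle_of \<tau>)) has_vector_derivative f \<tau> + k) (at \<tau> within {a..b})"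
    if \<tau>: "\<tau> \<in> {a..b}" for \<tau>
  proof -
    obtain c where c: "c \<in> A" "\<gamma> \<tau> \<in> fst c" using ex_chart by blast
    define q where "q = snd c \<circ> \<gamma>"
    define w where "w = calibrated_velocity (\<gamma> \<tau>) \<tau> c"
    have q\<tau>: "q \<tau> \<in> chart_image c" unfolding q_def using c by simp
    have "(q has_vector_derivative w) (at \<tau> within {a..b})"
      using \<gamma> \<tau> c unfolding integral_curve_def q_def w_def by blast
    then have "((\<lambda>\<tau>. (q \<tau>, \<tau>)) has_derivative (\<lambda>h. (h *\<^sub>R w, h))) (at \<tau> within {a..b})"
      unfolding has_vector_derivative_def by (auto intro!: derivative_eq_intros)
    from has_derivative_compose[OF this uloc_has_derivative[OF c(1) q\<tau>]]
    have "((\<lambda>\<tau>. uloc c (q \<tau>, \<tau>)) has_derivative (\<lambda>h. Du c (q \<tau>, \<tau>) (h *\<^sub>R w, h))) (at \<tau> within {a..b})" .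
    moreover have "(\<lambda>h. Du c (q \<tau>, \<tau>) (h *\<^sub>R w, h)) = (\<lambda>h. h *\<^sub>R (f \<tau> + k))"
    proof
      fix h :: real
      have "f \<tau> + k = Du c (q \<tau>, \<tau>) (w, 1)"
        using gap_calibrated_velocity[of "\<gamma> \<tau>" \<tau>] gap_in_chart[OF c calibrated_velocity_tangent[of "\<gamma> \<tau>" \<tau>], of \<tau>]
          loc_tangent[OF c calibrated_velocity_tangent[of "\<gamma> \<tau>" \<tau>], of \<tau>]
        unfolding f_def q_def w_def by simp
      then show "Du c (q \<tau>, \<tau>) (h *\<^sub>R w, h) = h *\<^sub>R (f \<tau> + k)"
        using blinfun.scaleR_right[of "Du c (q \<tau>, \<tau>)" h "(w, 1)"] by simp
    qed
    ultimately have "((\<lambda>\<tau>. uloc c (q \<tau>, \<tau>)) has_derivative (\<lambda>h. h *\<^sub>R (f \<tau> + k))) (at \<tau> within {a..b})"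
      by simp
    then show ?thesis
      unfolding has_vector_derivative_def
    proof (rule has_derivative_transform_eventually)
      have "continuous (at \<tau> within {a..b}) \<gamma>"
        using \<gamma> \<tau> unfolding integral_curve_def continuous_on_eq_continuous_within by blast
      from continuous_imp_eventually_in_chart[OF this c]
      show "\<forall>\<^sub>F \<sigma> in at \<tau> within {a..b}. uloc c (q \<sigma>, \<sigma>) = u (\<gamma> \<sigma>, circle_of \<sigma>)"
        by eventually_elim (simp add: q_def c(1))
    qed (use c \<tau> in \<open>simp_all add: q_def\<close>)
  qed
  then have I: "((\<lambda>\<tau>. f \<tau> + k) has_integral (u (\<gamma> b, circle_of b) - u (\<gamma> a, circle_of a))) {a..b}"
    by (rule fundamental_theorem_of_calculus[OF \<open>a \<le> b\<close>])
  have "f integrable_on {a..b}"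
    unfolding f_def
    by (rule integrable_continuous_interval[OF continuous_on_lagrangian_along_C1_curve[OF
          integral_curve_imp_C1_curve[OF calibrated_velocity_field \<gamma>]]])
  then have "integral {a..b} (\<lambda>\<tau>. f \<tau> + k) = integral {a..b} f + k * (b - a)"
    using \<open>a \<le> b\<close> by (subst integral_add) auto
  with integral_unique[OF I] show ?thesis unfolding f_def by simp
qed

lemma calibrated_curve_action:
  assumes \<gamma>: "integral_curve calibrated_velocity \<gamma> {a..b}" and "a \<le> b"
  shows "action A L k' \<gamma> a b = ereal (u (\<gamma> b, circle_of b) - u (\<gamma> a, circle_of a) + (k' - k) * (b - a))"
  using C1_curve_action[OF integral_curve_imp_C1_curve[OF calibrated_velocity_field \<gamma>] \<open>a \<le> b\<close>, of k']
    calibrated_integral[OF assms] by (simp add: algebra_simps)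

lemma calibrated_curve_ac:
  assumes \<gamma>: "integral_curve calibrated_velocity \<gamma> {a..b}" and "a \<le> b"
  shows "ac_curve A \<gamma> a b"
  by (rule Lipschitz_curve_imp_ac_curve[OF C1_curve_imp_Lipschitz_curve[OF
        integral_curve_imp_C1_curve[OF calibrated_velocity_field \<gamma>] \<open>a \<le> b\<close>]])

section \<open>The critical value and weak KAM solutions\<close>

text \<open>By periodicity in time, \<open>L\<close> need only be bounded on a compact set of positions, velocities and times.\<close>

lemma chart_segment_action_bound:
  assumes c: "c \<in> A" and r: "cball p r \<subseteq> chart_image c"
  obtains B where "\<And>q0 q1 m. q0 \<in> cball p r \<Longrightarrow> q1 \<in> cball p r \<Longrightarrow>
    integral {m..m + 1} (\<lambda>\<tau>. L (chart_segment c q0 q1 m \<tau>)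
      (tangent_of A c (chart_segment c q0 q1 m \<tau>) (q1 - q0)) \<tau>) \<le> B"
proof -
  let ?K = "cball p r \<times> cball (0::'e) (2 * r) \<times> {0..1::real}"
  have "compact ?K" by (intro compact_Times compact_cball compact_Icc)
  moreover have "?K \<subseteq> chart_image c \<times> UNIV \<times> UNIV" using r by blast
  ultimately have "bounded (loc c ` ?K)"
    by (intro compact_imp_bounded compact_continuous_image continuous_on_subset[OF continuous_on_loc[OF c]])
  then obtain B where B: "\<And>z. z \<in> ?K \<Longrightarrow> \<bar>loc c z\<bar> \<le> B" unfolding bounded_real by blast
  have loc_bound: "loc c (q, w, t) \<le> B" if q: "q \<in> cball p r" and w: "norm w \<le> 2 * r" for q w t
  proof -
    have x: "chart_inv c q \<in> fst c" using chart_inv_in_domain[OF c] q r by blast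
    have "loc c (q, w, t + 1) = loc c (q, w, t)" for t
      using L_periodic[OF tangent_of_in_tangent_space[OF c x]] by (simp add: local_lagrangian_def)
    then have "loc c (q, w, frac t) = loc c (q, w, t)" by (rule periodic_frac)
    moreover have "frac t \<in> {0..1}" using frac_lt_1[of t] frac_ge_0[of t] by auto
    ultimately show ?thesis using B[of "(q, w, frac t)"] q w by force
  qed
  show thesis
  proof (rule that[of B])
    fix q0 q1 m assume q: "q0 \<in> cball p r" "q1 \<in> cball p r"
    define q where "q \<tau> = q0 + (\<tau> - m) *\<^sub>R (q1 - q0)" for \<tau>
    define f where "f \<tau> = L (chart_inv c (q \<tau>)) (tangent_of A c (chart_inv c (q \<tau>)) (q1 - q0)) \<tau>" for \<tau>
    have "f integrable_on {m..m + 1}"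
      unfolding f_def q_def
      by (rule integrable_continuous_interval[OF continuous_on_lagrangian_along_C1_curve[OF
            C1_curve_chart_segment[OF c convex_cball r q]]])
    moreover have "f \<tau> \<le> B" if "\<tau> \<in> {m..m + 1}" for \<tau>
    proof -
      have "(1 - (\<tau> - m)) *\<^sub>R q0 + (\<tau> - m) *\<^sub>R q1 \<in> cball p r"
        by (rule convexD_alt[OF convex_cball q]) (use that in auto)
      moreover have "(1 - (\<tau> - m)) *\<^sub>R q0 + (\<tau> - m) *\<^sub>R q1 = q \<tau>" by (simp add: q_def algebra_simps)
      ultimately have "q \<tau> \<in> cball p r" by simp
      moreover have "norm (q1 - q0) \<le> 2 * r"
        using q norm_triangle_sub[of q1 q0] dist_triangle2[of q1 q0 p] by (simp add: dist_norm norm_minus_commute)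
      ultimately have "loc c (q \<tau>, q1 - q0, \<tau>) \<le> B" by (rule loc_bound)
      then show ?thesis by (simp add: f_def local_lagrangian_def)
    qed
    ultimately have "integral {m..m + 1} f \<le> integral {m..m + 1} (\<lambda>_. B)"
      by (intro integral_le) auto
    then have "integral {m..m + 1} f \<le> B" by simp
    then show "integral {m..m + 1} (\<lambda>\<tau>. L (chart_segment c q0 q1 m \<tau>)
      (tangent_of A c (chart_segment c q0 q1 m \<tau>) (q1 - q0)) \<tau>) \<le> B"
      unfolding f_def q_def .
  qed
qed

text \<open>Finitely many coordinate balls cover the manifold, so one of them contains the curve at infinitely many integer times.\<close>

lemma recurrent_chart_ball:
  fixes \<gamma> :: "real \<Rightarrow> 'a"
  assumes comp: "compact (UNIV :: 'a set)"
  obtains c p r where "c \<in> A" "cball p r \<subseteq> chart_image c"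
    "infinite {n :: nat. \<gamma> (real n) \<in> fst c \<and> snd c (\<gamma> (real n)) \<in> cball p r}"
proof -
  define good where "good x cr \<longleftrightarrow> fst cr \<in> A \<and> x \<in> fst (fst cr) \<and> snd cr > 0 \<and>
      cball (snd (fst cr) x) (snd cr) \<subseteq> chart_image (fst cr) \<and>
      open (fst (fst cr) \<inter> snd (fst cr) -` ball (snd (fst cr) x) (snd cr))" for x cr
  have "\<exists>cr. good x cr" for x
  proof -
    obtain c r where "c \<in> A" "x \<in> fst c" "r > 0" "cball (snd c x) r \<subseteq> chart_image c"
      "open (fst c \<inter> snd c -` ball (snd c x) r)"
      by (rule relatively_compact_chart_ball)
    then have "good x (c, r)" by (simp add: good_def)
    then show ?thesis by blast
  qed
  then obtain cr where cr: "\<And>x. good x (cr x)" by metis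
  define C where "C x = fst (cr x)" for x
  define r where "r x = snd (cr x)" for x
  have Cr: "C x \<in> A" "x \<in> fst (C x)" "r x > 0" "cball (snd (C x) x) (r x) \<subseteq> chart_image (C x)"
    "open (fst (C x) \<inter> snd (C x) -` ball (snd (C x) x) (r x))" for x
    using cr[of x] unfolding good_def C_def r_def by blast+
  define U where "U x = fst (C x) \<inter> snd (C x) -` ball (snd (C x) x) (r x)" for x
  have "x \<in> U x" for x using Cr(2,3) by (simp add: U_def)
  then have cover: "UNIV \<subseteq> (\<Union>x\<in>UNIV. U x)" by blast
  obtain X where X: "X \<subseteq> UNIV" "finite X" "UNIV \<subseteq> (\<Union>x\<in>X. U x)"
    by (rule compactE_image[OF comp _ cover]) (use Cr(5) in \<open>simp_all add: U_def\<close>)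
  have "\<exists>x. x \<in> X \<and> \<gamma> (real n) \<in> U x" for n using X(3) by blast
  then obtain h where h: "\<And>n :: nat. h n \<in> X \<and> \<gamma> (real n) \<in> U (h n)" by metis
  have "range h \<subseteq> X" using h by blast
  then have "finite (h ` UNIV)" using X(2) by (rule finite_subset)
  then obtain n0 where n0: "infinite {n \<in> UNIV. h n = h n0}"
    using pigeonhole_infinite[of UNIV h] by auto
  let ?x = "h n0"
  have "{n \<in> UNIV. h n = ?x} \<subseteq> {n. \<gamma> (real n) \<in> fst (C ?x) \<and> snd (C ?x) (\<gamma> (real n)) \<in> cball (snd (C ?x) ?x) (r ?x)}"
  proof
    fix n assume "n \<in> {n \<in> UNIV. h n = ?x}"
    then have "\<gamma> (real n) \<in> U ?x" using h[of n] by simp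
    then show "n \<in> {n. \<gamma> (real n) \<in> fst (C ?x) \<and> snd (C ?x) (\<gamma> (real n)) \<in> cball (snd (C ?x) ?x) (r ?x)}"
      unfolding U_def by simp
  qed
  then show thesis
    by (rule that[OF Cr(1) Cr(4) infinite_super[OF _ n0]])
qed

text \<open>Follow the calibrated curve from time \<open>n\<close> to time \<open>m\<close>, then the coordinate segment from \<open>\<gamma> m\<close>
  back to \<open>\<gamma> n\<close> in one unit of time.\<close>

lemma closed_curve_action:
  assumes \<gamma>: "integral_curve calibrated_velocity \<gamma> {n..m}" and nm: "n \<le> m"
    and c: "c \<in> A" "cball p r \<subseteq> chart_image c"
    and ends: "\<gamma> n \<in> fst c" "snd c (\<gamma> n) \<in> cball p r" "\<gamma> m \<in> fst c" "snd c (\<gamma> m) \<in> cball p r"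
    and B: "\<And>q0 q1 m. q0 \<in> cball p r \<Longrightarrow> q1 \<in> cball p r \<Longrightarrow>
      integral {m..m + 1} (\<lambda>\<tau>. L (chart_segment c q0 q1 m \<tau>)
      (tangent_of A c (chart_segment c q0 q1 m \<tau>) (q1 - q0)) \<tau>) \<le> B"
  shows "\<exists>\<Gamma> a. ac_curve A \<Gamma> n (m + 1) \<and> \<Gamma> n = \<Gamma> (m + 1) \<and> action A L k' \<Gamma> n (m + 1) = ereal a \<and>
     a \<le> u (\<gamma> m, circle_of m) - u (\<gamma> n, circle_of n) + (k' - k) * (m - n) + B + k'"
proof -
  define q0 where "q0 = snd c (\<gamma> m)"
  define q1 where "q1 = snd c (\<gamma> n)"
  define \<sigma> where "\<sigma> \<tau> = chart_segment c q0 q1 m \<tau>" for \<tau>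
  define V where "V \<tau> = tangent_of A c (\<sigma> \<tau>) (q1 - q0)" for \<tau>
  define \<Gamma> where "\<Gamma> \<tau> = (if \<tau> \<le> m then \<gamma> \<tau> else \<sigma> \<tau>)" for \<tau>
  have q: "q0 \<in> cball p r" "q1 \<in> cball p r" using ends by (simp_all add: q0_def q1_def)
  have \<sigma>m: "\<sigma> m = \<gamma> m" "\<sigma> (m + 1) = \<gamma> n" using ends c by (simp_all add: \<sigma>_def q0_def q1_def)
  have \<sigma>: "C1_curve \<sigma> V {m..m + 1}"
    unfolding \<sigma>_def V_def by (rule C1_curve_chart_segment[OF c(1) convex_cball c(2) q])
  have 1: "integral_curve calibrated_velocity \<Gamma> {n..m}"
    by (rule integral_curve_cong[OF \<gamma>]) (simp add: \<Gamma>_def)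
  have 2: "C1_curve \<Gamma> V {m..m + 1}"
    by (rule C1_curve_cong[OF \<sigma>]) (use \<sigma>m in \<open>auto simp: \<Gamma>_def\<close>)
  have "Lipschitz_curve \<Gamma> n (m + 1)"
    using Lipschitz_curve_join[OF C1_curve_imp_Lipschitz_curve[OF
        integral_curve_imp_C1_curve[OF calibrated_velocity_field 1] nm] C1_curve_imp_Lipschitz_curve[OF 2]] by simp
  then have "ac_curve A \<Gamma> n (m + 1)" by (rule Lipschitz_curve_imp_ac_curve)
  moreover have "\<Gamma> n = \<Gamma> (m + 1)" using nm \<sigma>m by (simp add: \<Gamma>_def)
  moreover define J where "J = integral {m..m + 1} (\<lambda>\<tau>. L (\<Gamma> \<tau>) (V \<tau>) \<tau>)"
  have segment: "action A L k' \<Gamma> m (m + 1) = ereal (J + k')"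
    using C1_curve_action[OF 2, of k'] unfolding J_def by simp
  have "action A L k' \<Gamma> n (m + 1)
      = ereal (u (\<Gamma> m, circle_of m) - u (\<Gamma> n, circle_of n) + (k' - k) * (m - n) + (J + k'))"
    by (rule action_join[OF calibrated_curve_action[OF 1 nm] segment nm]) simp
  moreover have "J \<le> B"
  proof -
    have "J = integral {m..m + 1} (\<lambda>\<tau>. L (\<sigma> \<tau>) (V \<tau>) \<tau>)"
      unfolding J_def by (rule integral_cong) (use \<sigma>m in \<open>auto simp: \<Gamma>_def\<close>)
    also have "\<dots> \<le> B" unfolding V_def \<sigma>_def by (rule B[OF q])
    finally show ?thesis .
  qed
  moreover have "\<Gamma> m = \<gamma> m" "\<Gamma> n = \<gamma> n" using nm by (simp_all add: \<Gamma>_def)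
  ultimately show ?thesis
    by (intro exI[of _ \<Gamma>] exI[of _ "u (\<Gamma> m, circle_of m) - u (\<Gamma> n, circle_of n) + (k' - k) * (m - n) + (J + k')"]) auto
qed

text \<open>That \<open>k\<close> is admissible is domination on closed curves. For \<open>k' < k\<close> the closed curves obtained from a
  recurrent calibrated curve have negative action as soon as they are long enough.\<close>

lemma critical_value_eq:
  assumes comp: "compact (UNIV :: 'a set)"
  shows "critical_value A L = k"
  unfolding critical_value_def
proof (rule Least_equality)
  show "\<forall>\<gamma> a b. ac_curve A \<gamma> a b \<and> \<gamma> a = \<gamma> b \<and> b - a \<in> \<int> \<longrightarrow> 0 \<le> action A L k \<gamma> a b"
  proof (intro allI impI)
    fix \<gamma> a b assume \<gamma>: "ac_curve A \<gamma> a b \<and> \<gamma> a = \<gamma> b \<and> b - a \<in> \<int>"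
    then have "circle_of b = circle_of a" by (simp add: circle.abs_eq_iff)
    then show "0 \<le> action A L k \<gamma> a b"
      using increment_le_action[of \<gamma> a b] \<gamma> by (simp add: zero_ereal_def)
  qed
  fix k' assume k': "\<forall>\<gamma> a b. ac_curve A \<gamma> a b \<and> \<gamma> a = \<gamma> b \<and> b - a \<in> \<int> \<longrightarrow> 0 \<le> action A L k' \<gamma> a b"
  show "k \<le> k'"
  proof (rule ccontr)
    assume "\<not> k \<le> k'"
    then have pos: "k - k' > 0" by simp
    obtain \<gamma> where \<gamma>: "integral_curve calibrated_velocity \<gamma> {0..}"
      using forward_integral_curve_exists[OF comp calibrated_velocity_field calibrated_velocity_periodic] by blast
    obtain c p r where c: "c \<in> A" "cball p r \<subseteq> chart_image c" and
      inf: "infinite {n :: nat. \<gamma> (real n) \<in> fst c \<and> snd c (\<gamma> (real n)) \<in> cball p r}" (is "infinite ?I")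
      using recurrent_chart_ball[OF comp, of \<gamma>] by blast
    obtain B where B: "\<And>q0 q1 m. q0 \<in> cball p r \<Longrightarrow> q1 \<in> cball p r \<Longrightarrow>
      integral {m..m + 1} (\<lambda>\<tau>. L (chart_segment c q0 q1 m \<tau>)
      (tangent_of A c (chart_segment c q0 q1 m \<tau>) (q1 - q0)) \<tau>) \<le> B"
      using chart_segment_action_bound[OF c] by blast
    have "continuous_on (cball p r) (\<lambda>q. uloc c (q, 0))"
    proof (rule continuous_at_imp_continuous_on, rule ballI)
      fix q assume "q \<in> cball p r"
      then have "q \<in> chart_image c" using c(2) by blast
      then show "isCont (\<lambda>q. uloc c (q, 0)) q"
        using has_derivative_continuous[OF uloc_space_derivative[OF c(1), of q 0]] by simp
    qed
    then have "bounded ((\<lambda>q. uloc c (q, 0)) ` cball p r)"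
      by (intro compact_imp_bounded compact_continuous_image compact_cball)
    then obtain M where M: "\<And>q. q \<in> cball p r \<Longrightarrow> \<bar>uloc c (q, 0)\<bar> \<le> M" unfolding bounded_real by blast
    have uM: "\<bar>u (\<gamma> (real n), circle_of (real n))\<bar> \<le> M" if "n \<in> ?I" for n
      using M[of "snd c (\<gamma> (real n))"] that c(1) circle_of_nat by simp
    obtain n where n: "n \<in> ?I" using infinite_imp_nonempty[OF inf] by blast
    \<comment> \<open>For \<open>m - n > T\<close> the bound \<open>2 * M + (k' - k) * (m - n) + B + k'\<close> of the action is negative.\<close>
    define T where "T = (2 * M + B + k') / (k - k')"
    obtain m where m: "m \<in> ?I" "nat \<lceil>T\<rceil> + n + 1 < m"
      using inf unfolding infinite_nat_iff_unbounded by blast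
    have mn: "T < real m - real n" "real n \<le> real m" using m(2) by linarith+
    have \<gamma>nm: "integral_curve calibrated_velocity \<gamma> {real n..real m}"
      by (rule integral_curve_subset[OF \<gamma>]) auto
    obtain \<Gamma> a where \<Gamma>: "ac_curve A \<Gamma> (real n) (real m + 1)" "\<Gamma> (real n) = \<Gamma> (real m + 1)"
      "action A L k' \<Gamma> (real n) (real m + 1) = ereal a"
      "a \<le> u (\<gamma> (real m), circle_of (real m)) - u (\<gamma> (real n), circle_of (real n)) + (k' - k) * (real m - real n) + B + k'"
      using closed_curve_action[OF \<gamma>nm mn(2) c _ _ _ _ B, of k'] n m(1) by blast
    have "real m + 1 - real n \<in> \<int>" by (intro Ints_diff Ints_add Ints_of_nat Ints_1)
    then have "0 \<le> a" using k' \<Gamma>(1,2,3) by (metis ereal_less_eq(5))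
    moreover have "T * (k - k') < (real m - real n) * (k - k')" using mn(1) pos by (rule mult_strict_right_mono)
    then have "2 * M + B + k' < (real m - real n) * (k - k')" using pos by (simp add: T_def)
    ultimately show False using \<Gamma>(4) uM[OF n] uM[OF m(1)] by (simp add: algebra_simps)
  qed
qed

lemma forward_weak_KAM_solution:
  assumes comp: "compact (UNIV :: 'a set)"
  shows "u \<in> forward_weak_KAM A L"
  unfolding forward_weak_KAM_def mem_Collect_eq critical_value_eq[OF comp]
proof (intro conjI dominated allI)
  fix x s
  obtain \<gamma> where \<gamma>: "\<gamma> s = x" "integral_curve calibrated_velocity \<gamma> {s..}"
    using forward_integral_curve_exists[OF comp calibrated_velocity_field calibrated_velocity_periodic] by blast
  have "integral_curve calibrated_velocity \<gamma> {s..t}" for t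
    by (rule integral_curve_subset[OF \<gamma>(2)]) auto
  then show "\<exists>\<gamma>. \<gamma> s = x \<and> (\<forall>t>s. ac_curve A \<gamma> s t \<and>
        ereal (u (\<gamma> t, circle_of t) - u (x, circle_of s)) = action A L k \<gamma> s t)"
    using \<gamma>(1) calibrated_curve_ac calibrated_curve_action[of \<gamma> s _ k] by (intro exI[of _ \<gamma>]) auto
qed

lemma backward_weak_KAM_solution:
  assumes comp: "compact (UNIV :: 'a set)"
  shows "u \<in> backward_weak_KAM A L"
  unfolding backward_weak_KAM_def mem_Collect_eq critical_value_eq[OF comp]
proof (intro conjI dominated allI)
  fix x s
  obtain \<gamma> where \<gamma>: "\<gamma> s = x" "integral_curve calibrated_velocity \<gamma> {..s}"
    using backward_integral_curve_exists[OF comp calibrated_velocity_field calibrated_velocity_periodic] by blast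
  have "integral_curve calibrated_velocity \<gamma> {t..s}" for t
    by (rule integral_curve_subset[OF \<gamma>(2)]) auto
  then show "\<exists>\<gamma>. \<gamma> s = x \<and> (\<forall>t<s. ac_curve A \<gamma> t s \<and>
        ereal (u (x, circle_of s) - u (\<gamma> t, circle_of t)) = action A L k \<gamma> t s)"
    using \<gamma>(1) calibrated_curve_ac calibrated_curve_action[of \<gamma> _ s k] by (intro exI[of _ \<gamma>]) auto
qed

end

theorem corollary14:
  fixes A :: "('a::t2_space, 'e::euclidean_space) chart set"
    and L :: "('a, 'e) lagrangian"
    and u :: "'a \<times> circle \<Rightarrow> real"
    and k :: real
  assumes "compact (UNIV :: 'a set)" and "connected (UNIV :: 'a set)"
    and "smooth_atlas A"
    and "smooth_lagrangian A L"
    and "convex_lagrangian A L"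
    and "superlinear_lagrangian A L"
    and "periodic_lagrangian A L"
    and "complete_lagrangian A L"
    and "C1_Lip A u"
    and "hamilton_jacobi A L k u"
  shows "k = critical_value A L \<and> u \<in> backward_weak_KAM A L \<inter> forward_weak_KAM A L"
proof -
  interpret C1_Hamilton_Jacobi_solution A L u k
    by unfold_locales (use assms in auto)
  show ?thesis using critical_value_eq forward_weak_KAM_solution backward_weak_KAM_solution assms(1) by simp
qed

end
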